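(* Let $R$ be an excellent two-dimensional local domain with quotient field $K$, and let $\nu$ be a valuation of $K$ centered at $R$. Let $L$ be a finite separable extension of $K$ and let $\omega$ be an extension of $\nu$ to $L$. If $d(\omega\mid\nu)=1$ and $\epsilon(\omega\mid\nu)=e(\omega\mid\nu)$, then $\mathcal{O}_\omega$ is essentially finitely generated over $\mathcal{O}_\nu$.
   Context: $\nu$ is centered at (in) $R$ if $R\subset\mathcal{O}_\nu$ and $\mathfrak{m}_\nu\cap R=\mathfrak{m}_R$, where $\mathfrak m_R$ is the maximal ideal of $R$. For a finite field extension $L|K$ and a valuation $\omega$ on $L$ with restriction $\nu$ to $K$: $\mathcal{O}_\omega,\mathcal{O}_\nu$ are the valuation rings, $\mathfrak m_\omega,\mathfrak m_\nu$ their maximal ideals, $\Gamma_\omega\supseteq\Gamma_\nu$ the value groups (totally ordered abelian groups), $L\omega\supseteq K\nu$ the residue fields. Put $e(\omega|\nu)=(\Gamma_\omega:\Gamma_\nu)$ and $f(\omega|\nu)=[L\omega:K\nu]$. Initial index: for an extension $\Delta\subseteq\Gamma$ of ordered abelian groups, $\epsilon(\Gamma\mid\Delta)=|\{\gamma\in\Gamma\mid \gamma\ge 0 \text{ and } \gamma<\delta\text{ for all }\delta\in\Delta\text{ with }\delta>0\}|$; and $\epsilon(\omega|\nu)=\epsilon(\Gamma_\omega\mid\Gamma_\nu)$. Defect: fix an extension $\overline\nu$ of $\omega$ to an algebraic closure $\overline K$ of $L$. The henselization $K^h$ of $(K,\nu)$ is the smallest field with $K\subseteq K^h\subseteq\overline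 K$ such that $\overline\nu$ is the only extension of $\overline\nu|_{K^h}$ to $\overline K$; $L^h$ is defined likewise for $(L,\omega)$. The defect is $d(\omega|\nu)=\dfrac{[L^h:K^h]}{e(\omega|\nu)f(\omega|\nu)}$, a positive integer. A ring extension $A\subseteq B$ is essentially finitely generated if there are $x_1,\ldots,x_r\in B$ and a multiplicative set $S\subseteq A[x_1,\ldots,x_r]$ with $B=S^{-1}A[x_1,\ldots,x_r]$. *)

theory Defs
  imports "HOL-Algebra.Algebra" "HOL-Library.Multiset" "HOL-Library.Extended_Nat"
begin

section \<open>Prime spectrum, dimension, local and regular rings\<close>

definition local_ring :: "('a, 'm) ring_scheme \<Rightarrow> bool"
  where "local_ring R \<longleftrightarrow> cring R \<and> (\<exists>!M. maximalideal M R)"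

definition max_ideal :: "('a, 'm) ring_scheme \<Rightarrow> 'a set"
  where "max_ideal R = (THE M. maximalideal M R)"

text \<open>A chain \<open>P\<^sub>0 \<subset> \<dots> \<subset> P\<^sub>n\<close> of prime ideals is the list
  \<open>[P\<^sub>0, \<dots>, P\<^sub>n]\<close>; its length in the sense of dimension theory is \<open>n\<close>.\<close>

definition prime_chain :: "('a, 'm) ring_scheme \<Rightarrow> 'a set list \<Rightarrow> bool"
  where "prime_chain R Ps \<longleftrightarrow>
    Ps \<noteq> [] \<and> (\<forall>P \<in> set Ps. primeideal P R) \<and> sorted_wrt (\<subset>) Ps"

definition krull_dim :: "('a, 'm) ring_scheme \<Rightarrow> enat"
  where "krull_dim R = (SUP Ps \<in> {Ps. prime_chain R Ps}. enat (length Ps - 1))"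

definition chain_between :: "('a, 'm) ring_scheme \<Rightarrow> 'a set \<Rightarrow> 'a set \<Rightarrow> 'a set list \<Rightarrow> bool"
  where "chain_between R P Q Ps \<longleftrightarrow> prime_chain R Ps \<and> hd Ps = P \<and> last Ps = Q"

definition maximal_chain_between ::
    "('a, 'm) ring_scheme \<Rightarrow> 'a set \<Rightarrow> 'a set \<Rightarrow> 'a set list \<Rightarrow> bool"
  where "maximal_chain_between R P Q Ps \<longleftrightarrow> chain_between R P Q Ps \<and>
    (\<forall>Qs. chain_between R P Q Qs \<and> set Ps \<subseteq> set Qs \<longrightarrow> Qs = Ps)"

definition catenary :: "('a, 'm) ring_scheme \<Rightarrow> bool"
  where "catenary R \<longleftrightarrow> (\<forall>P Q. primeideal P R \<and> primeideal Q R \<and> P \<subseteq> Q \<longrightarrow>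
    (\<exists>n. \<forall>Ps. chain_between R P Q Ps \<longrightarrow> length Ps \<le> n) \<and>
    (\<forall>Ps Qs. maximal_chain_between R P Q Ps \<and> maximal_chain_between R P Q Qs
        \<longrightarrow> length Ps = length Qs))"

definition zariski_open :: "('a, 'm) ring_scheme \<Rightarrow> 'a set set \<Rightarrow> bool"
  where "zariski_open R U \<longleftrightarrow>
    (\<exists>E \<subseteq> carrier R. U = {P. primeideal P R \<and> \<not> E \<subseteq> P})"

text \<open>\<open>fraction R S a s\<close> is the class of \<open>(a, s)\<close> in \<open>S\<^sup>-\<^sup>1R\<close>. In \<open>localization\<close> each union is
  a union of equal classes, by independence of representatives. The ring need not be a domain.\<close>

definition fraction :: "('a, 'm) ring_scheme \<Rightarrow> 'a set \<Rightarrow> 'a \<Rightarrow> 'a \<Rightarrow> ('a \<times> 'a) set"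
  where "fraction R S a s = {(b, t). b \<in> carrier R \<and> t \<in> S \<and>
    (\<exists>u \<in> S. u \<otimes>\<^bsub>R\<^esub> (a \<otimes>\<^bsub>R\<^esub> t) = u \<otimes>\<^bsub>R\<^esub> (b \<otimes>\<^bsub>R\<^esub> s))}"

definition localization :: "('a, 'm) ring_scheme \<Rightarrow> 'a set \<Rightarrow> ('a \<times> 'a) set ring"
  where "localization R S =
    \<lparr>carrier = {fraction R S a s | a s. a \<in> carrier R \<and> s \<in> S},
     monoid.mult = (\<lambda>U V. \<Union>(a, s) \<in> U. \<Union>(b, t) \<in> V. fraction R S (a \<otimes>\<^bsub>R\<^esub> b) (s \<otimes>\<^bsub>R\<^esub> t)),
     monoid.one = fraction R S \<one>\<^bsub>R\<^esub> \<one>\<^bsub>R\<^esub>,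
     ring.zero = fraction R S \<zero>\<^bsub>R\<^esub> \<one>\<^bsub>R\<^esub>,
     ring.add = (\<lambda>U V. \<Union>(a, s) \<in> U. \<Union>(b, t) \<in> V.
       fraction R S (a \<otimes>\<^bsub>R\<^esub> t \<oplus>\<^bsub>R\<^esub> b \<otimes>\<^bsub>R\<^esub> s) (s \<otimes>\<^bsub>R\<^esub> t))\<rparr>"

definition local_at :: "('a, 'm) ring_scheme \<Rightarrow> 'a set \<Rightarrow> ('a \<times> 'a) set ring"
  where "local_at R P = localization R (carrier R - P)"

text \<open>The residue field of a prime \<open>P\<close> is the quotient field of \<open>R/P\<close>; the zero of \<open>R/P\<close> is
  the coset \<open>P\<close>.\<close>

definition residue_field_at ::
    "('a, 'm) ring_scheme \<Rightarrow> 'a set \<Rightarrow> ('a set \<times> 'a set) set ring"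
  where "residue_field_at R P = local_at (R Quot P) {P}"

definition to_residue_field_at ::
    "('a, 'm) ring_scheme \<Rightarrow> 'a set \<Rightarrow> 'a \<Rightarrow> ('a set \<times> 'a set) set"
  where "to_residue_field_at R P a =
    fraction (R Quot P) (carrier (R Quot P) - {P}) (P +>\<^bsub>R\<^esub> a) \<one>\<^bsub>R Quot P\<^esub>"

definition regular_local_ring :: "('a, 'm) ring_scheme \<Rightarrow> bool"
  where "regular_local_ring R \<longleftrightarrow> noetherian_ring R \<and> local_ring R \<and>
    (\<exists>G \<subseteq> carrier R. finite G \<and> enat (card G) = krull_dim R \<and> Idl\<^bsub>R\<^esub> G = max_ideal R)"

definition regular_locus :: "('a, 'm) ring_scheme \<Rightarrow> 'a set set"
  where "regular_locus R = {P. primeideal P R \<and> regular_local_ring (local_at R P)}"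

definition regular_ring :: "('a, 'm) ring_scheme \<Rightarrow> bool"
  where "regular_ring R \<longleftrightarrow> cring R \<and> noetherian_ring R \<and>
    (\<forall>P. primeideal P R \<longrightarrow> regular_local_ring (local_at R P))"


section \<open>Completion and tensor product\<close>

fun ideal_power :: "('a, 'm) ring_scheme \<Rightarrow> 'a set \<Rightarrow> nat \<Rightarrow> 'a set"
  where "ideal_power R I 0 = carrier R"
  | "ideal_power R I (Suc n) = ideal_prod R I (ideal_power R I n)"

text \<open>The inverse limit of the rings \<open>R/I\<^sup>n\<close>; a coset of \<open>I\<^sup>n\<^sup>+\<^sup>1\<close> maps to a coset of \<open>I\<^sup>n\<close> iff it is
  contained in it.\<close>

definition completion :: "('a, 'm) ring_scheme \<Rightarrow> 'a set \<Rightarrow> (nat \<Rightarrow> 'a set) ring"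
  where "completion R I =
    \<lparr>carrier = {f. \<forall>n. f n \<in> carrier (R Quot ideal_power R I n) \<and> f (Suc n) \<subseteq> f n},
     monoid.mult = (\<lambda>f g n. f n \<otimes>\<^bsub>R Quot ideal_power R I n\<^esub> g n),
     monoid.one = (\<lambda>n. \<one>\<^bsub>R Quot ideal_power R I n\<^esub>),
     ring.zero = (\<lambda>n. \<zero>\<^bsub>R Quot ideal_power R I n\<^esub>),
     ring.add = (\<lambda>f g n. f n \<oplus>\<^bsub>R Quot ideal_power R I n\<^esub> g n)\<rparr>"

definition to_completion :: "('a, 'm) ring_scheme \<Rightarrow> 'a set \<Rightarrow> 'a \<Rightarrow> nat \<Rightarrow> 'a set"
  where "to_completion R I a = (\<lambda>n. ideal_power R I n +>\<^bsub>R\<^esub> a)"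

text \<open>The tensor product \<open>B \<otimes>\<^sub>A C\<close> of two \<open>A\<close>-algebras with structure maps \<open>\<phi>\<close> and \<open>\<psi>\<close>. The multiset
  \<open>{#(b\<^sub>1, c\<^sub>1), \<dots>, (b\<^sub>n, c\<^sub>n)#}\<close> stands for \<open>\<Sum>\<^sub>i b\<^sub>i \<otimes> c\<^sub>i\<close>, and \<open>tensor_eq\<close> is the
  congruence generated by the bilinearity relations. No formal negatives are needed, because
  \<open>(-b) \<otimes> c\<close> is inverse to \<open>b \<otimes> c\<close>.\<close>

inductive tensor_eq ::
    "('a, 'm) ring_scheme \<Rightarrow> ('a \<Rightarrow> 'b) \<Rightarrow> ('b, 'n) ring_scheme \<Rightarrow> ('a \<Rightarrow> 'c) \<Rightarrow> ('c, 'p) ring_scheme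
      \<Rightarrow> ('b \<times> 'c) multiset \<Rightarrow> ('b \<times> 'c) multiset \<Rightarrow> bool"
  for A \<phi> B \<psi> C
  where
    refl: "set_mset S \<subseteq> carrier B \<times> carrier C \<Longrightarrow> tensor_eq A \<phi> B \<psi> C S S"
  | sym: "tensor_eq A \<phi> B \<psi> C S T \<Longrightarrow> tensor_eq A \<phi> B \<psi> C T S"
  | trans: "\<lbrakk>tensor_eq A \<phi> B \<psi> C S T; tensor_eq A \<phi> B \<psi> C T W\<rbrakk> \<Longrightarrow> tensor_eq A \<phi> B \<psi> C S W"
  | plus: "\<lbrakk>tensor_eq A \<phi> B \<psi> C S T; set_mset W \<subseteq> carrier B \<times> carrier C\<rbrakk>
      \<Longrightarrow> tensor_eq A \<phi> B \<psi> C (S + W) (T + W)"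
  | left_add: "\<lbrakk>b \<in> carrier B; b' \<in> carrier B; c \<in> carrier C\<rbrakk>
      \<Longrightarrow> tensor_eq A \<phi> B \<psi> C {#(b \<oplus>\<^bsub>B\<^esub> b', c)#} {#(b, c), (b', c)#}"
  | right_add: "\<lbrakk>b \<in> carrier B; c \<in> carrier C; c' \<in> carrier C\<rbrakk>
      \<Longrightarrow> tensor_eq A \<phi> B \<psi> C {#(b, c \<oplus>\<^bsub>C\<^esub> c')#} {#(b, c), (b, c')#}"
  | scalar: "\<lbrakk>a \<in> carrier A; b \<in> carrier B; c \<in> carrier C\<rbrakk>
      \<Longrightarrow> tensor_eq A \<phi> B \<psi> C {#(\<phi> a \<otimes>\<^bsub>B\<^esub> b, c)#} {#(b, \<psi> a \<otimes>\<^bsub>C\<^esub> c)#}"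
  | zero: "c \<in> carrier C \<Longrightarrow> tensor_eq A \<phi> B \<psi> C {#(\<zero>\<^bsub>B\<^esub>, c)#} {#}"

definition tensor_ring ::
    "('a, 'm) ring_scheme \<Rightarrow> ('a \<Rightarrow> 'b) \<Rightarrow> ('b, 'n) ring_scheme \<Rightarrow> ('a \<Rightarrow> 'c) \<Rightarrow> ('c, 'p) ring_scheme
      \<Rightarrow> ('b \<times> 'c) multiset set ring"
  where "tensor_ring A \<phi> B \<psi> C =
    (let cls = (\<lambda>S. {T. tensor_eq A \<phi> B \<psi> C S T}) in
     \<lparr>carrier = cls ` {S. set_mset S \<subseteq> carrier B \<times> carrier C},
      monoid.mult = (\<lambda>U V. \<Union>S \<in> U. \<Union>T \<in> V.
        cls (\<Sum>(b, c) \<in># S. image_mset (\<lambda>(b', c'). (b \<otimes>\<^bsub>B\<^esub> b', c \<otimes>\<^bsub>C\<^esub> c')) T)),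
      monoid.one = cls {#(\<one>\<^bsub>B\<^esub>, \<one>\<^bsub>C\<^esub>)#},
      ring.zero = cls {#},
      ring.add = (\<lambda>U V. \<Union>S \<in> U. \<Union>T \<in> V. cls (S + T))\<rparr>)"

definition tensor_inr ::
    "('a, 'm) ring_scheme \<Rightarrow> ('a \<Rightarrow> 'b) \<Rightarrow> ('b, 'n) ring_scheme \<Rightarrow> ('a \<Rightarrow> 'c) \<Rightarrow> ('c, 'p) ring_scheme
      \<Rightarrow> 'c \<Rightarrow> ('b \<times> 'c) multiset set"
  where "tensor_inr A \<phi> B \<psi> C c = {T. tensor_eq A \<phi> B \<psi> C {#(\<one>\<^bsub>B\<^esub>, c)#} T}"


section \<open>Excellent rings\<close>

text \<open>\<open>k \<rightarrow> B\<close> (via \<open>\<phi>\<close>) is geometrically regular over the field \<open>k\<close> if \<open>B \<otimes>\<^sub>k E\<close> is regular for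
  every finite field extension \<open>E\<close> of \<open>k\<close>. Such an \<open>E\<close> is in bijection with some \<open>k\<^sup>n\<close>, so
  restricting to carriers consisting of lists over the type of \<open>k\<close> loses no isomorphism class.\<close>

definition geometrically_regular ::
    "('k, 'm) ring_scheme \<Rightarrow> ('k \<Rightarrow> 'b) \<Rightarrow> ('b, 'n) ring_scheme \<Rightarrow> bool"
  where "geometrically_regular k \<phi> B \<longleftrightarrow>
    (\<forall>(E :: 'k list ring) \<psi>.
        field E \<and> \<psi> \<in> ring_hom k E \<and> ring.finite_dimension E (\<psi> ` carrier k) (carrier E)
        \<longrightarrow> regular_ring (tensor_ring k \<phi> B \<psi> E))"

text \<open>For a Noetherian local ring \<open>A\<close> the completion is flat over \<open>A\<close>, so regularity of
  the map to the completion is exactly geometric regularity of its fibres.\<close>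

definition geometrically_regular_formal_fibres :: "('a, 'm) ring_scheme \<Rightarrow> bool"
  where "geometrically_regular_formal_fibres A \<longleftrightarrow>
    (\<forall>Q. primeideal Q A \<longrightarrow>
      (let M = max_ideal A; B = completion A M; \<beta> = to_completion A M;
           k = residue_field_at A Q; \<kappa> = to_residue_field_at A Q
       in geometrically_regular k (tensor_inr A \<beta> B \<kappa> k) (tensor_ring A \<beta> B \<kappa> k)))"

definition G_ring :: "('a, 'm) ring_scheme \<Rightarrow> bool"
  where "G_ring R \<longleftrightarrow> cring R \<and> noetherian_ring R \<and>
    (\<forall>P. primeideal P R \<longrightarrow> geometrically_regular_formal_fibres (local_at R P))"

definition finite_type_algebra ::
    "('a, 'm) ring_scheme \<Rightarrow> ('a \<Rightarrow> 'b) \<Rightarrow> ('b, 'n) ring_scheme \<Rightarrow> bool"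
  where "finite_type_algebra A \<phi> B \<longleftrightarrow> cring B \<and> \<phi> \<in> ring_hom A B \<and>
    (\<exists>G \<subseteq> carrier B. finite G \<and> carrier B = generate_ring B (\<phi> ` carrier A \<union> G))"

text \<open>In the next two definitions \<open>B\<close> ranges over algebras with carrier in \<open>'a list\<close>. An algebra of
  finite type over \<open>R\<close> has cardinality at most \<open>max |R| \<aleph>\<^sub>0\<close>, which is at most that of the type
  \<open>'a list\<close>, so every isomorphism class occurs.\<close>

definition universally_catenary :: "('a, 'm) ring_scheme \<Rightarrow> bool"
  where "universally_catenary R \<longleftrightarrow> cring R \<and> noetherian_ring R \<and>
    (\<forall>(B :: 'a list ring) \<phi>. finite_type_algebra R \<phi> B \<longrightarrow> catenary B)"

definition J2_ring :: "('a, 'm) ring_scheme \<Rightarrow> bool"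
  where "J2_ring R \<longleftrightarrow> cring R \<and> noetherian_ring R \<and>
    (\<forall>(B :: 'a list ring) \<phi>. finite_type_algebra R \<phi> B \<longrightarrow> zariski_open B (regular_locus B))"

definition excellent_ring :: "('a, 'm) ring_scheme \<Rightarrow> bool"
  where "excellent_ring R \<longleftrightarrow>
    cring R \<and> noetherian_ring R \<and> universally_catenary R \<and> G_ring R \<and> J2_ring R"


section \<open>Field extensions and valuations\<close>

text \<open>All fields are subfields of one ambient field \<open>\<Omega>\<close>.\<close>

definition is_quotient_field :: "('a, 'm) ring_scheme \<Rightarrow> 'a set \<Rightarrow> 'a set \<Rightarrow> bool"
  where "is_quotient_field \<Omega> R K \<longleftrightarrow>
    K = {a \<otimes>\<^bsub>\<Omega>\<^esub> inv\<^bsub>\<Omega>\<^esub> b | a b. a \<in> R \<and> b \<in> R \<and> b \<noteq> \<zero>\<^bsub>\<Omega>\<^esub>}"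

text \<open>Here \<open>\<Omega>\<close> is meant to be algebraically closed: a minimal polynomial is separable iff it has
  no multiple root in \<open>\<Omega>\<close>.\<close>

definition separable_extension :: "('a, 'm) ring_scheme \<Rightarrow> 'a set \<Rightarrow> 'a set \<Rightarrow> bool"
  where "separable_extension \<Omega> K L \<longleftrightarrow>
    (\<forall>x \<in> L. ring.algebraic \<Omega> K x \<and>
      (\<forall>a \<in> carrier \<Omega>. ring.alg_mult \<Omega> (ring.Irr \<Omega> K x) a \<le> 1))"

text \<open>Valuations are written additively, and only the values at nonzero elements are
  meaningful (the value at zero, \<open>\<infinity>\<close>, is not represented). The group \<open>'g\<close> only has to contain
  the value group.\<close>

definition valuation_on ::
    "('a, 'm) ring_scheme \<Rightarrow> 'a set \<Rightarrow> ('a \<Rightarrow> 'g::linordered_ab_group_add) \<Rightarrow> bool"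
  where "valuation_on \<Omega> K v \<longleftrightarrow>
    (\<forall>x \<in> K - {\<zero>\<^bsub>\<Omega>\<^esub>}. \<forall>y \<in> K - {\<zero>\<^bsub>\<Omega>\<^esub>}.
       v (x \<otimes>\<^bsub>\<Omega>\<^esub> y) = v x + v y \<and>
       (x \<oplus>\<^bsub>\<Omega>\<^esub> y \<noteq> \<zero>\<^bsub>\<Omega>\<^esub> \<longrightarrow> min (v x) (v y) \<le> v (x \<oplus>\<^bsub>\<Omega>\<^esub> y)))"

definition valuation_extends ::
    "('a, 'm) ring_scheme \<Rightarrow> 'a set \<Rightarrow> ('a \<Rightarrow> 'g) \<Rightarrow> ('a \<Rightarrow> 'g::linordered_ab_group_add) \<Rightarrow> bool"
  where "valuation_extends \<Omega> K v w \<longleftrightarrow> (\<forall>x \<in> K - {\<zero>\<^bsub>\<Omega>\<^esub>}. w x = v x)"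

definition val_ring ::
    "('a, 'm) ring_scheme \<Rightarrow> 'a set \<Rightarrow> ('a \<Rightarrow> 'g::linordered_ab_group_add) \<Rightarrow> 'a set"
  where "val_ring \<Omega> K v = {x \<in> K. x = \<zero>\<^bsub>\<Omega>\<^esub> \<or> 0 \<le> v x}"

definition val_ideal ::
    "('a, 'm) ring_scheme \<Rightarrow> 'a set \<Rightarrow> ('a \<Rightarrow> 'g::linordered_ab_group_add) \<Rightarrow> 'a set"
  where "val_ideal \<Omega> K v = {x \<in> K. x = \<zero>\<^bsub>\<Omega>\<^esub> \<or> 0 < v x}"

definition value_group ::
    "('a, 'm) ring_scheme \<Rightarrow> 'a set \<Rightarrow> ('a \<Rightarrow> 'g::linordered_ab_group_add) \<Rightarrow> 'g set"
  where "value_group \<Omega> K v = v ` (K - {\<zero>\<^bsub>\<Omega>\<^esub>})"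

definition centered_at ::
    "('a, 'm) ring_scheme \<Rightarrow> 'a set \<Rightarrow> ('a \<Rightarrow> 'g::linordered_ab_group_add) \<Rightarrow> 'a set \<Rightarrow> bool"
  where "centered_at \<Omega> K v R \<longleftrightarrow>
    R \<subseteq> val_ring \<Omega> K v \<and> val_ideal \<Omega> K v \<inter> R = max_ideal (\<Omega>\<lparr>carrier := R\<rparr>)"

definition ram_index ::
    "('a, 'm) ring_scheme \<Rightarrow> 'a set \<Rightarrow> ('a \<Rightarrow> 'g) \<Rightarrow> 'a set \<Rightarrow> ('a \<Rightarrow> 'g::linordered_ab_group_add) \<Rightarrow> nat"
  where "ram_index \<Omega> K \<nu> L \<omega> =
    card ((\<lambda>\<gamma>. (\<lambda>\<delta>. \<gamma> + \<delta>) ` value_group \<Omega> K \<nu>) ` value_group \<Omega> L \<omega>)"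

text \<open>The residue field of \<open>\<nu>\<close> is embedded into that of \<open>\<omega>\<close> as the set of cosets of elements
  of the valuation ring of \<open>\<nu>\<close>.\<close>

definition res_degree ::
    "('a, 'm) ring_scheme \<Rightarrow> 'a set \<Rightarrow> ('a \<Rightarrow> 'g) \<Rightarrow> 'a set \<Rightarrow> ('a \<Rightarrow> 'g::linordered_ab_group_add) \<Rightarrow> nat"
  where "res_degree \<Omega> K \<nu> L \<omega> =
    (let Ow = \<Omega>\<lparr>carrier := val_ring \<Omega> L \<omega>\<rparr>; Mw = val_ideal \<Omega> L \<omega>
     in ring.dim (Ow Quot Mw) ((\<lambda>x. Mw +>\<^bsub>Ow\<^esub> x) ` val_ring \<Omega> K \<nu>) (carrier (Ow Quot Mw)))"

definition init_index ::
    "('a, 'm) ring_scheme \<Rightarrow> 'a set \<Rightarrow> ('a \<Rightarrow> 'g) \<Rightarrow> 'a set \<Rightarrow> ('a \<Rightarrow> 'g::linordered_ab_group_add) \<Rightarrow> nat"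
  where "init_index \<Omega> K \<nu> L \<omega> =
    card {\<gamma> \<in> value_group \<Omega> L \<omega>. 0 \<le> \<gamma> \<and> (\<forall>\<delta> \<in> value_group \<Omega> K \<nu>. 0 < \<delta> \<longrightarrow> \<gamma> < \<delta>)}"

text \<open>The henselization of \<open>(K, v)\<close> inside \<open>\<Omega>\<close>, where \<open>\<Omega>\<close> is an algebraic closure of \<open>K\<close> and \<open>v\<close> is a
  valuation on \<open>\<Omega>\<close>. In the uniqueness clause \<open>w\<close> takes values in the same group \<open>'g\<close>, without loss
  of generality: \<open>\<Omega>\<close> is algebraic over \<open>F\<close>, so every extension of \<open>v\<close> from \<open>F\<close> to \<open>\<Omega>\<close> has values in the
  divisible hull of the value group of \<open>F\<close>, which is the value group of \<open>v\<close> on \<open>\<Omega>\<close>; and ordered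
  groups being torsion-free, equivalent extensions that agree on \<open>F\<close> are equal.\<close>

definition unique_extension ::
    "('a, 'm) ring_scheme \<Rightarrow> ('a \<Rightarrow> 'g::linordered_ab_group_add) \<Rightarrow> 'a set \<Rightarrow> bool"
  where "unique_extension \<Omega> v F \<longleftrightarrow>
    (\<forall>w. valuation_on \<Omega> (carrier \<Omega>) w \<and> valuation_extends \<Omega> F v w
       \<longrightarrow> (\<forall>x \<in> carrier \<Omega> - {\<zero>\<^bsub>\<Omega>\<^esub>}. w x = v x))"

definition henselization ::
    "('a, 'm) ring_scheme \<Rightarrow> ('a \<Rightarrow> 'g::linordered_ab_group_add) \<Rightarrow> 'a set \<Rightarrow> 'a set"
  where "henselization \<Omega> v K = (LEAST F. subfield F \<Omega> \<and> K \<subseteq> F \<and> unique_extension \<Omega> v F)"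

definition defect ::
    "('a, 'm) ring_scheme \<Rightarrow> ('a \<Rightarrow> 'g) \<Rightarrow> 'a set \<Rightarrow> ('a \<Rightarrow> 'g) \<Rightarrow> 'a set
      \<Rightarrow> ('a \<Rightarrow> 'g::linordered_ab_group_add) \<Rightarrow> rat"
  where "defect \<Omega> v K \<nu> L \<omega> =
    rat_of_nat (ring.dim \<Omega> (henselization \<Omega> v K) (henselization \<Omega> v L))
      / (rat_of_nat (ram_index \<Omega> K \<nu> L \<omega>) * rat_of_nat (res_degree \<Omega> K \<nu> L \<omega>))"

text \<open>For a subring \<open>C\<close> of \<open>B\<close>, the equation \<open>B = S\<^sup>-\<^sup>1C\<close> means that \<open>S\<close> consists of units of \<open>B\<close> and
  every element of \<open>B\<close> is of the form \<open>c s\<^sup>-\<^sup>1\<close>; the canonical map \<open>S\<^sup>-\<^sup>1C \<rightarrow> B\<close> is then bijective.\<close>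

definition essentially_fin_gen :: "('a, 'm) ring_scheme \<Rightarrow> 'a set \<Rightarrow> bool"
  where "essentially_fin_gen B A \<longleftrightarrow>
    (\<exists>G S. finite G \<and> G \<subseteq> carrier B \<and>
       S \<subseteq> generate_ring B (A \<union> G) \<and> submonoid S B \<and> S \<subseteq> Units B \<and>
       carrier B = {c \<otimes>\<^bsub>B\<^esub> inv\<^bsub>B\<^esub> s | c s. c \<in> generate_ring B (A \<union> G) \<and> s \<in> S})"

end

theory Submission
  imports Defs "HOL-Algebra.Algebraic_Closure_Type" "HOL-Combinatorics.Permutations"
    "HOL-Computational_Algebra.Computational_Algebra"
begin

text \<open>Choose elements \<open>y\<^sub>i\<close> of \<open>\<O>\<^sub>\<omega>\<close> lifting a basis of the residue field extension, and elements
  \<open>z\<^sub>j\<close> realizing the values counted by the initial index. Since \<open>\<epsilon> = e\<close> and \<open>d = 1\<close>, there are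
  \<open>e f = [L\<^sup>h : K\<^sup>h]\<close> products \<open>y\<^sub>i z\<^sub>j\<close>. The henselization is immediate and the values of the \<open>z\<^sub>j\<close>
  are smaller than all positive values of \<open>K\<close>, so the products are independent over \<open>K\<^sup>h\<close>, and a
  combination of them is integral only if all its coefficients are. Hence they form a basis of
  \<open>L\<^sup>h\<close> over \<open>K\<^sup>h\<close>, and the coefficients of a \<open>K\<close>-basis of \<open>L\<close> lie in a finite tower \<open>K'\<close> of
  extensions of \<open>K\<close> by Hensel roots. The valuation ring of each step of such a tower is a localization
  of the ring generated by the root over the valuation ring below, so \<open>\<O>\<close> of \<open>L K'\<close> is essentially
  finitely generated over \<open>\<O>\<^sub>\<nu>\<close>. This property descends along the tower \<open>L K' | L\<close>, by comparing
  coefficients in powers of the Hensel root. The henselization itself is obtained as the union of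
  all towers of Hensel roots.\<close>

section \<open>Polynomials over subrings\<close>

text \<open>The henselization is defined by uniqueness of extension, a property that yields no
  coefficients to compute with. The bridge is an equivalence for fields F with algebraic closure
  above them: extensions are unique iff F contains every unit root of a monic polynomial over F
  whose other roots lie in the maximal ideal. Instead of Galois groups, one direction uses
  embeddings obtained from Zorn's lemma and the other uses symmetric functions of the roots, listed
  with multiplicity so that repeated roots do no harm. The condition \<epsilon> = e is what makes
  coefficients integral: if v(c) + v(z) >= 0 with v(c) < 0, then -v(c) is a positive value of K that
  does not exceed v(z), which contradicts the choice of z. The coefficients of the K-basis, however,
  lie outside K, so finite generation is first reached over the larger field L K' and a descent is
  unavoidable. Polynomial arithmetic is carried out in a type that is a field, with subrings as
  subsets; the last third moves the result to fields given by a carrier.\<close>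

definition closed_ring :: "'k::comm_ring_1 set \<Rightarrow> bool"
  where "closed_ring A \<longleftrightarrow> 1 \<in> A \<and> (\<forall>x\<in>A. \<forall>y\<in>A. x - y \<in> A \<and> x * y \<in> A)"

definition closed_field :: "'k::field set \<Rightarrow> bool"
  where "closed_field F \<longleftrightarrow> closed_ring F \<and> (\<forall>x\<in>F. inverse x \<in> F)"

context
  fixes A :: "'k::comm_ring_1 set"
  assumes A: "closed_ring A"
begin

lemma closed_ring_one: "1 \<in> A"
  and closed_ring_diff: "x \<in> A \<Longrightarrow> y \<in> A \<Longrightarrow> x - y \<in> A"
  and closed_ring_mult: "x \<in> A \<Longrightarrow> y \<in> A \<Longrightarrow> x * y \<in> A"
  using A by (auto simp: closed_ring_def)

lemma closed_ring_zero: "0 \<in> A"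
  using closed_ring_diff[OF closed_ring_one closed_ring_one] by simp

lemma closed_ring_uminus: "x \<in> A \<Longrightarrow> - x \<in> A"
  using closed_ring_diff[OF closed_ring_zero] by fastforce

lemma closed_ring_add: "x \<in> A \<Longrightarrow> y \<in> A \<Longrightarrow> x + y \<in> A"
  using closed_ring_diff[of x "- y"] closed_ring_uminus by simp

lemma closed_ring_sum: "(\<And>i. i \<in> I \<Longrightarrow> f i \<in> A) \<Longrightarrow> sum f I \<in> A"
  by (induction I rule: infinite_finite_induct) (auto intro: closed_ring_zero closed_ring_add)

lemma closed_ring_prod: "(\<And>i. i \<in> I \<Longrightarrow> f i \<in> A) \<Longrightarrow> prod f I \<in> A"
  by (induction I rule: infinite_finite_induct) (auto intro: closed_ring_one closed_ring_mult)

lemma closed_ring_power: "x \<in> A \<Longrightarrow> x ^ n \<in> A"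
  by (induction n) (auto intro: closed_ring_one closed_ring_mult)

end

lemmas closed_ring_intros = closed_ring_one closed_ring_zero closed_ring_diff closed_ring_mult
  closed_ring_uminus closed_ring_add closed_ring_sum closed_ring_prod closed_ring_power

lemma closed_field_ring: "closed_field F \<Longrightarrow> closed_ring F"
  by (simp add: closed_field_def)

lemma closed_field_inverse: "closed_field F \<Longrightarrow> x \<in> F \<Longrightarrow> inverse x \<in> F"
  by (simp add: closed_field_def)

lemma closed_field_divide: "closed_field F \<Longrightarrow> x \<in> F \<Longrightarrow> y \<in> F \<Longrightarrow> x / y \<in> F"
  by (auto simp: divide_inverse intro!: closed_ring_mult closed_field_ring closed_field_inverse)

definition polys :: "'k::comm_ring_1 set \<Rightarrow> 'k poly set"
  where "polys A = {p. \<forall>i. coeff p i \<in> A}"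

lemma polysI: "(\<And>i. coeff p i \<in> A) \<Longrightarrow> p \<in> polys A"
  and polysD: "p \<in> polys A \<Longrightarrow> coeff p i \<in> A"
  by (auto simp: polys_def)

lemma polys_mono: "A \<subseteq> B \<Longrightarrow> polys A \<subseteq> polys B"
  by (auto simp: polys_def)

lemma closed_ring_polys:
  assumes "closed_ring A" shows "closed_ring (polys A)"
  unfolding closed_ring_def
proof (intro conjI ballI)
  show "1 \<in> polys A"
    using assms by (auto simp: polys_def one_pCons coeff_pCons split: nat.splits intro: closed_ring_intros)
  fix p q assume "p \<in> polys A" "q \<in> polys A"
  then show "p - q \<in> polys A" "p * q \<in> polys A"
    using assms by (auto intro!: polysI closed_ring_intros simp: coeff_mult dest: polysD)
qed

lemma pCons_in_polys: "closed_ring A \<Longrightarrow> pCons a p \<in> polys A \<longleftrightarrow> a \<in> A \<and> p \<in> polys A"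
  by (auto simp: polys_def coeff_pCons split: nat.splits)

lemma const_in_polys: "closed_ring A \<Longrightarrow> a \<in> A \<Longrightarrow> [:a:] \<in> polys A"
  by (auto simp: polys_def coeff_pCons split: nat.splits intro: closed_ring_zero)

lemma X_in_polys: "closed_ring A \<Longrightarrow> [:0, 1:] \<in> polys A"
  by (auto simp: pCons_in_polys closed_ring_intros intro!: const_in_polys closed_ring_one
      closed_ring_zero closed_ring_zero[OF closed_ring_polys])

lemma monom_in_polys: "closed_ring A \<Longrightarrow> a \<in> A \<Longrightarrow> monom a n \<in> polys A"
  by (auto simp: polys_def closed_ring_intros)

lemma smult_in_polys: "closed_ring A \<Longrightarrow> a \<in> A \<Longrightarrow> p \<in> polys A \<Longrightarrow> smult a p \<in> polys A"
  by (auto simp: polys_def intro: closed_ring_mult)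

lemma poly_in_closed_ring: "closed_ring A \<Longrightarrow> p \<in> polys A \<Longrightarrow> x \<in> A \<Longrightarrow> poly p x \<in> A"
  by (auto simp: poly_altdef intro!: closed_ring_intros dest: polysD)

text \<open>The remainder is bounded through its coefficients and not its degree, so that h = 1 is
  covered: there the condition forces r = 0.\<close>

lemma division_by_monic:
  assumes A: "closed_ring A" and h: "h \<in> polys A" "lead_coeff h = 1" and p: "p \<in> polys A"
  shows "\<exists>q\<in>polys A. \<exists>r\<in>polys A. p = q * h + r \<and> (\<forall>i\<ge>degree h. coeff r i = 0)"
  using p
proof (induction "degree p" arbitrary: p rule: less_induct)
  case less
  note pA = closed_ring_polys[OF A]
  show ?case
  proof (cases "degree p < degree h")
    case True
    then show ?thesis
      using less.prems pA by (intro bexI[of _ 0] bexI[of _ p]) (auto intro: closed_ring_intros coeff_eq_0)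
  next
    case False
    let ?m = "monom (lead_coeff p) (degree p - degree h)"
    have m: "?m \<in> polys A"
      using A less.prems by (intro monom_in_polys) (auto dest: polysD)
    let ?p = "p - ?m * h"
    have pp: "?p \<in> polys A" using m h less.prems pA by (intro closed_ring_intros)
    have deg: "degree (?m * h) \<le> degree p"
      using False degree_mult_le[of ?m h] degree_monom_le[of "lead_coeff p" "degree p - degree h"]
      by linarith
    have "coeff (?m * h) (degree p) = lead_coeff p"
      using False h(2) by (simp add: coeff_monom_mult)
    then have z: "coeff ?p (degree p) = 0" by simp
    show ?thesis
    \<comment> \<open>For constant p the degree cannot drop any further; but then h is constant as
      well, so h = 1 and p itself is the quotient.\<close>
    proof (cases "degree p = 0")
      case True
      then have "degree h = 0" using False by simp
      then have "h = 1" using h(2) by (auto elim!: degree_eq_zeroE simp: one_pCons)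
      then show ?thesis
        using less.prems pA by (intro bexI[of _ p] bexI[of _ 0]) (auto intro: closed_ring_intros)
    next
      case False
      have "degree ?p \<le> degree p" using deg by (simp add: degree_diff_le)
      moreover have "degree ?p \<noteq> degree p"
      proof
        assume "degree ?p = degree p"
        then have "lead_coeff ?p = 0" using z by simp
        then have "?p = 0" by (rule leading_coeff_0_iff[THEN iffD1])
        then show False using \<open>degree ?p = degree p\<close> False by simp
      qed
      ultimately have "degree ?p < degree p" by simp
      from less.hyps[OF this pp] obtain q r where
        "q \<in> polys A" "r \<in> polys A" "?p = q * h + r" "\<forall>i\<ge>degree h. coeff r i = 0" by blast
      then show ?thesis
        using m pA by (intro bexI[of _ "q + ?m"] bexI[of _ r])
          (auto intro: closed_ring_intros simp: algebra_simps)
    qed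
  qed
qed

section \<open>Minimal polynomials and simple algebraic extensions\<close>

definition minpoly :: "'k::field set \<Rightarrow> 'k \<Rightarrow> 'k poly \<Rightarrow> bool"
  where "minpoly F x h \<longleftrightarrow> h \<in> polys F \<and> lead_coeff h = 1 \<and> poly h x = 0 \<and>
    (\<forall>p\<in>polys F. poly p x = 0 \<longrightarrow> h dvd p)"

text \<open>The whole type is thought of as an algebraic extension of F. Every ring between the two
  is then a field, so adjunctions can be formed as mere rings of polynomial values.\<close>

definition alg_base :: "'k::field set \<Rightarrow> bool"
  where "alg_base F \<longleftrightarrow> closed_field F \<and> (\<forall>x. \<exists>p\<in>polys F. p \<noteq> 0 \<and> poly p x = 0)"

lemma alg_base_ring: "alg_base F \<Longrightarrow> closed_ring F"
  by (simp add: alg_base_def closed_field_ring)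

lemma alg_base_field: "alg_base F \<Longrightarrow> closed_field F"
  by (simp add: alg_base_def)

lemma alg_base_mono: "alg_base F \<Longrightarrow> F \<subseteq> F' \<Longrightarrow> closed_field F' \<Longrightarrow> alg_base F'"
  unfolding alg_base_def using polys_mono by blast

lemma minpoly_degree: "minpoly F x h \<Longrightarrow> degree h > 0"
  by (rule ccontr) (auto simp: minpoly_def elim!: degree_eq_zeroE)

lemma minpoly_exists:
  assumes F: "alg_base F" shows "\<exists>h. minpoly F x h"
proof -
  let ?P = "\<lambda>p. p \<in> polys F \<and> p \<noteq> 0 \<and> poly p x = 0"
  obtain p0 where "?P p0" using F by (auto simp: alg_base_def)
  define p where "p = arg_min degree ?P"
  have p: "?P p" and min: "\<And>q. ?P q \<Longrightarrow> degree p \<le> degree q"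
    unfolding p_def using arg_min_natI[of ?P, OF \<open>?P p0\<close>] arg_min_nat_le[of ?P] by (blast, blast)
  define h where "h = smult (inverse (lead_coeff p)) p"
  have R: "closed_ring F" using F by (rule alg_base_ring)
  have h: "h \<in> polys F" "lead_coeff h = 1" "poly h x = 0" "degree h = degree p"
    using p F by (auto simp: h_def intro!: smult_in_polys R closed_field_inverse alg_base_field dest: polysD)
  have "h dvd q" if q: "q \<in> polys F" "poly q x = 0" for q
  proof -
    obtain s r where sr: "s \<in> polys F" "r \<in> polys F" "q = s * h + r" "\<forall>i\<ge>degree h. coeff r i = 0"
      using division_by_monic[OF R h(1,2) q(1)] by blast
    have "r = 0"
    proof (rule ccontr)
      assume "r \<noteq> 0"
      moreover have "poly r x = 0" using q sr h by simp
      ultimately have "degree p \<le> degree r" using min sr by blast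
      then have "lead_coeff r = 0" using sr(4) h(4) by auto
      with \<open>r \<noteq> 0\<close> show False by simp
    qed
    then show ?thesis using sr by simp
  qed
  with h show ?thesis by (auto simp: minpoly_def)
qed

text \<open>Division by a monic polynomial is unique already over the ambient field, so the given
  quotient agrees with the one computed over F.\<close>

lemma quotient_in_polys:
  assumes F: "closed_ring F" and h: "h \<in> polys F" "lead_coeff h = 1" and p: "p \<in> polys F" "p = h * q"
  shows "q \<in> polys F"
proof -
  obtain s r where sr: "s \<in> polys F" "r \<in> polys F" "p = s * h + r" "\<forall>i\<ge>degree h. coeff r i = 0"
    using division_by_monic[OF F h p(1)] by blast
  have "r = (q - s) * h" using p sr by (simp add: algebra_simps)
  have "q - s = 0"
  proof (rule ccontr)
    assume ne: "q - s \<noteq> 0"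
    have "coeff ((q - s) * h) (degree (q - s) + degree h) = lead_coeff (q - s)"
      unfolding coeff_mult_degree_sum using h(2) by simp
    moreover have "coeff ((q - s) * h) (degree (q - s) + degree h) = 0"
      using sr(4) \<open>r = _\<close> by auto
    ultimately have "lead_coeff (q - s) = 0" by (rule HOL.trans[OF HOL.sym])
    then show False using ne leading_coeff_0_iff by blast
  qed
  then show ?thesis using sr by simp
qed

definition adj :: "'k::field set \<Rightarrow> 'k \<Rightarrow> 'k set"
  where "adj F x = (\<lambda>p. poly p x) ` polys F"

lemma adj_incl: "closed_ring F \<Longrightarrow> F \<subseteq> adj F x"
  by (auto simp: adj_def intro!: image_eqI[of _ _ "[:_:]"] const_in_polys)

lemma adj_mem: "closed_ring F \<Longrightarrow> x \<in> adj F x"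
  by (auto simp: adj_def intro!: image_eqI[of _ _ "[:0, 1:]"] X_in_polys)

lemma adj_least: "closed_ring U \<Longrightarrow> F \<subseteq> U \<Longrightarrow> x \<in> U \<Longrightarrow> adj F x \<subseteq> U"
  using poly_in_closed_ring[of U] polys_mono[of F U] by (auto simp: adj_def)

lemma closed_ring_adj:
  assumes "closed_ring F" shows "closed_ring (adj F x)"
proof -
  have "poly p x - poly q x \<in> adj F x \<and> poly p x * poly q x \<in> adj F x"
    if "p \<in> polys F" "q \<in> polys F" for p q
    using that closed_ring_polys[OF assms]
    by (auto simp: adj_def simp flip: poly_diff poly_mult intro!: imageI closed_ring_intros)
  moreover have "1 \<in> adj F x" using adj_incl[OF assms] assms by (auto intro: closed_ring_one)
  ultimately show ?thesis by (auto simp: closed_ring_def adj_def)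
qed

text \<open>Write the minimal polynomial as a + X p(X). Its constant term a is nonzero, because
  otherwise p would vanish at u in smaller degree; hence 1/u = -p(u)/a is a polynomial in u.\<close>

lemma algebraic_inverse:
  assumes F: "alg_base F" and U: "closed_ring U" "F \<subseteq> U" "u \<in> U"
  shows "inverse u \<in> U"
proof (cases "u = 0")
  case False
  obtain h where h: "minpoly F u h" using minpoly_exists[OF F] by blast
  obtain a p where ap: "h = pCons a p" by (cases h) auto
  have ap': "a \<in> F" "p \<in> polys F"
    using h by (auto simp: minpoly_def ap pCons_in_polys[OF alg_base_ring[OF F]])
  have eq: "a = - (u * poly p u)" using h by (auto simp: minpoly_def ap eq_neg_iff_add_eq_0)
  have "a \<noteq> 0"
  proof
    assume "a = 0"
    then have "poly p u = 0" using eq False by simp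
    then have "h dvd p" using h ap' by (auto simp: minpoly_def)
    moreover have "p \<noteq> 0" using minpoly_degree[OF h] ap by auto
    ultimately show False using ap by (auto dest!: dvd_imp_degree_le split: if_splits)
  qed
  then have "inverse u = - (poly p u * inverse a)" using eq False by (simp add: field_simps)
  moreover have "poly p u \<in> U" using U ap' polys_mono by (intro poly_in_closed_ring) auto
  moreover have "inverse a \<in> U" using F U ap' by (auto intro: closed_field_inverse alg_base_field)
  ultimately show ?thesis using U by (auto intro: closed_ring_intros)
qed (use U in \<open>auto intro: closed_ring_zero\<close>)

lemma closed_field_if_ring: "alg_base F \<Longrightarrow> closed_ring U \<Longrightarrow> F \<subseteq> U \<Longrightarrow> closed_field U"
  unfolding closed_field_def using algebraic_inverse by blast

lemma alg_base_adj: "alg_base F \<Longrightarrow> alg_base (adj F x)"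
  by (rule alg_base_mono[OF _ adj_incl closed_field_if_ring[OF _ closed_ring_adj adj_incl]])
    (auto intro: alg_base_ring)

lemma infinite_UNIV_alg_closed: "infinite (UNIV :: 'k::alg_closed_field set)"
proof
  assume fin: "finite (UNIV :: 'k set)"
  let ?p = "1 + (\<Prod>a\<in>UNIV. [:- a, 1:]) :: 'k poly"
  have c: "card (UNIV :: 'k set) > 0" using fin by (simp add: card_gt_0_iff)
  have "degree (\<Prod>a\<in>UNIV. [:- a, 1:] :: 'k poly) = card (UNIV :: 'k set)"
    by (subst degree_prod_eq_sum_degree) auto
  then have "degree ?p > 0" using c by (subst degree_add_eq_right) auto
  then obtain x where "poly ?p x = 0" using alg_closed_imp_poly_has_root by blast
  moreover have "poly (\<Prod>a\<in>UNIV. [:- a, 1:]) x = 0"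
    using fin by (auto simp: poly_prod prod_zero_iff)
  ultimately show False by simp
qed

section \<open>Symmetric polynomial functions\<close>

text \<open>Multivariate polynomials are represented by the functions they induce on infinite fields.\<close>

inductive_set polyfun :: "'k::comm_ring_1 set \<Rightarrow> nat \<Rightarrow> ((nat \<Rightarrow> 'k) \<Rightarrow> 'k) set"
  for F n where
    const: "c \<in> F \<Longrightarrow> (\<lambda>x. c) \<in> polyfun F n"
  | var: "i < n \<Longrightarrow> (\<lambda>x. x i) \<in> polyfun F n"
  | add: "f \<in> polyfun F n \<Longrightarrow> g \<in> polyfun F n \<Longrightarrow> (\<lambda>x. f x + g x) \<in> polyfun F n"
  | mult: "f \<in> polyfun F n \<Longrightarrow> g \<in> polyfun F n \<Longrightarrow> (\<lambda>x. f x * g x) \<in> polyfun F n"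

lemma polyfun_cong:
  "f \<in> polyfun F n \<Longrightarrow> (\<And>i. i < n \<Longrightarrow> x i = y i) \<Longrightarrow> f x = f y"
  by (induction rule: polyfun.induct) auto

lemma polyfun_value:
  "f \<in> polyfun F n \<Longrightarrow> closed_ring A \<Longrightarrow> F \<subseteq> A \<Longrightarrow> (\<And>i. i < n \<Longrightarrow> x i \<in> A) \<Longrightarrow> f x \<in> A"
  by (induction rule: polyfun.induct) (auto intro: closed_ring_intros)

lemma polyfun_compose:
  "f \<in> polyfun F n \<Longrightarrow> (\<And>i. i < n \<Longrightarrow> g i \<in> polyfun F m) \<Longrightarrow> (\<lambda>x. f (\<lambda>i. g i x)) \<in> polyfun F m"
  by (induction rule: polyfun.induct) (auto intro: polyfun.intros)

definition polyfun_poly_valued :: "'k::comm_ring_1 set \<Rightarrow> nat \<Rightarrow> ((nat \<Rightarrow> 'k) \<Rightarrow> 'k poly) set"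
  where "polyfun_poly_valued F n = {P. \<forall>k. (\<lambda>x. coeff (P x) k) \<in> polyfun F n}"

context
  fixes F :: "'k::comm_ring_1 set"
  assumes F: "closed_ring F"
begin

lemma polyfun_uminus: "f \<in> polyfun F n \<Longrightarrow> (\<lambda>x. - f x) \<in> polyfun F n"
  using polyfun.mult[OF polyfun.const[of "-1"], of F f n] F by (simp add: closed_ring_intros)

lemma polyfun_diff: "f \<in> polyfun F n \<Longrightarrow> g \<in> polyfun F n \<Longrightarrow> (\<lambda>x. f x - g x) \<in> polyfun F n"
  using polyfun.add[OF _ polyfun_uminus, of f n g] by simp

lemma polyfun_sum: "(\<And>i. i \<in> I \<Longrightarrow> f i \<in> polyfun F n) \<Longrightarrow> (\<lambda>x. \<Sum>i\<in>I. f i x) \<in> polyfun F n"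
  by (induction I rule: infinite_finite_induct)
    (auto intro: polyfun.intros closed_ring_zero[OF F])

lemma polyfun_prod: "(\<And>i. i \<in> I \<Longrightarrow> f i \<in> polyfun F n) \<Longrightarrow> (\<lambda>x. \<Prod>i\<in>I. f i x) \<in> polyfun F n"
  by (induction I rule: infinite_finite_induct)
    (auto intro: polyfun.intros closed_ring_one[OF F])

lemma polyfun_power: "f \<in> polyfun F n \<Longrightarrow> (\<lambda>x. f x ^ m) \<in> polyfun F n"
  by (induction m) (auto intro: polyfun.intros closed_ring_one[OF F])

lemma polyfun_poly:
  "p \<in> polys F \<Longrightarrow> f \<in> polyfun F n \<Longrightarrow> (\<lambda>x. poly p (f x)) \<in> polyfun F n"
  unfolding poly_altdef by (intro polyfun_sum polyfun.mult polyfun.const polyfun_power polysD)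

lemma ppv_const: "f \<in> polyfun F n \<Longrightarrow> (\<lambda>x. [:f x:]) \<in> polyfun_poly_valued F n"
  unfolding polyfun_poly_valued_def
proof (intro CollectI allI)
  fix k assume "f \<in> polyfun F n"
  then show "(\<lambda>x. coeff [:f x:] k) \<in> polyfun F n"
    by (cases k) (auto intro: polyfun.const closed_ring_zero[OF F])
qed

lemma ppv_pCons: "f \<in> polyfun F n \<Longrightarrow> P \<in> polyfun_poly_valued F n \<Longrightarrow> (\<lambda>x. pCons (f x) (P x)) \<in> polyfun_poly_valued F n"
  unfolding polyfun_poly_valued_def
proof (intro CollectI allI)
  fix k assume "f \<in> polyfun F n" "P \<in> {P. \<forall>k. (\<lambda>x. coeff (P x) k) \<in> polyfun F n}"
  then show "(\<lambda>x. coeff (pCons (f x) (P x)) k) \<in> polyfun F n"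
    by (cases k) auto
qed

lemma ppv_add: "P \<in> polyfun_poly_valued F n \<Longrightarrow> Q \<in> polyfun_poly_valued F n \<Longrightarrow> (\<lambda>x. P x + Q x) \<in> polyfun_poly_valued F n"
  by (auto simp: polyfun_poly_valued_def intro: polyfun.intros)

lemma ppv_diff: "P \<in> polyfun_poly_valued F n \<Longrightarrow> Q \<in> polyfun_poly_valued F n \<Longrightarrow> (\<lambda>x. P x - Q x) \<in> polyfun_poly_valued F n"
  by (auto simp: polyfun_poly_valued_def intro: polyfun_diff)

lemma ppv_mult: "P \<in> polyfun_poly_valued F n \<Longrightarrow> Q \<in> polyfun_poly_valued F n \<Longrightarrow> (\<lambda>x. P x * Q x) \<in> polyfun_poly_valued F n"
  by (auto simp: polyfun_poly_valued_def coeff_mult intro!: polyfun_sum polyfun.mult)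

lemma ppv_smult: "f \<in> polyfun F n \<Longrightarrow> Q \<in> polyfun_poly_valued F n \<Longrightarrow> (\<lambda>x. smult (f x) (Q x)) \<in> polyfun_poly_valued F n"
  by (auto simp: polyfun_poly_valued_def intro!: polyfun.mult)

lemma ppv_prod: "(\<And>i. i \<in> I \<Longrightarrow> P i \<in> polyfun_poly_valued F n) \<Longrightarrow> (\<lambda>x. \<Prod>i\<in>I. P i x) \<in> polyfun_poly_valued F n"
proof (induction I rule: infinite_finite_induct)
  case (insert a I)
  then show ?case using ppv_mult[of "P a" n "\<lambda>x. \<Prod>i\<in>I. P i x"] by simp
qed (use ppv_const[OF polyfun.const[OF closed_ring_one[OF F]]] in \<open>auto simp: one_pCons\<close>)

lemma ppv_sum: "(\<And>i. i \<in> I \<Longrightarrow> P i \<in> polyfun_poly_valued F n) \<Longrightarrow> (\<lambda>x. \<Sum>i\<in>I. P i x) \<in> polyfun_poly_valued F n"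
proof (induction I rule: infinite_finite_induct)
  case (insert a I)
  then show ?case using ppv_add[of "P a" n "\<lambda>x. \<Sum>i\<in>I. P i x"] by simp
qed (use ppv_const[OF polyfun.const[OF closed_ring_zero[OF F]]] in auto)

lemma ppv_linear_factor: "f \<in> polyfun F n \<Longrightarrow> (\<lambda>x. [:- f x, 1:]) \<in> polyfun_poly_valued F n"
  using ppv_pCons[OF polyfun_uminus ppv_const[OF polyfun.const[OF closed_ring_one[OF F]]], of f] by simp

text \<open>The degree of \<open>P x\<close> varies with x. The uniform bound d is what allows f to
  be written as one sum over k <= d and allows induction on d later.\<close>

lemma polyfun_last_variable:
  "f \<in> polyfun F (Suc n) \<Longrightarrow>
   \<exists>P\<in>polyfun_poly_valued F n. \<exists>d. (\<forall>x. degree (P x) \<le> d) \<and> (\<forall>x. f x = poly (P x) (x n))"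
proof (induction rule: polyfun.induct)
  case (const c)
  show ?case
    by (rule bexI[OF _ ppv_const[OF polyfun.const[OF const]]]) (auto intro: exI[of _ 0])
next
  case (var i)
  show ?case
  proof (cases "i = n")
    case True
    show ?thesis
      by (rule bexI[OF _ ppv_pCons[OF polyfun.const[OF closed_ring_zero[OF F]]
              ppv_const[OF polyfun.const[OF closed_ring_one[OF F]]]]])
        (auto simp: True intro!: exI[of _ 1])
  next
    case False
    with var have "i < n" by simp
    show ?thesis
      by (rule bexI[OF _ ppv_const[OF polyfun.var[OF \<open>i < n\<close>]]]) (auto intro: exI[of _ 0])
  qed
next
  case (add f g)
  then obtain P d Q e where "P \<in> polyfun_poly_valued F n" "Q \<in> polyfun_poly_valued F n"
    "\<And>x. degree (P x) \<le> d" "\<And>x. degree (Q x) \<le> e"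
    "\<And>x. f x = poly (P x) (x n)" "\<And>x. g x = poly (Q x) (x n)" by metis
  then show ?case
    by (intro bexI[OF _ ppv_add[of P _ Q]] exI[of _ "max d e"])
      (auto intro: degree_add_le le_trans max.coboundedI1 max.coboundedI2)
next
  case (mult f g)
  then obtain P d Q e where "P \<in> polyfun_poly_valued F n" "Q \<in> polyfun_poly_valued F n"
    "\<And>x. degree (P x) \<le> d" "\<And>x. degree (Q x) \<le> e"
    "\<And>x. f x = poly (P x) (x n)" "\<And>x. g x = poly (Q x) (x n)" by metis
  then show ?case
    by (intro bexI[OF _ ppv_mult[of P _ Q]] exI[of _ "d + e"])
      (auto intro: le_trans[OF degree_mult_le] add_mono)
qed

text \<open>The divisor t^n + z_(n-1) t^(n-1) + ... + z_0 has the variables themselves as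
  coefficients. Being monic, it can be divided by without denominators, so the remainder still has
  polynomial functions of z as coefficients.\<close>

lemma reduce_mod_generic_monic:
  assumes "P \<in> polyfun_poly_valued F n" "\<And>z. degree (P z) \<le> d"
  shows "\<exists>Q\<in>polyfun_poly_valued F n. \<forall>z. (\<forall>k\<ge>n. coeff (Q z) k = 0) \<and>
    (\<forall>t. t ^ n + (\<Sum>k<n. z k * t ^ k) = 0 \<longrightarrow> poly (P z) t = poly (Q z) t)"
  using assms
proof (induction d arbitrary: P rule: less_induct)
  case (less d)
  show ?case
  proof (cases "d < n")
    case True
    then have "coeff (P z) k = 0" if "k \<ge> n" for z k
      using less.prems(2)[of z] that by (intro coeff_eq_0) linarith
    then show ?thesis using less.prems(1) by (intro bexI[of _ P]) simp_all
  next
    case False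
    let ?f = "\<lambda>z. monom 1 n + (\<Sum>k<n. monom (z k) k) :: 'k poly"
    let ?m = "\<lambda>z. monom (coeff (P z) d) (d - n)"
    let ?P = "\<lambda>z. P z - ?m z * ?f z"
    have m: "(\<lambda>z. monom (g z) j) \<in> polyfun_poly_valued F n" if "g \<in> polyfun F n" for g j
      unfolding polyfun_poly_valued_def
    proof (intro CollectI allI)
      fix k show "(\<lambda>z. coeff (monom (g z) j) k) \<in> polyfun F n"
        using that by (cases "j = k") (auto intro: polyfun.const closed_ring_zero[OF F])
    qed
    have c: "(\<lambda>z. coeff (P z) d) \<in> polyfun F n"
      using less.prems by (auto simp: polyfun_poly_valued_def)
    have f: "?f \<in> polyfun_poly_valued F n"
      using closed_ring_one[OF F] by (intro ppv_add ppv_sum m) (auto intro: polyfun.const polyfun.var)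
    have PP: "?P \<in> polyfun_poly_valued F n"
      using less.prems by (intro ppv_diff ppv_mult f m c)
    have "coeff (\<Sum>k<n. monom (z k) k) k = (if k < n then z k else 0)" for z :: "nat \<Rightarrow> 'k" and k
      by (auto simp: coeff_sum)
    then have cf: "coeff (?f z) k = (if k = n then 1 else if k < n then z k else 0)" for z k
      by auto
    have deg: "coeff (?P z) k = 0" if "k \<ge> d" for z k
    proof -
      have "coeff (P z) k = 0" if "k > d" 
        using less.prems(2)[of z] that by (intro coeff_eq_0) auto
      moreover have "k = d \<or> k > d" using that by auto
      ultimately show ?thesis
        using False by (auto simp: coeff_monom_mult cf simp del: coeff_add)
    qed
    have root: "poly (?P z) t = poly (P z) t" if "t ^ n + (\<Sum>k<n. z k * t ^ k) = 0" for z t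
    proof -
      have "poly (?f z) t = 0" using that by (simp add: poly_monom poly_sum)
      then show ?thesis by (simp only: poly_diff poly_mult mult_zero_right diff_zero)
    qed
    show ?thesis
    proof (cases d)
      \<comment> \<open>Here n = 0. The degree bound cannot decrease, but a single subtraction has
        already removed every coefficient.\<close>
      case 0
      have "\<forall>z. (\<forall>k\<ge>n. coeff (?P z) k = 0) \<and>
        (\<forall>t. t ^ n + (\<Sum>k<n. z k * t ^ k) = 0 \<longrightarrow> poly (P z) t = poly (?P z) t)"
        using deg root[symmetric] unfolding 0 by blast
      then show ?thesis by (intro bexI[OF _ PP])
    next
      case (Suc e)
      have "degree (?P z) \<le> e" for z
      proof (intro degree_le allI impI)
        fix i assume "e < i"
        then show "coeff (?P z) i = 0" using Suc by (intro deg) simp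
      qed
      from less.IH[OF _ PP this] Suc obtain Q where Q: "Q\<in>polyfun_poly_valued F n"
        "\<forall>z. (\<forall>k\<ge>n. coeff (Q z) k = 0) \<and>
        (\<forall>t. t ^ n + (\<Sum>k<n. z k * t ^ k) = 0 \<longrightarrow> poly (?P z) t = poly (Q z) t)" by blast
      have "\<forall>z. (\<forall>k\<ge>n. coeff (Q z) k = 0) \<and>
        (\<forall>t. t ^ n + (\<Sum>k<n. z k * t ^ k) = 0 \<longrightarrow> poly (P z) t = poly (Q z) t)"
      proof (intro allI conjI impI)
        fix z k t
        show "coeff (Q z) k = 0" if "n \<le> k" using Q(2) that by blast
        assume t: "t ^ n + (\<Sum>k<n. z k * t ^ k) = 0"
        show "poly (P z) t = poly (Q z) t"
          using root[OF t] Q(2) t by fastforce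
      qed
      then show ?thesis by (intro bexI[OF _ Q(1)])
    qed
  qed
qed

end

section \<open>Symmetric functions as coefficients of products of linear factors\<close>

definition root_poly :: "nat \<Rightarrow> (nat \<Rightarrow> 'k) \<Rightarrow> 'k::comm_ring_1 poly"
  where "root_poly n x = (\<Prod>i<n. [:- x i, 1:])"

lemma root_poly_Suc: "root_poly (Suc n) x = [:- x n, 1:] * root_poly n x"
  by (simp add: root_poly_def mult.commute)

lemma degree_root_poly: "degree (root_poly n (x :: nat \<Rightarrow> 'k::idom)) = n"
  unfolding root_poly_def by (subst degree_prod_eq_sum_degree) auto

lemma lead_coeff_root_poly: "coeff (root_poly n (x :: nat \<Rightarrow> 'k::idom)) n = 1"
proof -
  have "lead_coeff (root_poly n x) = 1"
    unfolding root_poly_def by (subst lead_coeff_prod) auto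
  then show ?thesis by (simp add: degree_root_poly)
qed

lemma poly_root_poly_eq_0_iff: "poly (root_poly n (x :: nat \<Rightarrow> 'k::idom)) t = 0 \<longleftrightarrow> (\<exists>i<n. t = x i)"
  by (auto simp: root_poly_def poly_prod prod_zero_iff)

lemma root_poly_permute:
  assumes "\<sigma> permutes {..<n}" shows "root_poly n (x \<circ> \<sigma>) = root_poly n x"
  unfolding root_poly_def comp_def
  using prod.permute[OF assms, of "\<lambda>i. [:- x i, 1:]"] by (simp add: comp_def)

text \<open>Horner's scheme: dividing the full product by X - x_n recovers its coefficients
  downwards from the leading 1, each being the next coefficient of the product plus x_n times the
  one found before. The function f needs x_n as an extra argument; it is stored at index
  \<open>Suc n\<close>, where the coefficient is the constant 1 anyway.\<close>

lemma synthetic_division: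
  assumes F: "closed_ring (F :: 'k::idom set)" and "j \<le> n"
  shows "\<exists>f\<in>polyfun F (Suc (Suc n)). \<forall>x.
    coeff (root_poly n x) j = f ((\<lambda>k. coeff (root_poly (Suc n) x) k)(Suc n := x n))"
  using \<open>j \<le> n\<close>
proof (induction j rule: inc_induct)
  case base
  show ?case
    by (rule bexI[OF _ polyfun.const[OF closed_ring_one[OF F]]]) (auto simp: lead_coeff_root_poly)
next
  case (step j)
  then obtain f where f: "f\<in>polyfun F (Suc (Suc n))" "\<And>x.
    coeff (root_poly n x) (Suc j) = f ((\<lambda>k. coeff (root_poly (Suc n) x) k)(Suc n := x n))" by blast
  have "coeff (root_poly n x) j = coeff (root_poly (Suc n) x) (Suc j) + x n * coeff (root_poly n x) (Suc j)" for x :: "nat \<Rightarrow> 'k"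
    by (simp add: root_poly_Suc)
  then show ?case
    using \<open>j < n\<close> f(2)
    by (intro bexI[OF _ polyfun.add[OF polyfun.var[of "Suc j"] polyfun.mult[OF polyfun.var[of "Suc n"] f(1)]]])
      (auto simp: fun_upd_other fun_upd_same simp del: fun_upd_apply)
qed

text \<open>Induction on the number of variables. Expand f in powers of the last variable; the
  coefficients are symmetric in the others, hence functions of their elementary symmetric functions,
  and by synthetic division functions of all the elementary symmetric functions together with the
  last variable. That variable is a root of the full product, so its powers can be reduced below
  degree n + 1. Distinct coordinates are required to conclude that the reduced polynomial is
  constant.\<close>

lemma symmetric_polyfun:
  fixes F :: "'k::field set"
  assumes F: "closed_ring F" and inf: "infinite (UNIV :: 'k set)"
    and f: "f \<in> polyfun F n" and sym: "\<And>\<sigma> x. \<sigma> permutes {..<n} \<Longrightarrow> f (x \<circ> \<sigma>) = f x"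
  shows "\<exists>g\<in>polyfun F n. \<forall>x. inj_on x {..<n} \<longrightarrow> f x = g (coeff (root_poly n x))"
  using f sym
proof (induction n arbitrary: f)
  case 0
  then show ?case by (intro bexI[of _ f]) (auto intro: polyfun_cong)
next
  case (Suc n)
  obtain P d where P: "P \<in> polyfun_poly_valued F n" "\<And>x. degree (P x) \<le> d"
    "\<And>x. f x = poly (P x) (x n)"
    using polyfun_last_variable[OF F Suc.prems(1)] by blast
  have P_cong: "P x = P y" if "\<And>i. i < n \<Longrightarrow> x i = y i" for x y
  proof (rule poly_eqI)
    fix k show "coeff (P x) k = coeff (P y) k"
      using P(1) that polyfun_cong[of "\<lambda>x. coeff (P x) k" F n x y] by (auto simp: polyfun_poly_valued_def)
  qed
  have P_sym: "P (x \<circ> \<sigma>) = P x" if \<sigma>: "\<sigma> permutes {..<n}" for \<sigma> and x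
  proof -
    have "poly (P (x \<circ> \<sigma>)) t = poly (P x) t" for t
    proof -
      let ?x = "x(n := t)"
      have \<sigma>n: "\<sigma> n = n" using \<sigma> by (auto simp: permutes_def)
      have \<sigma>': "\<sigma> permutes {..<Suc n}" using \<sigma> by (rule permutes_subset) auto
      have "P (x \<circ> \<sigma>) = P (?x \<circ> \<sigma>)"
        using permutes_in_image[OF \<sigma>] by (intro P_cong) (metis comp_apply fun_upd_apply lessThan_iff less_irrefl)
      moreover have "P x = P ?x" by (intro P_cong) auto
      ultimately show ?thesis
        using Suc.prems(2)[OF \<sigma>', of ?x] P(3)[of "?x \<circ> \<sigma>"] P(3)[of ?x] \<sigma>n by (metis comp_apply fun_upd_same)
    qed
    \<comment> \<open>An identity of values becomes an identity of polynomials because the field is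
      infinite.\<close>
    then have "{t. poly (P (x \<circ> \<sigma>) - P x) t = 0} = UNIV" by auto
    then have "P (x \<circ> \<sigma>) - P x = 0" using inf poly_roots_finite by metis
    then show ?thesis by simp
  qed
  have "\<exists>g\<in>polyfun F n. \<forall>x. inj_on x {..<n} \<longrightarrow> coeff (P x) k = g (coeff (root_poly n x))" for k
  proof (rule Suc.IH)
    show "(\<lambda>x. coeff (P x) k) \<in> polyfun F n" using P(1) by (auto simp: polyfun_poly_valued_def)
  qed (simp only: P_sym)
  then obtain g where g: "\<And>k. g k \<in> polyfun F n"
    "\<And>k x. inj_on x {..<n} \<Longrightarrow> coeff (P x) k = g k (coeff (root_poly n x))" by metis
  obtain s where s: "\<And>j. j < n \<Longrightarrow> s j \<in> polyfun F (Suc (Suc n))" "\<And>j x. j < n \<Longrightarrow>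
    coeff (root_poly n x) j = s j ((\<lambda>k. coeff (root_poly (Suc n) x) k)(Suc n := x n))"
    using synthetic_division[OF F, of _ n] less_imp_le by metis
  let ?h = "\<lambda>z. \<Sum>k\<le>d. g k (\<lambda>j. s j z) * z (Suc n) ^ k"
  have h: "?h \<in> polyfun F (Suc (Suc n))"
    using s(1) by (intro polyfun_sum[OF F] polyfun.mult polyfun_compose[OF g(1)] polyfun_power[OF F] polyfun.var) auto
  have h_eq: "f x = ?h ((\<lambda>k. coeff (root_poly (Suc n) x) k)(Suc n := x n))"
    if x: "inj_on x {..<Suc n}" for x
  proof -
    let ?z = "(\<lambda>k. coeff (root_poly (Suc n) x) k)(Suc n := x n)"
    have "inj_on x {..<n}" using x by (rule inj_on_subset) auto
    then have "coeff (P x) k = g k (\<lambda>j. s j ?z)" for k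
      using g(2) s(2) by (auto intro: polyfun_cong[OF g(1)])
    moreover have "poly (P x) (x n) = (\<Sum>k\<le>d. coeff (P x) k * x n ^ k)"
      unfolding poly_altdef using P(2)[of x] by (intro sum.mono_neutral_left) (auto intro: coeff_eq_0)
    ultimately show ?thesis using P(3)[of x] by simp
  qed
  obtain Q e where Q: "Q \<in> polyfun_poly_valued F (Suc n)" "\<And>z. degree (Q z) \<le> e"
    "\<And>z. ?h z = poly (Q z) (z (Suc n))"
    using polyfun_last_variable[OF F h] by blast
  obtain R where R: "R \<in> polyfun_poly_valued F (Suc n)" "\<And>z k. k \<ge> Suc n \<Longrightarrow> coeff (R z) k = 0"
    "\<And>z t. t ^ Suc n + (\<Sum>k<Suc n. z k * t ^ k) = 0 \<Longrightarrow> poly (Q z) t = poly (R z) t"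
    using reduce_mod_generic_monic[OF F Q(1,2)] by blast
  have Q_cong: "Q x = Q y" if "\<And>i. i < Suc n \<Longrightarrow> x i = y i" for x y
  proof (rule poly_eqI)
    fix k show "coeff (Q x) k = coeff (Q y) k"
      using Q(1) that polyfun_cong[of "\<lambda>x. coeff (Q x) k" F "Suc n" x y] by (auto simp: polyfun_poly_valued_def)
  qed
  have "f x = coeff (R (coeff (root_poly (Suc n) x))) 0" if x: "inj_on x {..<Suc n}" for x
  proof -
    let ?z = "coeff (root_poly (Suc n) x)"
    have last: "f y = poly (R (coeff (root_poly (Suc n) y))) (y n)" if y: "inj_on y {..<Suc n}" for y
    proof -
      let ?z = "coeff (root_poly (Suc n) y)"
      have "poly (root_poly (Suc n) y) (y n) = 0" by (auto simp: poly_root_poly_eq_0_iff)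
      moreover have "poly (root_poly (Suc n) y) t = t ^ Suc n + (\<Sum>k<Suc n. ?z k * t ^ k)" for t
        using lead_coeff_root_poly[of "Suc n" y]
        by (simp only: poly_altdef degree_root_poly lessThan_Suc_atMost[symmetric] sum.lessThan_Suc) simp
      ultimately have "poly (Q ?z) (y n) = poly (R ?z) (y n)" by (intro R(3)) simp
      moreover have "Q (?z(Suc n := y n)) = Q ?z" by (intro Q_cong) auto
      ultimately show ?thesis using h_eq[OF y] Q(3)[of "?z(Suc n := y n)"] by simp
    qed
    have all: "f x = poly (R ?z) (x i)" if i: "i < Suc n" for i
    proof -
      let ?\<sigma> = "transpose i n"
      have \<sigma>: "?\<sigma> permutes {..<Suc n}" using i by (intro permutes_swap_id) auto
      have "inj_on (x \<circ> ?\<sigma>) {..<Suc n}"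
        using x \<sigma> by (auto intro!: comp_inj_on permutes_inj_on[OF \<sigma>] simp: permutes_image[OF \<sigma>])
      from last[OF this] show ?thesis
        using Suc.prems(2)[OF \<sigma>, of x] root_poly_permute[OF \<sigma>, of x] by simp
    qed
    \<comment> \<open>The polynomial has degree at most n but takes the value f x at n + 1 distinct
      points.\<close>
    have "R ?z = [:f x:]"
    proof (rule poly_eqI_degree)
      show "\<And>t. t \<in> x ` {..<Suc n} \<Longrightarrow> poly (R ?z) t = poly [:f x:] t" using all by auto
      have "card (x ` {..<Suc n}) = Suc n" using x by (subst card_image) auto
      moreover have "degree (R ?z) \<le> n" using R(2) by (intro degree_le) auto
      ultimately show "degree (R ?z) < card (x ` {..<Suc n})" "degree [:f x:] < card (x ` {..<Suc n})" by auto
    qed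
    then show ?thesis by simp
  qed
  moreover have "(\<lambda>z. coeff (R z) 0) \<in> polyfun F (Suc n)"
    using R(1) by (auto simp: polyfun_poly_valued_def)
  ultimately show ?case by (intro bexI[of _ "\<lambda>z. coeff (R z) 0"]) auto
qed

lemma polyfun_on_line:
  "f \<in> polyfun UNIV n \<Longrightarrow> \<exists>p. \<forall>t. f (\<lambda>i. a i + t * b i) = poly p t"
proof (induction rule: polyfun.induct)
  case (const c) show ?case by (rule exI[of _ "[:c:]"]) auto
next
  case (var i) show ?case by (rule exI[of _ "[:a i, b i:]"]) auto
next
  case (add f g) then show ?case by (metis poly_add)
next
  case (mult f g) then show ?case by (metis poly_mult)
qed

text \<open>This removes the restriction to distinct coordinates, so that repeated roots are
  allowed. On the line through \<alpha> in a direction with distinct entries, all but finitely many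
  points have distinct coordinates; the difference of both sides is a polynomial in the parameter
  with infinitely many zeros, and so vanishes at \<alpha> too.\<close>

lemma symmetric_value:
  fixes F :: "'k::alg_closed_field set"
  assumes F: "closed_ring F" and \<alpha>: "root_poly n \<alpha> \<in> polys F"
    and f: "f \<in> polyfun F n" and sym: "\<And>\<sigma> x. \<sigma> permutes {..<n} \<Longrightarrow> f (x \<circ> \<sigma>) = f x"
  shows "f \<alpha> \<in> F"
proof -
  obtain g where g: "g\<in>polyfun F n" "\<And>x. inj_on x {..<n} \<Longrightarrow> f x = g (coeff (root_poly n x))"
    using symmetric_polyfun[OF F infinite_UNIV_alg_closed f sym] by blast
  have up: "h \<in> polyfun UNIV n" if "h \<in> polyfun F n" for h
    using that by (induction rule: polyfun.induct) (auto intro: polyfun.intros)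
  have U: "closed_ring (UNIV :: 'k set)" by (simp add: closed_ring_def)
  have "root_poly n \<in> polyfun_poly_valued (UNIV :: 'k set) n"
    unfolding root_poly_def by (intro ppv_prod[OF U] ppv_linear_factor[OF U] polyfun.var) auto
  then have rp: "(\<lambda>x. coeff (root_poly n x) k) \<in> polyfun (UNIV :: 'k set) n" for k :: nat
    by (auto simp: polyfun_poly_valued_def)
  have fg: "(\<lambda>x. f x - g (coeff (root_poly n x))) \<in> polyfun UNIV n"
    by (intro polyfun_diff[OF U] up f polyfun_compose[OF up[OF g(1)] rp])
  obtain \<xi> :: "nat \<Rightarrow> 'k" where \<xi>: "inj \<xi>"
    using infinite_countable_subset[OF infinite_UNIV_alg_closed] by blast
  from polyfun_on_line[OF fg, of \<alpha> \<xi>] obtain p where p: "\<And>t. f (\<lambda>i. \<alpha> i + t * \<xi> i) - g (coeff (root_poly n (\<lambda>i. \<alpha> i + t * \<xi> i))) = poly p t"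
    by blast
  let ?bad = "(\<lambda>(i, j). (\<alpha> j - \<alpha> i) / (\<xi> i - \<xi> j)) ` ({..<n} \<times> {..<n})"
  have "poly p t = 0" if t: "t \<notin> ?bad" for t
  proof -
    have "inj_on (\<lambda>i. \<alpha> i + t * \<xi> i) {..<n}"
    proof (rule inj_onI, rule ccontr)
      fix i j assume ij: "i \<in> {..<n}" "j \<in> {..<n}" "\<alpha> i + t * \<xi> i = \<alpha> j + t * \<xi> j" "i \<noteq> j"
      then have "\<xi> i - \<xi> j \<noteq> 0" using \<xi> by (auto dest: injD)
      then have "t = (\<alpha> j - \<alpha> i) / (\<xi> i - \<xi> j)" using ij by (simp add: field_simps)
      then have "t \<in> ?bad" using ij(1,2) by (intro image_eqI[of _ _ "(i, j)"]) auto
      then show False using t by contradiction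
    qed
    then show ?thesis using p[of t] g(2) by simp
  qed
  then have "- ?bad \<subseteq> {t. poly p t = 0}" by auto
  moreover have "infinite (- ?bad)"
    unfolding Compl_eq_Diff_UNIV
    by (intro Diff_infinite_finite infinite_UNIV_alg_closed finite_imageI finite_SigmaI) auto
  ultimately have "p = 0" using poly_roots_finite finite_subset by blast
  then have "f \<alpha> = g (coeff (root_poly n \<alpha>))" using p[of 0] by simp
  moreover have "g (coeff (root_poly n \<alpha>)) \<in> F"
    using \<alpha> by (intro polyfun_value[OF g(1) F]) (auto dest: polysD)
  ultimately show ?thesis by simp
qed

text \<open>This stands in for the invariance of a polynomial under a Galois group: permuting the
  roots \<alpha> only permutes the family y, so the coefficients of the product are symmetric in
  \<alpha>.\<close>

lemma symmetric_family:
  fixes F :: "'k::alg_closed_field set"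
  assumes F: "closed_ring F" and \<alpha>: "root_poly n \<alpha> \<in> polys F"
    and y: "\<And>i. i \<in> I \<Longrightarrow> y i \<in> polyfun F n"
    and act: "\<And>\<sigma>. \<sigma> permutes {..<n} \<Longrightarrow> \<exists>\<pi>. bij_betw \<pi> I I \<and> (\<forall>i\<in>I. \<forall>x. y i (x \<circ> \<sigma>) = y (\<pi> i) x)"
  shows "(\<Prod>i\<in>I. [:- y i \<alpha>, 1:]) \<in> polys F"
proof (rule polysI)
  fix k
  show "coeff (\<Prod>i\<in>I. [:- y i \<alpha>, 1:]) k \<in> F"
  proof (rule symmetric_value[OF F \<alpha>, where f = "\<lambda>x. coeff (\<Prod>i\<in>I. [:- y i x, 1:]) k"])
    show "(\<lambda>x. coeff (\<Prod>i\<in>I. [:- y i x, 1:]) k) \<in> polyfun F n"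
      using ppv_prod[OF F ppv_linear_factor[OF F y], of I "\<lambda>i. i"]
      by (simp add: polyfun_poly_valued_def)
  next
    fix \<sigma> :: "nat \<Rightarrow> nat" and x :: "nat \<Rightarrow> 'k" assume "\<sigma> permutes {..<n}"
    from act[OF this] obtain \<pi> where \<pi>: "bij_betw \<pi> I I" "\<And>i x. i \<in> I \<Longrightarrow> y i (x \<circ> \<sigma>) = y (\<pi> i) x" by blast
    have "(\<Prod>i\<in>I. [:- y i (x \<circ> \<sigma>), 1:]) = (\<Prod>i\<in>I. [:- y (\<pi> i) x, 1:])"
      using \<pi>(2) by (intro prod.cong) auto
    also have "\<dots> = (\<Prod>i\<in>I. [:- y i x, 1:])"
      using prod.reindex_bij_betw[OF \<pi>(1), of "\<lambda>i. [:- y i x, 1:]"] .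
    finally show "coeff (\<Prod>i\<in>I. [:- y i (x \<circ> \<sigma>), 1:]) k = coeff (\<Prod>i\<in>I. [:- y i x, 1:]) k" by simp
  qed
qed

section \<open>Extension of homomorphisms\<close>

text \<open>Encoded as a relation so that the upper bound of a chain is its union. The clause on 0
  makes the relation single-valued, by subtraction of two pairs with equal first entry.\<close>

definition partial_hom :: "('k::field \<times> 'k) set \<Rightarrow> bool"
  where "partial_hom r \<longleftrightarrow> (1, 1) \<in> r \<and> (\<forall>y. (0, y) \<in> r \<longrightarrow> y = 0) \<and>
    (\<forall>x y x' y'. (x, y) \<in> r \<longrightarrow> (x', y') \<in> r \<longrightarrow> (x - x', y - y') \<in> r \<and> (x * x', y * y') \<in> r)"

lemma partial_hom_unique:
  assumes "partial_hom r" "(x, y) \<in> r" "(x, y') \<in> r" shows "y = y'"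
proof -
  have "(x - x, y - y') \<in> r" using assms unfolding partial_hom_def by blast
  then show ?thesis using assms(1) by (auto simp: partial_hom_def)
qed

lemma closed_ring_Domain: "partial_hom r \<Longrightarrow> closed_ring (Domain r)"
  unfolding partial_hom_def closed_ring_def Domain_iff by blast

definition hom_fun :: "('k::field \<times> 'k) set \<Rightarrow> 'k \<Rightarrow> 'k"
  where "hom_fun r x = (if x \<in> Domain r then (THE y. (x, y) \<in> r) else 0)"

context
  fixes r :: "('k::field \<times> 'k) set"
  assumes r: "partial_hom r"
begin

lemma hom_fun_eq: "(x, y) \<in> r \<Longrightarrow> hom_fun r x = y"
  unfolding hom_fun_def using partial_hom_unique[OF r] by (auto intro!: the_equality)

lemma hom_fun_mem: "x \<in> Domain r \<Longrightarrow> (x, hom_fun r x) \<in> r"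
  using hom_fun_eq by auto

lemma hom_fun_diff: "x \<in> Domain r \<Longrightarrow> y \<in> Domain r \<Longrightarrow> hom_fun r (x - y) = hom_fun r x - hom_fun r y"
  and hom_fun_mult: "x \<in> Domain r \<Longrightarrow> y \<in> Domain r \<Longrightarrow> hom_fun r (x * y) = hom_fun r x * hom_fun r y"
  and hom_fun_one: "hom_fun r 1 = 1"
proof -
  have "(x - y, hom_fun r x - hom_fun r y) \<in> r \<and> (x * y, hom_fun r x * hom_fun r y) \<in> r"
    if "x \<in> Domain r" "y \<in> Domain r"
    using r hom_fun_mem[OF that(1)] hom_fun_mem[OF that(2)] unfolding partial_hom_def by blast
  then show "x \<in> Domain r \<Longrightarrow> y \<in> Domain r \<Longrightarrow> hom_fun r (x - y) = hom_fun r x - hom_fun r y"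
    and "x \<in> Domain r \<Longrightarrow> y \<in> Domain r \<Longrightarrow> hom_fun r (x * y) = hom_fun r x * hom_fun r y"
    by (blast intro: hom_fun_eq)+
  show "hom_fun r 1 = 1" using r by (auto simp: partial_hom_def intro: hom_fun_eq)
qed

lemma hom_fun_zero: "hom_fun r 0 = 0"
  using hom_fun_diff[of 1 1] closed_ring_one[OF closed_ring_Domain[OF r]] by simp

lemma hom_fun_uminus: "x \<in> Domain r \<Longrightarrow> hom_fun r (- x) = - hom_fun r x"
  using hom_fun_diff[of 0 x] closed_ring_zero[OF closed_ring_Domain[OF r]] by (simp add: hom_fun_zero)

lemma hom_fun_add: "x \<in> Domain r \<Longrightarrow> y \<in> Domain r \<Longrightarrow> hom_fun r (x + y) = hom_fun r x + hom_fun r y"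
  using hom_fun_diff[of x "- y"] closed_ring_uminus[OF closed_ring_Domain[OF r], of y] by (simp add: hom_fun_uminus)

lemma hom_fun_sum: "(\<And>i. i \<in> I \<Longrightarrow> f i \<in> Domain r) \<Longrightarrow> hom_fun r (sum f I) = (\<Sum>i\<in>I. hom_fun r (f i))"
proof (induction I rule: infinite_finite_induct)
  case (insert i I)
  then have "sum f I \<in> Domain r" by (intro closed_ring_sum[OF closed_ring_Domain[OF r]]) auto
  then show ?case using insert by (simp add: hom_fun_add)
qed (auto simp: hom_fun_zero)

lemma map_hom_fun_diff:
  "p \<in> polys (Domain r) \<Longrightarrow> q \<in> polys (Domain r) \<Longrightarrow>
   map_poly (hom_fun r) (p - q) = map_poly (hom_fun r) p - map_poly (hom_fun r) q"
  by (intro poly_eqI) (simp add: coeff_map_poly hom_fun_zero hom_fun_diff polysD)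

lemma map_hom_fun_mult:
  assumes p: "p \<in> polys (Domain r)" and q: "q \<in> polys (Domain r)"
  shows "map_poly (hom_fun r) (p * q) = map_poly (hom_fun r) p * map_poly (hom_fun r) q"
proof (rule poly_eqI)
  fix n
  have "coeff (map_poly (hom_fun r) (p * q)) n = (\<Sum>i\<le>n. hom_fun r (coeff p i * coeff q (n - i)))"
    unfolding coeff_map_poly[of "hom_fun r", OF hom_fun_zero] coeff_mult
    by (intro hom_fun_sum closed_ring_mult[OF closed_ring_Domain[OF r]] polysD[OF p] polysD[OF q])
  also have "\<dots> = coeff (map_poly (hom_fun r) p * map_poly (hom_fun r) q) n"
    unfolding coeff_mult coeff_map_poly[of "hom_fun r", OF hom_fun_zero]
    by (intro sum.cong HOL.refl hom_fun_mult polysD[OF p] polysD[OF q])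
  finally show "coeff (map_poly (hom_fun r) (p * q)) n = coeff (map_poly (hom_fun r) p * map_poly (hom_fun r) q) n" .
qed

text \<open>The extension sends p(x) to the value at y of the image of p. It is well defined because
  p(x) = 0 makes p a multiple of h, with a quotient whose coefficients again lie in the
  domain.\<close>

lemma extend_partial_hom:
  assumes h: "minpoly (Domain r) x h" and y: "poly (map_poly (hom_fun r) h) y = 0"
  shows "\<exists>r'. partial_hom r' \<and> r \<subseteq> r' \<and> (x, y) \<in> r'"
proof -
  let ?\<tau> = "map_poly (hom_fun r)"
  let ?D = "Domain r"
  note D = closed_ring_Domain[OF r]
  note PD = closed_ring_polys[OF D]
  let ?r = "(\<lambda>p. (poly p x, poly (?\<tau> p) y)) ` polys ?D"
  have const: "[:c:] \<in> polys ?D" "?\<tau> [:c:] = [:hom_fun r c:]" if "c \<in> ?D" for c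
    using that D by (auto intro: const_in_polys poly_eqI simp: coeff_map_poly hom_fun_zero coeff_pCons split: nat.splits)
  have "partial_hom ?r"
    unfolding partial_hom_def
  proof (intro conjI allI impI)
    show "(1, 1) \<in> ?r"
      using const[OF closed_ring_one[OF D]] by (intro image_eqI[of _ _ "[:1:]"]) (auto simp: hom_fun_one)
  next
    fix z assume "(0, z) \<in> ?r"
    then obtain p where p: "p \<in> polys ?D" "poly p x = 0" "z = poly (?\<tau> p) y" by auto
    then obtain q where q: "p = h * q" using h by (auto simp: minpoly_def)
    have hD: "h \<in> polys ?D" "lead_coeff h = 1" using h by (auto simp: minpoly_def)
    have "q \<in> polys ?D" using quotient_in_polys[OF D hD p(1) q] .
    then show "z = 0" using y p q hD by (simp add: map_hom_fun_mult)
  next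
    fix a b a' b' assume "(a, b) \<in> ?r" "(a', b') \<in> ?r"
    then obtain p q where pq: "p \<in> polys ?D" "q \<in> polys ?D" "a = poly p x" "b = poly (?\<tau> p) y"
      "a' = poly q x" "b' = poly (?\<tau> q) y" by auto
    show "(a - a', b - b') \<in> ?r"
      using pq closed_ring_diff[OF PD] by (intro image_eqI[of _ _ "p - q"]) (auto simp: map_hom_fun_diff)
    show "(a * a', b * b') \<in> ?r"
      using pq closed_ring_mult[OF PD] by (intro image_eqI[of _ _ "p * q"]) (auto simp: map_hom_fun_mult)
  qed
  moreover have "r \<subseteq> ?r"
  proof
    fix z assume z: "z \<in> r"
    then have "fst z \<in> ?D" "snd z = hom_fun r (fst z)" using hom_fun_eq[of "fst z" "snd z"] by (cases z, auto)+
    then show "z \<in> ?r" using const[of "fst z"] by (intro image_eqI[of _ _ "[:fst z:]"]) (auto simp: prod_eq_iff)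
  qed
  moreover have "?\<tau> [:0, 1:] = [:0, 1:]"
    by (intro poly_eqI) (auto simp: coeff_map_poly hom_fun_zero hom_fun_one coeff_pCons split: nat.splits)
  then have "(x, y) \<in> ?r" by (intro image_eqI[of _ _ "[:0, 1:]"]) (auto intro: X_in_polys[OF D])
  ultimately show ?thesis by blast
qed

end

text \<open>The assignment a to b extends to the ring generated by F and a, and Zorn's lemma yields
  a maximal extension. Its domain is everything, since any further element could be sent to a root
  of the image of its minimal polynomial.\<close>

lemma hom_extension:
  fixes F :: "'k::alg_closed_field set"
  assumes F: "alg_base F" and a: "minpoly F a h" and b: "poly h b = 0"
  shows "\<exists>s::'k \<Rightarrow> 'k. (\<forall>x y. s (x + y) = s x + s y \<and> s (x * y) = s x * s y) \<and> s 1 = 1 \<and>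
    (\<forall>x\<in>F. s x = x) \<and> s a = b"
proof -
  note R = alg_base_ring[OF F]
  have r0: "partial_hom (Id_on F)"
    using R by (auto simp: partial_hom_def intro: closed_ring_intros)
  have D0: "Domain (Id_on F) = F" by auto
  have "map_poly (hom_fun (Id_on F)) h = h"
    using a hom_fun_eq[OF r0] hom_fun_zero[OF r0] by (intro poly_eqI) (auto simp: coeff_map_poly minpoly_def dest: polysD)
  then obtain r1 where r1: "partial_hom r1" "Id_on F \<subseteq> r1" "(a, b) \<in> r1"
    using extend_partial_hom[OF r0, of a h b] a b D0 by auto
  let ?A = "{r. partial_hom r \<and> r1 \<subseteq> r}"
  have "\<exists>m\<in>?A. \<forall>s\<in>?A. m \<subseteq> s \<longrightarrow> s = m"
  proof (rule subset_Zorn_nonempty)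
    show "?A \<noteq> {}" using r1 by auto
    fix C assume C: "C \<noteq> {}" "subset.chain ?A C"
    then obtain r where rC: "r \<in> C" by auto
    have CA: "s \<in> C \<Longrightarrow> partial_hom s \<and> r1 \<subseteq> s" for s using C by (auto simp: subset.chain_def)
    have tot: "s \<in> C \<Longrightarrow> t \<in> C \<Longrightarrow> s \<subseteq> t \<or> t \<subseteq> s" for s t using C unfolding subset_chain_def by blast
    have "partial_hom (\<Union>C)"
      unfolding partial_hom_def
    proof (intro conjI allI impI)
      show "(1, 1) \<in> \<Union>C" using CA[OF rC] rC by (auto simp: partial_hom_def)
      show "y = 0" if "(0, y) \<in> \<Union>C" for y using that CA by (auto simp: partial_hom_def)
      fix x y x' y' assume "(x, y) \<in> \<Union>C" "(x', y') \<in> \<Union>C"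
      then obtain s t where "s \<in> C" "t \<in> C" "(x, y) \<in> s" "(x', y') \<in> t" by auto
      with tot obtain u where u: "u \<in> C" "(x, y) \<in> u" "(x', y') \<in> u" by blast
      then show "(x - x', y - y') \<in> \<Union>C" "(x * x', y * y') \<in> \<Union>C"
        using CA[OF u(1)] unfolding partial_hom_def by blast+
    qed
    then show "\<Union>C \<in> ?A" using CA[OF rC] rC by auto
  qed
  then obtain m where m: "partial_hom m" "r1 \<subseteq> m" and max: "\<And>s. partial_hom s \<Longrightarrow> m \<subseteq> s \<Longrightarrow> s = m"
    by (auto intro: order_trans)
  have "F \<subseteq> Domain m" using r1(2) m(2) by blast
  then have base: "alg_base (Domain m)"
    using alg_base_mono[OF F] closed_field_if_ring[OF F closed_ring_Domain[OF m(1)]] by blast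
  have dom: "x \<in> Domain m" for x
  proof -
    obtain g where g: "minpoly (Domain m) x g" using minpoly_exists[OF base] by blast
    \<comment> \<open>The image of the minimal polynomial keeps its leading coefficient 1, hence has
      positive degree and a root.\<close>
    have "coeff (map_poly (hom_fun m) g) (degree g) = 1"
      using g by (simp add: coeff_map_poly hom_fun_zero[OF m(1)] hom_fun_one[OF m(1)] minpoly_def)
    then have "degree g \<le> degree (map_poly (hom_fun m) g)" by (intro le_degree) simp
    then obtain y where "poly (map_poly (hom_fun m) g) y = 0"
      using minpoly_degree[OF g] alg_closed_imp_poly_has_root[of "map_poly (hom_fun m) g"] by auto
    from extend_partial_hom[OF m(1) g this] obtain m' where m': "partial_hom m'" "m \<subseteq> m'" "(x, y) \<in> m'" by blast
    then have "m' = m" using max by blast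
    then show ?thesis using m'(3) by blast
  qed
  let ?s = "hom_fun m"
  show ?thesis
  proof (intro exI[of _ ?s] conjI allI ballI)
    show "?s (x + y) = ?s x + ?s y" "?s (x * y) = ?s x * ?s y" for x y
      using hom_fun_add[OF m(1) dom dom] hom_fun_mult[OF m(1) dom dom] by blast+
    show "?s 1 = 1" by (rule hom_fun_one[OF m(1)])
    show "?s x = x" if "x \<in> F" for x using that r1(2) m(2) by (intro hom_fun_eq[OF m(1)]) auto
    show "?s a = b" using r1(3) m(2) by (intro hom_fun_eq[OF m(1)]) auto
  qed
qed

text \<open>Irreducibility in disguise: if h = g q with g minimal for y, then q cannot vanish at x
  for reasons of degree, so g does, and h divides g.\<close>

lemma minpoly_other_root:
  assumes F: "alg_base F" and x: "minpoly F x h" and y: "poly h y = 0"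
  shows "minpoly F y h"
proof -
  obtain g where g: "minpoly F y g" using minpoly_exists[OF F] by blast
  then have gF: "g \<in> polys F" "lead_coeff g = 1" and hF: "h \<in> polys F" "lead_coeff h = 1"
    using x by (auto simp: minpoly_def)
  have "g dvd h" using g x y by (auto simp: minpoly_def)
  then obtain q where q: "h = g * q" by blast
  have qF: "q \<in> polys F" using quotient_in_polys[OF alg_base_ring[OF F] gF hF(1) q] .
  have "h \<noteq> 0" using hF by auto
  then have nz: "g \<noteq> 0" "q \<noteq> 0" using q by auto
  have "poly q x \<noteq> 0"
  proof
    assume "poly q x = 0"
    then have "h dvd q" using x qF by (auto simp: minpoly_def)
    then have "degree h \<le> degree q" using nz by (intro dvd_imp_degree_le)
    then show False using minpoly_degree[OF g] nz by (simp add: q degree_mult_eq)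
  qed
  moreover have "poly h x = 0" using x by (auto simp: minpoly_def)
  ultimately have "poly g x = 0" by (simp add: q)
  then have hg: "h dvd g" using x gF by (auto simp: minpoly_def)
  have "lead_coeff q = 1" using hF(2) gF(2) by (simp add: q lead_coeff_mult)
  moreover have "degree q = 0"
    using dvd_imp_degree_le[OF hg nz(1)] nz by (simp add: q degree_mult_eq)
  ultimately have "q = 1" by (auto elim!: degree_eq_zeroE simp: one_pCons)
  then show ?thesis using g q by simp
qed

lemma monic_eq_root_poly:
  fixes p :: "'k::alg_closed_field poly"
  assumes "lead_coeff p = 1" shows "\<exists>\<alpha>. p = root_poly (degree p) \<alpha>"
proof -
  have "p \<noteq> 0" using assms by auto
  from alg_closed_imp_factorization[OF this] obtain A
    where A: "size A = degree p" "p = smult (lead_coeff p) (\<Prod>x\<in>#A. [:-x, 1:])" by blast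
  obtain xs where xs: "A = mset xs" by (metis ex_mset)
  have "p = (\<Prod>x\<leftarrow>xs. [:-x, 1:])" using A assms xs by (simp flip: prod_mset_prod_list)
  also have "\<dots> = root_poly (degree p) (\<lambda>i. xs ! i)"
    using A(1) by (simp add: xs root_poly_def prod.list_conv_set_nth atLeast0LessThan)
  finally show ?thesis by blast
qed

lemma root_poly_Suc_shift: "root_poly (Suc n) \<alpha> = [:- \<alpha> 0, 1:] * root_poly n (\<lambda>i. \<alpha> (Suc i))"
  unfolding root_poly_def by (rule prod.lessThan_Suc_shift)

section \<open>Valuations on an algebraically closed field\<close>

definition valuation :: "('k::field \<Rightarrow> 'g::linordered_ab_group_add) \<Rightarrow> bool"
  where "valuation v \<longleftrightarrow> (\<forall>x y. x \<noteq> 0 \<longrightarrow> y \<noteq> 0 \<longrightarrow>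
    v (x * y) = v x + v y \<and> (x + y \<noteq> 0 \<longrightarrow> min (v x) (v y) \<le> v (x + y)))"

locale valued_field =
  fixes v :: "'k::field \<Rightarrow> 'g::linordered_ab_group_add"
  assumes val: "valuation v"
begin

definition O\<^sub>v :: "'k set" where "O\<^sub>v = {x. x = 0 \<or> 0 \<le> v x}"
definition M\<^sub>v :: "'k set" where "M\<^sub>v = {x. x = 0 \<or> 0 < v x}"

lemma v_mult: "x \<noteq> 0 \<Longrightarrow> y \<noteq> 0 \<Longrightarrow> v (x * y) = v x + v y"
  and v_add: "x \<noteq> 0 \<Longrightarrow> y \<noteq> 0 \<Longrightarrow> x + y \<noteq> 0 \<Longrightarrow> min (v x) (v y) \<le> v (x + y)"
  using val by (auto simp: valuation_def)

lemma v_one: "v 1 = 0"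
  using v_mult[of 1 1] by simp

lemma v_inverse: "x \<noteq> 0 \<Longrightarrow> v (inverse x) = - v x"
  using v_mult[of x "inverse x"] v_one by (simp add: eq_neg_iff_add_eq_0 add.commute)

lemma v_divide: "x \<noteq> 0 \<Longrightarrow> y \<noteq> 0 \<Longrightarrow> v (x / y) = v x - v y"
  by (simp add: divide_inverse v_mult v_inverse)

lemma double_eq_0: "g + g = 0 \<Longrightarrow> g = 0" for g :: 'g
  by (metis add_neg_neg add_pos_pos less_irrefl linorder_neqE)

lemma v_uminus: "v (- x) = v x"
proof (cases "x = 0")
  case False
  have "v (- 1) + v (- 1) = 0" using v_mult[of "- 1" "- 1"] v_one by simp
  then have "v (- 1) = 0" by (rule double_eq_0)
  then show ?thesis using v_mult[of "- 1" x] False by simp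
qed simp

lemma v_sum_gt:
  assumes "\<And>i. i \<in> I \<Longrightarrow> f i = 0 \<or> g < v (f i)"
  shows "sum f I = 0 \<or> g < v (sum f I)"
  using assms
proof (induction I rule: infinite_finite_induct)
  case (insert i I)
  then have "f i = 0 \<or> g < v (f i)" "sum f I = 0 \<or> g < v (sum f I)" by auto
  then show ?case
    using v_add[of "f i" "sum f I"] insert(1,2)
    by (cases "f i = 0 \<or> sum f I = 0 \<or> f i + sum f I = 0") (auto simp: min_le_iff_disj)
qed auto

lemma closed_ring_O: "closed_ring O\<^sub>v"
  unfolding closed_ring_def
proof (intro conjI ballI)
  show "1 \<in> O\<^sub>v" by (simp add: O\<^sub>v_def v_one)
  fix x y assume "x \<in> O\<^sub>v" "y \<in> O\<^sub>v"
  then show "x * y \<in> O\<^sub>v" by (cases "x = 0 \<or> y = 0") (auto simp: O\<^sub>v_def v_mult)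
  show "x - y \<in> O\<^sub>v"
    using \<open>x \<in> O\<^sub>v\<close> \<open>y \<in> O\<^sub>v\<close> v_add[of x "- y"]
    by (cases "x = 0 \<or> y = 0 \<or> x = y") (auto simp: O\<^sub>v_def v_uminus min_le_iff_disj)
qed

lemma M_subset_O: "M\<^sub>v \<subseteq> O\<^sub>v" and zero_M: "0 \<in> M\<^sub>v" and one_notin_M: "1 \<notin> M\<^sub>v"
  by (auto simp: M\<^sub>v_def O\<^sub>v_def v_one)

lemma M_mult: "x \<in> M\<^sub>v \<Longrightarrow> y \<in> O\<^sub>v \<Longrightarrow> x * y \<in> M\<^sub>v"
  by (cases "x = 0 \<or> y = 0") (auto simp: M\<^sub>v_def O\<^sub>v_def v_mult add_pos_nonneg)

lemma M_mult2: "x \<in> O\<^sub>v \<Longrightarrow> y \<in> M\<^sub>v \<Longrightarrow> x * y \<in> M\<^sub>v"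
  using M_mult by (metis mult.commute)

lemma M_uminus: "x \<in> M\<^sub>v \<Longrightarrow> - x \<in> M\<^sub>v"
  by (auto simp: M\<^sub>v_def v_uminus)

lemma M_sum: "(\<And>i. i \<in> I \<Longrightarrow> f i \<in> M\<^sub>v) \<Longrightarrow> sum f I \<in> M\<^sub>v"
  using v_sum_gt[of I f 0] by (auto simp: M\<^sub>v_def)

lemma M_add: "x \<in> M\<^sub>v \<Longrightarrow> y \<in> M\<^sub>v \<Longrightarrow> x + y \<in> M\<^sub>v"
  using v_add[of x y] by (cases "x = 0 \<or> y = 0 \<or> x + y = 0") (auto simp: M\<^sub>v_def min_le_iff_disj)

lemma M_diff: "x \<in> M\<^sub>v \<Longrightarrow> y \<in> M\<^sub>v \<Longrightarrow> x - y \<in> M\<^sub>v"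
  using M_add[of x "- y"] M_uminus by simp

lemma unit_iff: "x \<in> O\<^sub>v - M\<^sub>v \<longleftrightarrow> x \<noteq> 0 \<and> v x = 0"
  by (auto simp: M\<^sub>v_def O\<^sub>v_def)

lemma O_I: "v x = 0 \<Longrightarrow> x \<in> O\<^sub>v" and M_I: "0 < v x \<Longrightarrow> x \<in> M\<^sub>v"
  by (auto simp: M\<^sub>v_def O\<^sub>v_def)

lemma not_M_mult: "x \<in> O\<^sub>v \<Longrightarrow> y \<in> O\<^sub>v \<Longrightarrow> x \<notin> M\<^sub>v \<Longrightarrow> y \<notin> M\<^sub>v \<Longrightarrow> x * y \<notin> M\<^sub>v"
  by (auto simp: M\<^sub>v_def O\<^sub>v_def v_mult)

lemma not_M_power: "x \<in> O\<^sub>v \<Longrightarrow> x \<notin> M\<^sub>v \<Longrightarrow> x ^ n \<notin> M\<^sub>v"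
  by (induction n) (auto simp: one_notin_M not_M_mult closed_ring_power[OF closed_ring_O])

lemma M_power: "x \<in> M\<^sub>v \<Longrightarrow> 0 < n \<Longrightarrow> x ^ n \<in> M\<^sub>v"
  by (induction n) (auto intro!: M_mult closed_ring_power[OF closed_ring_O] dest: M_subset_O[THEN subsetD])

lemma not_M_prod: "(\<And>i. i \<in> I \<Longrightarrow> f i \<in> O\<^sub>v) \<Longrightarrow> (\<And>i. i \<in> I \<Longrightarrow> f i \<notin> M\<^sub>v) \<Longrightarrow> prod f I \<notin> M\<^sub>v"
  by (induction I rule: infinite_finite_induct)
    (auto simp: one_notin_M not_M_mult closed_ring_prod[OF closed_ring_O])

lemma M_prod: "finite I \<Longrightarrow> i \<in> I \<Longrightarrow> f i \<in> M\<^sub>v \<Longrightarrow> (\<And>i. i \<in> I \<Longrightarrow> f i \<in> O\<^sub>v) \<Longrightarrow> prod f I \<in> M\<^sub>v"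
  by (subst prod.remove[of I i]) (auto intro!: M_mult closed_ring_prod[OF closed_ring_O])

lemma add_M_unit: "x \<in> O\<^sub>v \<Longrightarrow> x \<notin> M\<^sub>v \<Longrightarrow> y \<in> M\<^sub>v \<Longrightarrow> x + y \<notin> M\<^sub>v"
  using M_diff[of "x + y" y] by auto

lemma inverse_unit: "x \<in> O\<^sub>v \<Longrightarrow> x \<notin> M\<^sub>v \<Longrightarrow> inverse x \<in> O\<^sub>v \<and> inverse x \<notin> M\<^sub>v"
  by (auto simp: O\<^sub>v_def M\<^sub>v_def v_inverse)

lemma inverse_not_O: "x \<notin> O\<^sub>v \<Longrightarrow> inverse x \<in> M\<^sub>v"
  by (auto simp: O\<^sub>v_def M\<^sub>v_def v_inverse)

lemma divide_O: "y \<noteq> 0 \<Longrightarrow> x \<noteq> 0 \<Longrightarrow> x / y \<in> O\<^sub>v \<longleftrightarrow> v y \<le> v x"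
  and divide_M: "y \<noteq> 0 \<Longrightarrow> x \<noteq> 0 \<Longrightarrow> x / y \<in> M\<^sub>v \<longleftrightarrow> v y < v x"
  by (auto simp: O\<^sub>v_def M\<^sub>v_def v_divide)

lemma polys_M_mult: "p \<in> polys M\<^sub>v \<Longrightarrow> q \<in> polys O\<^sub>v \<Longrightarrow> p * q \<in> polys M\<^sub>v"
  by (auto simp: polys_def coeff_mult intro!: M_sum M_mult)

lemma polys_M_add: "p \<in> polys M\<^sub>v \<Longrightarrow> q \<in> polys M\<^sub>v \<Longrightarrow> p + q \<in> polys M\<^sub>v"
  by (auto simp: polys_def intro!: M_add)

lemma prod_cong_mod_M:
  assumes "\<And>i. i \<in> I \<Longrightarrow> p i \<in> polys O\<^sub>v" "\<And>i. i \<in> I \<Longrightarrow> q i \<in> polys O\<^sub>v"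
    "\<And>i. i \<in> I \<Longrightarrow> p i - q i \<in> polys M\<^sub>v"
  shows "(\<Prod>i\<in>I. p i) - (\<Prod>i\<in>I. q i) \<in> polys M\<^sub>v"
  using assms
proof (induction I rule: infinite_finite_induct)
  case (insert i I)
  have "(p i - q i) * (\<Prod>i\<in>I. p i) + ((\<Prod>i\<in>I. p i) - (\<Prod>i\<in>I. q i)) * q i \<in> polys M\<^sub>v"
    using insert by (intro polys_M_add polys_M_mult closed_ring_prod[OF closed_ring_polys[OF closed_ring_O]]) auto
  then show ?case using insert(1,2) by (simp add: algebra_simps)
qed (auto simp: polys_def zero_M)

lemma poly_M: "p \<in> polys M\<^sub>v \<Longrightarrow> x \<in> O\<^sub>v \<Longrightarrow> poly p x \<in> M\<^sub>v"
  by (auto simp: poly_altdef intro!: M_sum M_mult closed_ring_power[OF closed_ring_O] dest: polysD)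

text \<open>In an algebraic relation for y over F the minimal value must be attained by two terms;
  comparing them gives the value of a power of y. Powers replace multiples of values here.\<close>

lemma power_value_in_base:
  assumes F: "alg_base F" and y: "y \<noteq> 0"
  shows "\<exists>m>0. \<exists>c\<in>F. c \<noteq> 0 \<and> v (y ^ m) = v c"
proof -
  obtain p where p: "p \<in> polys F" "p \<noteq> 0" "poly p y = 0" using F by (auto simp: alg_base_def)
  define T where "T = {k. k \<le> degree p \<and> coeff p k \<noteq> 0}"
  define t where "t k = coeff p k * y ^ k" for k
  have T: "finite T" "degree p \<in> T" using p by (auto simp: T_def)
  have "Min ((v \<circ> t) ` T) \<in> (v \<circ> t) ` T" using T by (intro Min_in) auto
  then obtain k where k: "k \<in> T" "v (t k) = Min ((v \<circ> t) ` T)" by auto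
  have min: "v (t k) \<le> v (t j)" if "j \<in> T" for j using that T k by auto
  have nz: "t j \<noteq> 0" if "j \<in> T" for j using that y by (auto simp: T_def t_def)
  have sum0: "(\<Sum>j\<in>T. t j) = 0"
  proof -
    have "(\<Sum>j\<in>T. t j) = (\<Sum>j\<le>degree p. t j)"
      by (intro sum.mono_neutral_left) (auto simp: T_def t_def)
    then show ?thesis using p(3) by (simp add: poly_altdef t_def)
  qed
  have "\<exists>j\<in>T - {k}. v (t j) = v (t k)"
  proof (rule ccontr)
    assume "\<not> ?thesis"
    then have "v (t k) < v (t j)" if "j \<in> T - {k}" for j
      using min[of j] that by (auto simp: less_le)
    then have "sum t (T - {k}) = 0 \<or> v (t k) < v (sum t (T - {k}))" by (intro v_sum_gt) auto
    moreover have "sum t (T - {k}) = - t k" using sum0 T(1) k(1) by (simp add: sum_diff1)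
    ultimately show False using nz[OF k(1)] by (auto simp: v_uminus)
  qed
  then obtain j where j: "j \<in> T" "j \<noteq> k" "v (t j) = v (t k)" by auto
  have key: "\<exists>m>0. \<exists>c\<in>F. c \<noteq> 0 \<and> v (y ^ m) = v c" if "i < l" "i \<in> T" "l \<in> T" "v (t i) = v (t l)" for i l
  proof -
    have "v (t l) = v (coeff p l) + v (y ^ (l - i)) + v (y ^ i)"
      using that y v_mult[of "y ^ (l - i)" "y ^ i"]
      by (auto simp: t_def T_def v_mult simp flip: power_add)
    moreover have "v (t i) = v (coeff p i) + v (y ^ i)"
      using that y by (auto simp: t_def T_def v_mult)
    ultimately have "v (y ^ (l - i)) = v (coeff p i / coeff p l)"
      using that by (auto simp: T_def v_divide algebra_simps)
    moreover have "coeff p i / coeff p l \<in> F" using p F by (intro closed_field_divide alg_base_field polysD)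
    ultimately show ?thesis using that
      by (intro exI[of _ "l - i"] conjI bexI[of _ "coeff p i / coeff p l"]) (auto simp: T_def)
  qed
  show ?thesis using key[of j k] key[of k j] j k by (cases "j < k") auto
qed

end

lemma linear_factor_in_polys: "closed_ring A \<Longrightarrow> a \<in> A \<Longrightarrow> [:- a, 1:] \<in> polys A"
  by (auto simp: pCons_in_polys closed_ring_uminus closed_ring_one closed_ring_zero[OF closed_ring_polys])

lemma dvd_root: "p dvd q \<Longrightarrow> poly p x = 0 \<Longrightarrow> poly q x = 0"
  by (auto elim!: dvdE)

lemma smult_prod_const: "(\<Prod>i<n. smult c (f i)) = smult (c ^ n) (\<Prod>i<(n::nat). f i)"
  by (induction n) (auto simp: mult.commute)

section \<open>Hensel roots and uniqueness of extension\<close>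

locale valued_alg_closed = valued_field v
  for v :: "'k::alg_closed_field \<Rightarrow> 'g::linordered_ab_group_add"
begin

text \<open>In the definition of a Hensel root the indices \<open>i \<ge> n\<close> of the family of conjugates are junk.\<close>

definition hensel_root :: "'k set \<Rightarrow> 'k \<Rightarrow> bool"
  where "hensel_root F a \<longleftrightarrow> (\<exists>n \<alpha>. 0 < n \<and> \<alpha> 0 = a \<and> a \<in> O\<^sub>v \<and> a \<notin> M\<^sub>v \<and>
    (\<forall>i. 0 < i \<longrightarrow> i < n \<longrightarrow> \<alpha> i \<in> M\<^sub>v) \<and> root_poly n \<alpha> \<in> polys F)"

definition hensel_closed :: "'k set \<Rightarrow> bool"
  where "hensel_closed F \<longleftrightarrow> (\<forall>a. hensel_root F a \<longrightarrow> a \<in> F)"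

definition uniquely_extending :: "'k set \<Rightarrow> bool"
  where "uniquely_extending F \<longleftrightarrow> (\<forall>w :: 'k \<Rightarrow> 'g. valuation w \<longrightarrow>
    (\<forall>x\<in>F. x \<noteq> 0 \<longrightarrow> w x = v x) \<longrightarrow> (\<forall>x. x \<noteq> 0 \<longrightarrow> w x = v x))"

text \<open>Equality of value groups and of residue fields in one condition: every element of \<open>F'\<close> has
  the leading term of an element of \<open>F\<close>.\<close>

definition immediate :: "'k set \<Rightarrow> 'k set \<Rightarrow> bool"
  where "immediate F F' \<longleftrightarrow> (\<forall>x\<in>F'. x \<noteq> 0 \<longrightarrow> (\<exists>c\<in>F. c \<noteq> 0 \<and> x / c - 1 \<in> M\<^sub>v))"

lemma hensel_root_mono: "hensel_root F a \<Longrightarrow> F \<subseteq> F' \<Longrightarrow> hensel_root F' a"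
  unfolding hensel_root_def using polys_mono by blast

lemma hensel_root_family:
  assumes fin: "finite I" and i0: "i0 \<in> I" "y i0 \<in> O\<^sub>v" "y i0 \<notin> M\<^sub>v"
    and others: "\<And>i. i \<in> I \<Longrightarrow> i \<noteq> i0 \<Longrightarrow> y i \<in> M\<^sub>v"
    and F: "(\<Prod>i\<in>I. [:- y i, 1:]) \<in> polys F"
  shows "hensel_root F (y i0)"
proof -
  obtain h where h: "bij_betw h {0..<card (I - {i0})} (I - {i0})"
    using ex_bij_betw_nat_finite[of "I - {i0}"] fin by auto
  define m where "m = card (I - {i0})"
  define \<alpha> where "\<alpha> i = (case i of 0 \<Rightarrow> y i0 | Suc j \<Rightarrow> y (h j))" for i
  have "(\<Prod>i\<in>I. [:- y i, 1:]) = [:- y i0, 1:] * (\<Prod>i\<in>I - {i0}. [:- y i, 1:])"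
    using fin i0 by (simp add: prod.remove)
  also have "(\<Prod>i\<in>I - {i0}. [:- y i, 1:]) = (\<Prod>j<m. [:- y (h j), 1:])"
    using prod.reindex_bij_betw[OF h, of "\<lambda>i. [:- y i, 1:]"] by (simp add: m_def atLeast0LessThan)
  finally have "root_poly (Suc m) \<alpha> = (\<Prod>i\<in>I. [:- y i, 1:])"
    unfolding root_poly_Suc_shift by (simp add: \<alpha>_def root_poly_def)
  moreover have "\<alpha> i \<in> M\<^sub>v" if "0 < i" "i < Suc m" for i
  proof -
    obtain j where j: "i = Suc j" using \<open>0 < i\<close> by (cases i) auto
    then have "h j \<in> I - {i0}" using h that by (auto simp: bij_betw_def m_def)
    then show ?thesis using others j by (auto simp: \<alpha>_def)
  qed
  ultimately show ?thesis unfolding hensel_root_def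
    using i0 F by (intro exI[of _ "Suc m"] exI[of _ \<alpha>]) (auto simp: \<alpha>_def)
qed

text \<open>The minimal polynomial of a divides the given one. After the factor X - a is cancelled
  on both sides, its remaining roots are found among the old ones, which lie in
  \<open>M\<^sub>v\<close>.\<close>

lemma hensel_root_minpoly:
  assumes F: "alg_base F" and a: "hensel_root F a"
  shows "\<exists>n \<alpha>. minpoly F a (root_poly n \<alpha>) \<and> 0 < n \<and> \<alpha> 0 = a \<and> (\<forall>i. 0 < i \<longrightarrow> i < n \<longrightarrow> \<alpha> i \<in> M\<^sub>v)"
proof -
  obtain n \<alpha> where \<alpha>: "0 < n" "\<alpha> 0 = a" "\<And>i. 0 < i \<Longrightarrow> i < n \<Longrightarrow> \<alpha> i \<in> M\<^sub>v" "root_poly n \<alpha> \<in> polys F"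
    using a by (auto simp: hensel_root_def)
  obtain m where n: "n = Suc m" using \<alpha>(1) by (cases n) auto
  obtain h where h: "minpoly F a h" using minpoly_exists[OF F] by blast
  then have "[:- a, 1:] dvd h" by (auto simp: minpoly_def poly_eq_0_iff_dvd)
  then obtain q where q: "h = [:- a, 1:] * q" by blast
  have "poly (root_poly n \<alpha>) a = 0" using \<alpha> by (auto simp: poly_root_poly_eq_0_iff)
  then have "h dvd root_poly n \<alpha>" using h \<alpha> by (auto simp: minpoly_def)
  then have "[:- a, 1:] * q dvd [:- a, 1:] * root_poly m (\<lambda>i. \<alpha> (Suc i))"
    using \<alpha>(2) by (simp add: n root_poly_Suc_shift q)
  then have qd: "q dvd root_poly m (\<lambda>i. \<alpha> (Suc i))"
    by (subst (asm) dvd_mult_cancel_left) simp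
  have "lead_coeff h = 1" using h by (simp add: minpoly_def)
  then have "lead_coeff q = 1" unfolding q lead_coeff_mult by simp
  then obtain \<beta> where \<beta>: "q = root_poly (degree q) \<beta>" using monic_eq_root_poly by blast
  have \<beta>M: "\<beta> i \<in> M\<^sub>v" if "i < degree q" for i
  proof -
    have "poly q (\<beta> i) = 0" using that by (subst \<beta>) (auto simp: poly_root_poly_eq_0_iff)
    then have "poly (root_poly m (\<lambda>i. \<alpha> (Suc i))) (\<beta> i) = 0" using qd by (rule dvd_root[rotated])
    then show ?thesis using \<alpha>(3) by (auto simp: poly_root_poly_eq_0_iff n)
  qed
  let ?\<alpha> = "\<lambda>i. case i of 0 \<Rightarrow> a | Suc j \<Rightarrow> \<beta> j"
  have "root_poly (Suc (degree q)) ?\<alpha> = h"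
    unfolding root_poly_Suc_shift using \<beta> by (simp add: q)
  then show ?thesis using h \<beta>M
    by (intro exI[of _ "Suc (degree q)"] exI[of _ ?\<alpha>]) (auto split: nat.splits)
qed

text \<open>If a were not rational, an embedding s over F could move it to a conjugate in
  \<open>M\<^sub>v\<close>. Then v and v composed with s both extend the valuation of F, but they
  disagree at the unit a.\<close>

lemma uniquely_extending_imp_hensel_closed:
  assumes F: "alg_base F" and uniq: "uniquely_extending F"
  shows "hensel_closed F"
  unfolding hensel_closed_def
proof (intro allI impI)
  fix a assume a: "hensel_root F a"
  obtain n \<alpha> where \<alpha>: "minpoly F a (root_poly n \<alpha>)" "0 < n" "\<alpha> 0 = a" "\<And>i. 0 < i \<Longrightarrow> i < n \<Longrightarrow> \<alpha> i \<in> M\<^sub>v"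
    using hensel_root_minpoly[OF F a] by blast
  have unit: "a \<noteq> 0" "v a = 0" using a unit_iff[of a] by (auto simp: hensel_root_def)
  have "n = 1"
  proof (rule ccontr)
    assume "n \<noteq> 1"
    then have "1 < n" using \<alpha>(2) by simp
    then have "poly (root_poly n \<alpha>) (\<alpha> 1) = 0" by (auto simp: poly_root_poly_eq_0_iff)
    from hom_extension[OF F \<alpha>(1) this] obtain s where
      s: "\<And>x y. s (x + y) = s x + s y" "\<And>x y. s (x * y) = s x * s y" "s 1 = 1" "\<And>x. x \<in> F \<Longrightarrow> s x = x" "s a = \<alpha> 1"
      by blast
    have s0: "s x \<noteq> 0" if "x \<noteq> 0" for x
      using s(2)[of x "inverse x"] s(3) that by auto
    have "valuation (v \<circ> s)"
      unfolding valuation_def using s s0 v_mult v_add by (metis comp_apply)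
    moreover have "\<forall>x\<in>F. x \<noteq> 0 \<longrightarrow> (v \<circ> s) x = v x" using s by simp
    ultimately have "(v \<circ> s) a = v a" using uniq unit unfolding uniquely_extending_def by blast
    then have "v (\<alpha> 1) = 0" using unit s by simp
    moreover have "\<alpha> 1 \<in> M\<^sub>v" using \<alpha>(4) \<open>1 < n\<close> by simp
    moreover have "\<alpha> 1 \<noteq> 0" using s0[OF unit(1)] s by simp
    ultimately show False by (simp add: M\<^sub>v_def)
  qed
  then have "root_poly n \<alpha> = [:- a, 1:]" using \<alpha>(3) by (simp add: root_poly_def)
  then have "[:- a, 1:] \<in> polys F" using \<alpha>(1) by (simp add: minpoly_def)
  then have "- a \<in> F" using polysD[of "[:- a, 1:]" F 0] by simp
  then show "a \<in> F" using closed_ring_uminus[OF alg_base_ring[OF F], of "- a"] by simp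
qed

text \<open>The product of the unit roots is the only unit among the products over subsets of the same
  cardinality, so it is a Hensel root; multiplying by the coefficients of the partial products
  recovers these.\<close>

lemma unit_factor_rational:
  assumes F: "closed_field F" and hc: "hensel_closed F"
    and \<beta>: "root_poly n \<beta> \<in> polys F" "\<And>i. i < n \<Longrightarrow> \<beta> i \<in> O\<^sub>v"
    and A: "A = {i. i < n \<and> \<beta> i \<notin> M\<^sub>v}"
  shows "(\<Prod>i\<in>A. [:- \<beta> i, 1:]) \<in> polys F"
proof (rule polysI)
  fix k
  note R = closed_field_ring[OF F]
  have A': "A \<subseteq> {..<n}" "finite A" using A by auto
  define I where "I = {S. S \<subseteq> {..<n} \<and> card S = card A}"
  have I: "finite I" "A \<in> I" using A' by (auto simp: I_def)
  define c where "c S x = coeff (\<Prod>i\<in>S. [:- x i, 1:]) k" for S :: "nat set" and x :: "nat \<Rightarrow> 'k"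
  define \<theta> where "\<theta> S x = (\<Prod>i\<in>S. x i)" for S :: "nat set" and x :: "nat \<Rightarrow> 'k"
  have cO: "c S \<beta> \<in> O\<^sub>v" if "S \<in> I" for S
  proof -
    have "(\<Prod>i\<in>S. [:- \<beta> i, 1:]) \<in> polys O\<^sub>v"
      using that \<beta>(2) closed_ring_O
      by (intro closed_ring_prod[OF closed_ring_polys[OF closed_ring_O]] linear_factor_in_polys) (auto simp: I_def)
    then show ?thesis by (auto simp: c_def dest: polysD)
  qed
  \<comment> \<open>A coefficient may fail to be a unit, hence the shift by e. The choice (e, d) =
    (1, 0) gives the product of the unit roots; a coefficient in \<open>M\<^sub>v\<close> is reached
    with (1, 1) and a unit coefficient with (0, 1).\<close>
  have key: "\<theta> A \<beta> * (e + d * c A \<beta>) \<in> F"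
    if e: "e \<in> F" "d \<in> F" "e \<in> O\<^sub>v" "d \<in> O\<^sub>v" and u: "e + d * c A \<beta> \<notin> M\<^sub>v" for e d
  proof -
    define y where "y S x = \<theta> S x * (e + d * c S x)" for S x
    have "hensel_root F (y A \<beta>)"
    proof (rule hensel_root_family[OF I])
      have uO: "e + d * c S \<beta> \<in> O\<^sub>v" if "S \<in> I" for S
        using e cO[OF that] closed_ring_O by (intro closed_ring_intros)
      have \<theta>O: "\<theta> A \<beta> \<in> O\<^sub>v" unfolding \<theta>_def using A \<beta>(2) by (intro closed_ring_prod[OF closed_ring_O]) auto
      show "y A \<beta> \<in> O\<^sub>v" using \<theta>O uO[OF I(2)] closed_ring_O by (auto simp: y_def intro: closed_ring_mult)
      have "\<theta> A \<beta> \<notin> M\<^sub>v" unfolding \<theta>_def using A \<beta>(2) by (intro not_M_prod) auto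
      then show "y A \<beta> \<notin> M\<^sub>v" unfolding y_def using \<theta>O uO[OF I(2)] u by (intro not_M_mult)
      show "y S \<beta> \<in> M\<^sub>v" if S: "S \<in> I" "S \<noteq> A" for S
      proof -
        have "finite S" "card S = card A" using S by (auto simp: I_def intro: finite_subset)
        then have "\<not> S \<subseteq> A" using S(2) A'(2) card_subset_eq by blast
        then obtain i where i: "i \<in> S" "i \<notin> A" by auto
        then have "\<beta> i \<in> M\<^sub>v" using S A by (auto simp: I_def)
        then have "\<theta> S \<beta> \<in> M\<^sub>v" unfolding \<theta>_def using i S \<beta>(2) \<open>finite S\<close>
          by (intro M_prod[of S i]) (auto simp: I_def)
        then show ?thesis unfolding y_def using uO S by (intro M_mult) auto
      qed
      show "(\<Prod>S\<in>I. [:- y S \<beta>, 1:]) \<in> polys F"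
      proof (rule symmetric_family[OF R \<beta>(1)])
        fix S assume S: "S \<in> I"
        have "(\<lambda>x. \<Prod>i\<in>S. [:- x i, 1:]) \<in> polyfun_poly_valued F n"
          using S by (intro ppv_prod[OF R] ppv_linear_factor[OF R] polyfun.var) (auto simp: I_def)
        then have cp: "c S \<in> polyfun F n" by (auto simp: c_def[abs_def] polyfun_poly_valued_def)
        have \<theta>p: "\<theta> S \<in> polyfun F n"
          unfolding \<theta>_def[abs_def] using S by (intro polyfun_prod[OF R] polyfun.var) (auto simp: I_def)
        show "y S \<in> polyfun F n"
          unfolding y_def[abs_def] using cp \<theta>p e by (intro polyfun.mult polyfun.add polyfun.const)
      next
        fix \<sigma> :: "nat \<Rightarrow> nat" assume \<sigma>: "\<sigma> permutes {..<n}"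
        have inj: "inj_on \<sigma> S" for S using \<sigma> by (auto intro: inj_on_subset dest: permutes_inj)
        have "bij_betw (image \<sigma>) I I"
        proof (rule bij_betwI[where g = "image (inv_into UNIV \<sigma>)"])
          have "\<tau> ` S \<in> I" if "S \<in> I" "\<tau> permutes {..<n}" for S and \<tau> :: "nat \<Rightarrow> nat"
            using that permutes_image[OF that(2)] card_image[of \<tau> S] permutes_inj[OF that(2)]
            by (auto simp: I_def intro: inj_on_subset)
          then show "image \<sigma> \<in> I \<rightarrow> I" "image (inv_into UNIV \<sigma>) \<in> I \<rightarrow> I"
            using \<sigma> permutes_inv[OF \<sigma>] by auto
        qed (use \<sigma> in \<open>auto simp: image_image permutes_inverses\<close>)
        moreover have "y S (x \<circ> \<sigma>) = y (\<sigma> ` S) x" for S x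
          by (simp add: y_def \<theta>_def c_def prod.reindex[OF inj] comp_def)
        ultimately show "\<exists>\<pi>. bij_betw \<pi> I I \<and> (\<forall>S\<in>I. \<forall>x. y S (x \<circ> \<sigma>) = y (\<pi> S) x)" by blast
      qed
    qed
    then show ?thesis using hc by (simp add: hensel_closed_def y_def)
  qed
  have 01: "0 \<in> F" "1 \<in> F" "0 \<in> O\<^sub>v" "1 \<in> O\<^sub>v" using R closed_ring_O by (auto intro: closed_ring_intros)
  have \<theta>F: "\<theta> A \<beta> \<in> F" using key[of 1 0] 01 one_notin_M by simp
  have \<theta>0: "\<theta> A \<beta> \<noteq> 0"
  proof -
    have "\<theta> A \<beta> \<notin> M\<^sub>v" unfolding \<theta>_def using A \<beta>(2) by (intro not_M_prod) auto
    then show ?thesis using zero_M by auto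
  qed
  have div: "z \<in> F" if "\<theta> A \<beta> * z \<in> F" for z
    using closed_field_divide[OF F that \<theta>F] \<theta>0 by simp
  have "c A \<beta> \<in> F"
  proof (cases "c A \<beta> \<in> M\<^sub>v")
    case True
    then have "1 + 1 * c A \<beta> \<notin> M\<^sub>v" using add_M_unit 01 one_notin_M by simp
    from div[OF key[of 1 1, OF _ _ _ _ this]] have "1 + 1 * c A \<beta> \<in> F" using 01 by blast
    then have "1 + 1 * c A \<beta> - 1 \<in> F" using 01 by (intro closed_ring_diff[OF R])
    then show ?thesis by simp
  next
    case False
    then show ?thesis using div[OF key[of 0 1]] 01 by simp
  qed
  then show "coeff (\<Prod>i\<in>A. [:- \<beta> i, 1:]) k \<in> F" by (simp add: c_def)
qed

lemma polys_pcompose: "closed_ring F \<Longrightarrow> q \<in> polys F \<Longrightarrow> p \<in> polys F \<Longrightarrow> pcompose p q \<in> polys F"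
  by (induction p)
    (auto simp: pcompose_pCons pCons_in_polys intro!: closed_ring_add[OF closed_ring_polys]
      closed_ring_mult[OF closed_ring_polys] const_in_polys closed_ring_zero[OF closed_ring_polys])

text \<open>Let \<alpha>_j have the least value among the conjugates and let c in F have the value
  of \<alpha>_j^m. The elements \<beta>_i = \<alpha>_i^m / c are integral, and the factor of their
  polynomial belonging to the units among them is rational. As it vanishes at \<beta>_j, conjugation
  makes it vanish at every \<beta>_i, so all of these are units.\<close>

lemma conjugates_equal_value:
  assumes F: "alg_base F" and hc: "hensel_closed F" and x: "x \<noteq> 0"
    and \<alpha>: "minpoly F x (root_poly n \<alpha>)" and i: "i < n"
  shows "\<alpha> i \<noteq> 0 \<and> v (\<alpha> i) = v x"
proof -
  note R = alg_base_ring[OF F]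
  have root: "poly (root_poly n \<alpha>) (\<alpha> i) = 0" if "i < n" for i
    using that by (auto simp: poly_root_poly_eq_0_iff)
  have other: "poly p y = 0" if "p \<in> polys F" "j < n" "poly p (\<alpha> j) = 0" "poly (root_poly n \<alpha>) y = 0" for p j y
    using minpoly_other_root[OF F \<alpha> root[OF that(2)]] that by (auto simp: minpoly_def intro: dvd_root)
  have xroot: "poly (root_poly n \<alpha>) x = 0" using \<alpha> by (simp add: minpoly_def)
  have nz: "\<alpha> j \<noteq> 0" if j: "j < n" for j
  proof
    assume "\<alpha> j = 0"
    then have "poly [:0, 1:] x = 0" using other[OF X_in_polys[OF R] j _ xroot] by simp
    then show False using x by simp
  qed
  obtain ix where ix: "ix < n" "x = \<alpha> ix" using xroot by (auto simp: poly_root_poly_eq_0_iff)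
  have "Min ((v \<circ> \<alpha>) ` {..<n}) \<in> (v \<circ> \<alpha>) ` {..<n}" using ix by (intro Min_in) auto
  then obtain j where j: "j < n" "v (\<alpha> j) = Min ((v \<circ> \<alpha>) ` {..<n})" by auto
  have min: "v (\<alpha> j) \<le> v (\<alpha> i)" if "i < n" for i using that j by auto
  obtain m c where m: "0 < m" "c \<in> F" "c \<noteq> 0" "v (\<alpha> j ^ m) = v c"
    using power_value_in_base[OF F nz[OF j(1)]] by blast
  define \<beta> where "\<beta> i = inverse c * \<alpha> i ^ m" for i
  have ic: "inverse c \<in> F" using F m by (intro closed_field_inverse alg_base_field)
  have \<beta>_eq: "\<beta> i = (\<alpha> i / \<alpha> j) ^ m * \<beta> j" for i
    using nz[OF j(1)] by (simp add: \<beta>_def power_divide)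
  have \<beta>j: "\<beta> j \<in> O\<^sub>v" "\<beta> j \<notin> M\<^sub>v"
    using unit_iff[of "\<beta> j"] m nz[OF j(1)] by (auto simp: \<beta>_def v_mult v_inverse)
  have ratio: "\<alpha> i / \<alpha> j \<in> O\<^sub>v" if "i < n" for i
    using min[OF that] nz that j by (simp add: divide_O)
  have \<beta>O: "\<beta> i \<in> O\<^sub>v" if "i < n" for i
    unfolding \<beta>_eq[of i] using ratio[OF that] \<beta>j closed_ring_O by (intro closed_ring_intros)
  have \<beta>F: "root_poly n \<beta> \<in> polys F"
    unfolding root_poly_def \<beta>_def
  proof (rule symmetric_family[OF R, of n \<alpha> "{..<n}" "\<lambda>i x. inverse c * x i ^ m"])
    show "root_poly n \<alpha> \<in> polys F" using \<alpha> by (simp add: minpoly_def)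
    show "(\<lambda>x. inverse c * x i ^ m) \<in> polyfun F n" if "i \<in> {..<n}" for i
      using that ic by (intro polyfun.mult polyfun.const polyfun_power[OF R] polyfun.var) auto
    show "\<exists>\<pi>. bij_betw \<pi> {..<n} {..<n} \<and> (\<forall>i\<in>{..<n}. \<forall>x. inverse c * (x \<circ> \<sigma>) i ^ m = inverse c * x (\<pi> i) ^ m)"
      if "\<sigma> permutes {..<n}" for \<sigma> using permutes_imp_bij[OF that] by (intro exI[of _ \<sigma>]) auto
  qed
  define A where "A = {i. i < n \<and> \<beta> i \<notin> M\<^sub>v}"
  define g where "g = (\<Prod>i\<in>A. [:- \<beta> i, 1:])"
  have gF: "g \<in> polys F"
    unfolding g_def by (rule unit_factor_rational[OF alg_base_field[OF F] hc \<beta>F \<beta>O A_def])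
  \<comment> \<open>Conjugation acts on roots of polynomials over F in \<alpha>, so the factor g in
    \<beta> is pulled back along X^m / c.\<close>
  define G where "G = pcompose g (monom (inverse c) m)"
  have GF: "G \<in> polys F" unfolding G_def using gF ic by (intro polys_pcompose[OF R] monom_in_polys[OF R])
  have Geval: "poly G (\<alpha> i) = (\<Prod>k\<in>A. \<beta> i - \<beta> k)" for i
    by (simp add: G_def poly_pcompose poly_monom g_def poly_prod \<beta>_def mult.commute)
  have "j \<in> A" using j(1) \<beta>j by (simp add: A_def)
  have finA: "finite A" by (simp add: A_def)
  have "poly G (\<alpha> j) = 0" unfolding Geval using \<open>j \<in> A\<close> finA by (auto simp: prod_zero_iff)
  then have unit: "\<beta> i \<notin> M\<^sub>v" if "i < n" for i
    using other[OF GF j(1) _ root[OF that]] finA Geval[of i] by (auto simp: prod_zero_iff A_def)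
  have eqv: "v (\<alpha> i) = v (\<alpha> j)" if i: "i < n" for i
  proof -
    have "\<alpha> i / \<alpha> j \<notin> M\<^sub>v"
    proof
      assume "\<alpha> i / \<alpha> j \<in> M\<^sub>v"
      then have "\<beta> i \<in> M\<^sub>v" unfolding \<beta>_eq[of i] using m(1) \<beta>j(1) by (intro M_mult M_power)
      then show False using unit[OF i] by simp
    qed
    then show ?thesis using min[OF i] nz[OF i] nz[OF j(1)] by (simp add: divide_M)
  qed
  show ?thesis using nz[OF i] eqv[OF i] eqv[OF ix(1)] ix(2) by simp
qed

text \<open>Let t_k be the terms of the minimal polynomial evaluated at x. Since all conjugates have
  the value of x, no t_k has smaller v-value than t_0 and t_n, which both have the value of x^n. If
  w(x) differed from v(x), the shift by k(w(x) - v(x)) would give t_0 or t_n, depending on the sign,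
  a strictly smaller w-value than all other terms, although the sum is zero.\<close>

lemma hensel_closed_imp_uniquely_extending:
  assumes F: "alg_base F" and hc: "hensel_closed F"
  shows "uniquely_extending F"
  unfolding uniquely_extending_def
proof (intro allI impI)
  fix w :: "'k \<Rightarrow> 'g" and x :: 'k
  assume w: "valuation w" and eq: "\<forall>x\<in>F. x \<noteq> 0 \<longrightarrow> w x = v x" and x: "x \<noteq> 0"
  interpret w: valued_field w by unfold_locales (rule w)
  obtain h where h: "minpoly F x h" using minpoly_exists[OF F] by blast
  define n where "n = degree h"
  have "n > 0" using minpoly_degree[OF h] by (simp add: n_def)
  obtain \<alpha> where n: "h = root_poly n \<alpha>"
    using monic_eq_root_poly h unfolding minpoly_def n_def by blast
  define t where "t k = coeff h k * x ^ k" for k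
  have \<alpha>v: "\<alpha> i \<noteq> 0" "v (\<alpha> i) = v x" if "i < n" for i
    using conjugates_equal_value[OF F hc x h[unfolded n] that] by auto
  define y where "y i = \<alpha> i / x" for i
  have yO: "y i \<in> O\<^sub>v" "y i \<notin> M\<^sub>v" if "i < n" for i
    using \<alpha>v[OF that] x by (auto simp: y_def divide_O divide_M)
  \<comment> \<open>Substituting x X for X turns the roots into the units y_i, which exposes the
    values of the coefficients.\<close>
  have scaled: "pcompose h [:0, x:] = smult (x ^ n) (root_poly n y)"
  proof -
    have "pcompose [:- \<alpha> i, 1:] [:0, x:] = smult x [:- y i, 1:]" for i
      using x by (simp add: pcompose_pCons y_def)
    then have "pcompose h [:0, x:] = (\<Prod>i<n. smult x [:- y i, 1:])"
      by (simp add: n root_poly_def pcompose_prod)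
    also have "\<dots> = smult (x ^ n) (root_poly n y)"
      unfolding smult_prod_const root_poly_def ..
    finally show ?thesis .
  qed
  have t_eq: "t k = x ^ n * coeff (root_poly n y) k" for k
  proof -
    have "coeff (pcompose h [:0, x:]) k = x ^ k * coeff h k" by (rule coeff_pcompose_linear)
    then show ?thesis unfolding scaled by (simp add: t_def mult.commute)
  qed
  have cO: "coeff (root_poly n y) k \<in> O\<^sub>v" for k
  proof -
    have "root_poly n y \<in> polys O\<^sub>v" unfolding root_poly_def
      using yO closed_ring_O
      by (intro closed_ring_prod[OF closed_ring_polys[OF closed_ring_O]] linear_factor_in_polys) auto
    then show ?thesis by (rule polysD)
  qed
  have c0: "coeff (root_poly n y) 0 \<in> O\<^sub>v - M\<^sub>v"
  proof -
    have "coeff (root_poly n y) 0 = (\<Prod>i<n. - y i)"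
      by (simp add: root_poly_def poly_prod flip: poly_0_coeff_0)
    moreover have "- y i \<in> O\<^sub>v" "- y i \<notin> M\<^sub>v" if "i < n" for i
      using yO[OF that] M_uminus[of "- y i"] closed_ring_uminus[OF closed_ring_O] by auto
    then have "(\<Prod>i<n. - y i) \<notin> M\<^sub>v" by (intro not_M_prod) auto
    ultimately show ?thesis using cO[of 0] by simp
  qed
  have xn: "x ^ k \<noteq> 0" for k using x by simp
  have tv: "v (x ^ n) \<le> v (t k)" if "t k \<noteq> 0" for k
  proof -
    have "coeff (root_poly n y) k \<noteq> 0" using that by (auto simp: t_eq)
    then show ?thesis using cO[of k] xn[of n] by (auto simp: t_eq v_mult O\<^sub>v_def)
  qed
  have t0: "t 0 \<noteq> 0" "v (t 0) = v (x ^ n)" "w (t 0) = v (t 0)"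
  proof -
    show "t 0 \<noteq> 0" "v (t 0) = v (x ^ n)" using c0 xn[of n] unfolding unit_iff by (auto simp: t_eq v_mult)
    then show "w (t 0) = v (t 0)" using eq h by (auto simp: t_def minpoly_def dest: polysD)
  qed
  have tn: "t n = x ^ n"
    using h by (simp add: t_def n_def minpoly_def)
  have sum0: "(\<Sum>k\<le>n. t k) = 0" using h by (simp add: minpoly_def poly_altdef n_def t_def)
  \<comment> \<open>This is k times the difference w(x) - v(x), expressed through powers so that no
    multiples in the value group are needed.\<close>
  define \<delta> where "\<delta> k = w (x ^ k) - v (x ^ k)" for k
  have \<delta>_Suc: "\<delta> (Suc k) = \<delta> 1 + \<delta> k" for k
    using x xn[of k] by (simp add: \<delta>_def v_mult w.v_mult)
  have \<delta>_0: "\<delta> 0 = 0" by (simp add: \<delta>_def v_one w.v_one)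
  have wt: "w (t k) = v (t k) + \<delta> k" if "t k \<noteq> 0" for k
  proof -
    have "coeff h k \<noteq> 0" using that by (auto simp: t_def)
    moreover have "coeff h k \<in> F" using h by (auto simp: minpoly_def dest: polysD)
    ultimately show ?thesis using eq xn[of k] by (simp add: t_def v_mult w.v_mult \<delta>_def)
  qed
  have "\<not> 0 < \<delta> 1"
  proof
    assume pos: "0 < \<delta> 1"
    have \<delta>pos: "0 < \<delta> k" if "0 < k" for k
      using that
    proof (induction k rule: nat_induct_non_zero)
      case 1 show ?case by (rule pos)
    next
      case (Suc k) then show ?case unfolding \<delta>_Suc[of k] using pos by (intro add_pos_pos)
    qed
    have "t k = 0 \<or> w (t 0) < w (t k)" if "k \<in> {1..n}" for k
      using that add_le_less_mono[OF tv[of k] \<delta>pos[of k]] wt[of k] t0 by (cases "t k = 0") auto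
    then have "sum t {1..n} = 0 \<or> w (t 0) < w (sum t {1..n})" by (intro w.v_sum_gt)
    moreover have "sum t {1..n} = - t 0"
    proof -
      have "{..n} = insert 0 {1..n}" by auto
      then have "t 0 + sum t {1..n} = 0" using sum0 by simp
      then show ?thesis by (rule minus_unique[symmetric])
    qed
    ultimately show False using t0(1) by (auto simp: w.v_uminus)
  qed
  moreover have "\<not> \<delta> 1 < 0"
  proof
    assume neg: "\<delta> 1 < 0"
    have step: "\<delta> (Suc k) < \<delta> k" for k
      using add_strict_right_mono[OF neg, of "\<delta> k"] unfolding \<delta>_Suc[of k] by simp
    have dec: "\<delta> l < \<delta> k" if "k < l" for k l
      using that
    proof (induction l)
      case (Suc l)
      then show ?case using step[of l] by (cases "k = l") (auto simp: less_Suc_eq)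
    qed simp
    have "t k = 0 \<or> w (t n) < w (t k)" if "k \<in> {..<n}" for k
      using that add_le_less_mono[OF tv[of k] dec[of k n]] wt[of k] wt[of n] tn xn[of n]
      by (cases "t k = 0") auto
    then have "sum t {..<n} = 0 \<or> w (t n) < w (sum t {..<n})" by (intro w.v_sum_gt)
    moreover have "sum t {..<n} = - t n"
    proof -
      have "{..n} = insert n {..<n}" by auto
      then have "t n + sum t {..<n} = 0" using sum0 by simp
      then show ?thesis by (rule minus_unique[symmetric])
    qed
    ultimately show False using tn xn[of n] by (auto simp: w.v_uminus)
  qed
  ultimately have "\<delta> 1 = 0" by simp
  then show "w x = v x" by (simp add: \<delta>_def)
qed

end

section \<open>Extensions by a Hensel root\<close>

lemma finite_range_coeff: "finite (range (coeff (p :: 'a::zero poly)))"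
proof -
  have "range (coeff p) \<subseteq> insert 0 (coeff p ` {..degree p})"
    using le_degree[of p] by fastforce
  then show ?thesis by (rule finite_subset) auto
qed

definition gen :: "'k::comm_ring_1 set \<Rightarrow> 'k set"
  where "gen A = \<Inter>{U. closed_ring U \<and> A \<subseteq> U}"

lemma closed_ring_gen: "closed_ring (gen A)"
  unfolding closed_ring_def gen_def by (auto intro: closed_ring_intros)

lemma gen_incl: "A \<subseteq> gen A"
  and gen_least: "closed_ring U \<Longrightarrow> A \<subseteq> U \<Longrightarrow> gen A \<subseteq> U"
  by (auto simp: gen_def)

lemma gen_mono: "A \<subseteq> B \<Longrightarrow> gen A \<subseteq> gen B"
  by (auto simp: gen_def)

lemma prod_choice_monom:
  "finite I \<Longrightarrow> (\<Prod>i\<in>I. if P i then 1 else [:0, 1:]) = monom (1 :: 'a::comm_semiring_1) (card {i\<in>I. \<not> P i})"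
proof (induction I rule: finite_induct)
  case (insert x I)
  have "{i \<in> insert x I. \<not> P i} = (if P x then {i\<in>I. \<not> P i} else insert x {i\<in>I. \<not> P i})" by auto
  then show ?case using insert by (auto simp: monom_Suc)
qed simp

context valued_alg_closed
begin

section \<open>Leading terms and approximation by elements of the base field\<close>

lemma unit_ratio_mult: "x - 1 \<in> M\<^sub>v \<Longrightarrow> y - 1 \<in> M\<^sub>v \<Longrightarrow> x * y - 1 \<in> M\<^sub>v"
proof -
  assume x: "x - 1 \<in> M\<^sub>v" and y: "y - 1 \<in> M\<^sub>v"
  then have "x \<in> O\<^sub>v" using M_subset_O closed_ring_add[OF closed_ring_O, of "x - 1" 1] closed_ring_one[OF closed_ring_O] by auto
  have "x * (y - 1) + (x - 1) \<in> M\<^sub>v" using x M_mult2[OF \<open>x \<in> O\<^sub>v\<close> y] by (rule M_add[rotated])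
  then show ?thesis by (simp add: algebra_simps)
qed

lemma one_unit: "x - 1 \<in> M\<^sub>v \<Longrightarrow> x \<in> O\<^sub>v \<and> x \<notin> M\<^sub>v"
proof -
  assume x: "x - 1 \<in> M\<^sub>v"
  then have "x \<in> O\<^sub>v" using M_subset_O closed_ring_add[OF closed_ring_O, of "x - 1" 1] closed_ring_one[OF closed_ring_O] by auto
  moreover have "x \<notin> M\<^sub>v" using M_diff[of x "x - 1"] x one_notin_M by auto
  ultimately show ?thesis ..
qed

lemma unit_ratio_inverse: "x - 1 \<in> M\<^sub>v \<Longrightarrow> inverse x - 1 \<in> M\<^sub>v"
proof -
  assume x: "x - 1 \<in> M\<^sub>v"
  then have "x \<in> O\<^sub>v" "x \<notin> M\<^sub>v" using one_unit by auto
  moreover from this have "x \<noteq> 0" using zero_M by auto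
  ultimately have "- (x - 1) * inverse x \<in> M\<^sub>v" using inverse_unit x by (intro M_mult M_uminus) auto
  then show ?thesis using \<open>x \<noteq> 0\<close> by (simp add: algebra_simps)
qed

lemma unit_ratio_power: "x - 1 \<in> M\<^sub>v \<Longrightarrow> x ^ n - 1 \<in> M\<^sub>v"
  by (induction n) (auto simp: zero_M intro: unit_ratio_mult)

text \<open>A Newton polygon edge of length one. After X is replaced by z X and a constant is split
  off, each factor reduces modulo \<open>M\<^sub>v\<close> to X - 1 for the root z itself, to 1 for
  roots of smaller value and to X for roots of larger value. So the polynomial reduces to X^s (X -
  1), and z has the leading term of minus the quotient of the coefficients at s and s + 1.\<close>

lemma isolated_value_approximable:
  assumes F: "closed_field F" and y: "root_poly n y \<in> polys F" "0 < n" "y 0 \<noteq> 0"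
    and iso: "\<And>i. 0 < i \<Longrightarrow> i < n \<Longrightarrow> y i = 0 \<or> v (y i) \<noteq> v (y 0)"
  shows "\<exists>c\<in>F. c \<noteq> 0 \<and> y 0 / c - 1 \<in> M\<^sub>v"
proof -
  define z where "z = y 0"
  define R where "R i \<longleftrightarrow> y i \<noteq> 0 \<and> v (y i) < v z" for i
  define E where "E i = (if i = 0 then [:-1, 1:] else if R i then [:1, - (z / y i):] else [:- (y i / z), 1:])" for i
  define E' where "E' i = (if i = 0 then [:-1, 1:] else if R i then 1 else [:0, 1:] :: 'k poly)" for i :: nat
  define C where "C i = (if i \<noteq> 0 \<and> R i then - y i else z)" for i
  have z: "z \<noteq> 0" using y by (simp add: z_def)
  have C0: "prod C {..<n} \<noteq> 0" using z by (auto simp: C_def R_def)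
  have small: "z / y i \<in> M\<^sub>v" if "R i" for i using that z by (auto simp: R_def divide_M)
  have large: "y i / z \<in> M\<^sub>v" if "\<not> R i" "0 < i" "i < n" for i
    using iso[OF that(2,3)] that(1) z zero_M by (cases "y i = 0") (auto simp: R_def divide_M z_def)
  have fac: "pcompose [:- y i, 1:] [:0, z:] = smult (C i) (E i)" for i
    using z by (auto simp: C_def E_def z_def R_def pcompose_pCons)
  have "pcompose (root_poly n y) [:0, z:] = smult (prod C {..<n}) (prod E {..<n})"
    unfolding root_poly_def pcompose_prod fac by (rule prod_smult)
  then have coeffs: "z ^ k * coeff (root_poly n y) k = prod C {..<n} * coeff (prod E {..<n}) k" for k
    by (metis coeff_pcompose_linear coeff_smult)
  have one_O: "1 \<in> O\<^sub>v" "0 \<in> O\<^sub>v" "-1 \<in> O\<^sub>v" using closed_ring_O by (auto intro: closed_ring_intros)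
  have MO: "x \<in> M\<^sub>v \<Longrightarrow> - x \<in> O\<^sub>v" for x using M_uminus M_subset_O by auto
  have "prod E {..<n} - prod E' {..<n} \<in> polys M\<^sub>v"
  proof (rule prod_cong_mod_M)
    fix i assume i: "i \<in> {..<n}"
    have 0: "0 \<in> polys O\<^sub>v" by (rule closed_ring_zero[OF closed_ring_polys[OF closed_ring_O]])
    show "E i \<in> polys O\<^sub>v" using small[of i] large[of i] i one_O MO 0
      by (auto simp: E_def pCons_in_polys[OF closed_ring_O])
    show "E' i \<in> polys O\<^sub>v" using one_O 0 closed_ring_one[OF closed_ring_polys[OF closed_ring_O]]
      by (auto simp: E'_def pCons_in_polys[OF closed_ring_O])
    have "E i - E' i = (if i = 0 then 0 else if R i then [:0, - (z / y i):] else [:- (y i / z):])"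
      by (simp add: E_def E'_def one_pCons)
    then show "E i - E' i \<in> polys M\<^sub>v" using small[of i] large[of i] i zero_M M_uminus
      by (auto simp: polys_def coeff_pCons split: nat.splits)
  qed
  then have close: "coeff (prod E {..<n}) k - coeff (prod E' {..<n}) k \<in> M\<^sub>v" for k
    by (auto simp: polys_def)
  obtain s where s: "prod E' {..<n} = [:-1, 1:] * monom 1 s"
  proof -
    have "prod E' {..<n} = E' 0 * prod E' {1..<n}"
    proof -
      have "{..<n} = insert 0 {1..<n}" using y(2) by auto
      then show ?thesis by simp
    qed
    also have "prod E' {1..<n} = (\<Prod>i\<in>{1..<n}. if R i then 1 else [:0, 1:])"
      by (intro prod.cong) (auto simp: E'_def)
    also have "\<dots> = monom 1 (card {i\<in>{1..<n}. \<not> R i})"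
      by (rule prod_choice_monom) simp
    also have "E' 0 = [:-1, 1:]" by (simp add: E'_def)
    finally show ?thesis by (rule that)
  qed
  then have E': "coeff (prod E' {..<n}) s = -1" "coeff (prod E' {..<n}) (Suc s) = 1"
    unfolding s by (cases s, auto simp: coeff_pCons)+
  define g where "g = coeff (root_poly n y)"
  define D where "D = coeff (prod E {..<n})"
  have D1: "- D s - 1 \<in> M\<^sub>v" "D (Suc s) - 1 \<in> M\<^sub>v"
    using close[of s] close[of "Suc s"] M_uminus[of "D s + 1"] by (auto simp: E' D_def)
  then have Dnz: "D s \<noteq> 0" "D (Suc s) \<noteq> 0" using one_unit[of "- D s"] one_unit[of "D (Suc s)"] zero_M by auto
  have g: "z ^ s * g s = prod C {..<n} * D s" "z ^ Suc s * g (Suc s) = prod C {..<n} * D (Suc s)"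
    using coeffs by (simp_all only: g_def D_def)
  have gnz: "g s \<noteq> 0" "g (Suc s) \<noteq> 0" using g C0 Dnz by auto
  define c where "c = - g s / g (Suc s)"
  have "g k \<in> F" for k using y(1) by (auto simp: g_def dest: polysD)
  then have "c \<in> F" unfolding c_def
    using F by (intro closed_field_divide closed_ring_uminus[OF closed_field_ring]) auto
  moreover have "c \<noteq> 0" using gnz by (simp add: c_def)
  moreover have "z / c = D (Suc s) * inverse (- D s)"
  proof -
    have gs: "g s = prod C {..<n} * D s / z ^ s" "g (Suc s) = prod C {..<n} * D (Suc s) / z ^ Suc s"
      using g z by (simp_all add: field_simps)
    show ?thesis unfolding c_def gs using z C0 Dnz by (simp add: field_simps)
  qed
  then have "z / c - 1 \<in> M\<^sub>v" using D1 by (simp only: unit_ratio_mult unit_ratio_inverse)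
  ultimately show ?thesis by (auto simp: z_def)
qed

text \<open>Multiplication by a^m, with a a unit, leaves the value of an element alone but shifts
  those of its conjugates by multiples of the positive values v(\<alpha>_i). Each index therefore
  spoils at most one exponent, and a suitable m isolates the element from its conjugates.\<close>

lemma avoid_value:
  fixes n :: nat and \<alpha> u :: "nat \<Rightarrow> 'k"
  assumes "\<And>i. 0 < i \<Longrightarrow> i < n \<Longrightarrow> \<alpha> i \<in> M\<^sub>v"
  shows "\<exists>m. \<forall>i. 0 < i \<longrightarrow> i < n \<longrightarrow> u i * \<alpha> i ^ m = 0 \<or> v (u i * \<alpha> i ^ m) \<noteq> \<gamma>"
proof -
  let ?bad = "\<lambda>i. {m. u i * \<alpha> i ^ m \<noteq> 0 \<and> v (u i * \<alpha> i ^ m) = \<gamma>}"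
  have bad: "finite (?bad i)" if i: "i \<in> {0<..<n}" for i
  proof (cases "\<alpha> i = 0 \<or> u i = 0")
    case True
    then have "?bad i \<subseteq> {0}" by (auto simp: power_0_left split: if_splits)
    then show ?thesis by (rule finite_subset) auto
  next
    case False
    have no: False if "m \<in> ?bad i" "m' \<in> ?bad i" "m < m'" for m m'
    proof -
      have "\<alpha> i ^ (m' - m) \<in> M\<^sub>v" using assms i that by (intro M_power) auto
      then have "0 < v (\<alpha> i ^ (m' - m))" using False by (auto simp: M\<^sub>v_def)
      moreover have "v (u i * \<alpha> i ^ m') = v (u i * \<alpha> i ^ m) + v (\<alpha> i ^ (m' - m))"
        using False v_mult[of "u i * \<alpha> i ^ m" "\<alpha> i ^ (m' - m)"] that(3) by (simp add: mult.assoc flip: power_add)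
      ultimately show False using that by auto
    qed
    have "\<exists>m. ?bad i \<subseteq> {m}"
    proof (cases "?bad i = {}")
      case False
      then obtain m where m: "m \<in> ?bad i" by blast
      then have "m' = m" if "m' \<in> ?bad i" for m'
        using no[OF m that] no[OF that m] by (cases m m' rule: linorder_cases) auto
      then show ?thesis by blast
    qed blast
    then show ?thesis using finite_subset by blast
  qed
  have "finite (\<Union>i\<in>{0<..<n}. ?bad i)"
    using bad by blast
  then obtain m where "m \<notin> (\<Union>i\<in>{0<..<n}. ?bad i)" using ex_new_if_finite[OF infinite_UNIV_nat] by blast
  then show ?thesis by (intro exI[of _ m]) auto
qed

lemma conjugate_values_rational:
  fixes F :: "'k set"
  assumes F: "closed_ring F" and \<alpha>: "root_poly n \<alpha> \<in> polys F" and p: "p \<in> polys F"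
  shows "root_poly n (\<lambda>i. poly p (\<alpha> i)) \<in> polys F"
  unfolding root_poly_def
proof (rule symmetric_family[OF F \<alpha>, of "{..<n}" "\<lambda>i x. poly p (x i)"])
  show "(\<lambda>x. poly p (x i)) \<in> polyfun F n" if "i \<in> {..<n}" for i
    using that p by (intro polyfun_poly[OF F] polyfun.var) auto
  show "\<exists>\<pi>. bij_betw \<pi> {..<n} {..<n} \<and> (\<forall>i\<in>{..<n}. \<forall>x. poly p ((x \<circ> \<sigma>) i) = poly p (x (\<pi> i)))"
    if "\<sigma> permutes {..<n}" for \<sigma> using permutes_imp_bij[OF that] by (intro exI[of _ \<sigma>]) auto
qed

text \<open>For a suitable m the element x a^m differs in value from its nonzero conjugates and so
  has the leading term of some c in F. The same holds for a itself, with some e in F, because the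
  other conjugates of a lie in \<open>M\<^sub>v\<close>. Hence c / e^m approximates x.\<close>

lemma hensel_root_immediate:
  assumes F: "alg_base F" and a: "hensel_root F a"
  shows "immediate F (adj F a)"
  unfolding immediate_def
proof (intro ballI impI)
  fix x assume x: "x \<in> adj F a" "x \<noteq> 0"
  note R = alg_base_ring[OF F]
  obtain n \<alpha> where \<alpha>: "minpoly F a (root_poly n \<alpha>)" "0 < n" "\<alpha> 0 = a" "\<And>i. 0 < i \<Longrightarrow> i < n \<Longrightarrow> \<alpha> i \<in> M\<^sub>v"
    using hensel_root_minpoly[OF F a] by blast
  have a0: "a \<noteq> 0" "v a = 0" using a unit_iff[of a] by (auto simp: hensel_root_def)
  have va: "v (a ^ m) = 0" for m by (induction m) (auto simp: v_one v_mult a0)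
  obtain p where p: "p \<in> polys F" "x = poly p a" using x by (auto simp: adj_def)
  have \<alpha>F: "root_poly n \<alpha> \<in> polys F" using \<alpha>(1) by (simp add: minpoly_def)
  have "\<exists>m. \<forall>i. 0 < i \<longrightarrow> i < n \<longrightarrow> poly p (\<alpha> i) * \<alpha> i ^ m = 0 \<or> v (poly p (\<alpha> i) * \<alpha> i ^ m) \<noteq> v x"
    by (rule avoid_value[OF \<alpha>(4)])
  then obtain m where m: "\<forall>i. 0 < i \<longrightarrow> i < n \<longrightarrow> poly p (\<alpha> i) * \<alpha> i ^ m = 0 \<or> v (poly p (\<alpha> i) * \<alpha> i ^ m) \<noteq> v x" ..
  define y where "y i = poly (p * monom 1 m) (\<alpha> i)" for i
  have "p * monom 1 m \<in> polys F"
    using p R by (intro closed_ring_mult[OF closed_ring_polys] monom_in_polys closed_ring_one)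
  from conjugate_values_rational[OF R \<alpha>F this] have "root_poly n y \<in> polys F"
    unfolding y_def[abs_def] .
  moreover have y0: "y 0 = x * a ^ m" using \<alpha>(3) p by (simp add: y_def poly_monom)
  moreover have vy: "v (y 0) = v x" using x a0 va by (simp add: y0 v_mult)
  moreover have "y 0 \<noteq> 0" using x(2) a0(1) by (simp add: y0)
  moreover have "y i = 0 \<or> v (y i) \<noteq> v (y 0)" if "0 < i" "i < n" for i
    using m[rule_format, OF that] unfolding vy by (simp only: y_def poly_mult poly_monom mult_1)
  ultimately obtain c where c: "c \<in> F" "c \<noteq> 0" "y 0 / c - 1 \<in> M\<^sub>v"
    using isolated_value_approximable[OF alg_base_field[OF F] _ \<alpha>(2)] by blast
  have "\<exists>e\<in>F. e \<noteq> 0 \<and> a / e - 1 \<in> M\<^sub>v"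
  proof -
    have "\<alpha> i = 0 \<or> v (\<alpha> i) \<noteq> v a" if "0 < i" "i < n" for i
      using \<alpha>(4)[OF that] a0 by (auto simp: M\<^sub>v_def)
    then show ?thesis
      using isolated_value_approximable[OF alg_base_field[OF F] \<alpha>F \<alpha>(2)] \<alpha>(3) a0 by simp
  qed
  then obtain e where e: "e \<in> F" "e \<noteq> 0" "a / e - 1 \<in> M\<^sub>v" by blast
  have "c / e ^ m \<in> F" using F c e by (intro closed_field_divide alg_base_field closed_ring_power[OF R])
  moreover have "c / e ^ m \<noteq> 0" using c e by simp
  moreover have "x / (c / e ^ m) = (y 0 / c) * inverse ((a / e) ^ m)"
    using c(2) e(2) a0(1) by (simp add: y0 power_divide)
  then have "x / (c / e ^ m) - 1 \<in> M\<^sub>v"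
    using unit_ratio_mult[OF c(3) unit_ratio_inverse[OF unit_ratio_power[OF e(3)]]] by (simp only:)
  ultimately show "\<exists>c\<in>F. c \<noteq> 0 \<and> x / c - 1 \<in> M\<^sub>v" by blast
qed

text \<open>Lagrange interpolation: the element with integral conjugates becomes integral over the
  coefficients after multiplication by the different, which is a unit here.\<close>

lemma interpolation_integral:
  assumes F: "closed_ring F" and \<alpha>: "root_poly n \<alpha> \<in> polys F" "0 < n"
    and O: "\<And>i. i < n \<Longrightarrow> \<alpha> i \<in> O\<^sub>v" and k: "k \<in> polys F" "\<And>i. i < n \<Longrightarrow> poly k (\<alpha> i) \<in> O\<^sub>v"
  shows "\<exists>G\<in>polys (F \<inter> O\<^sub>v). poly G (\<alpha> 0) = poly k (\<alpha> 0) * (\<Prod>j\<in>{0<..<n}. \<alpha> 0 - \<alpha> j)"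
proof -
  let ?g = "\<lambda>x. \<Sum>i<n. smult (poly k (x i)) (\<Prod>j\<in>{..<n} - {i}. [:- x j, 1:])"
  have "coeff (?g \<alpha>) c \<in> F" for c
  proof (rule symmetric_value[OF F \<alpha>(1), where f = "\<lambda>x. coeff (?g x) c"])
    have "?g \<in> polyfun_poly_valued F n"
      by (intro ppv_sum[OF F] ppv_smult[OF F] polyfun_poly[OF F k(1)] polyfun.var ppv_prod[OF F] ppv_linear_factor[OF F]) auto
    then show "(\<lambda>x. coeff (?g x) c) \<in> polyfun F n" by (simp add: polyfun_poly_valued_def)
    fix \<sigma> :: "nat \<Rightarrow> nat" and x :: "nat \<Rightarrow> 'k" assume \<sigma>: "\<sigma> permutes {..<n}"
    have "(\<Prod>j\<in>{..<n} - {i}. [:- x (\<sigma> j), 1:]) = (\<Prod>j\<in>{..<n} - {\<sigma> i}. [:- x j, 1:])" if "i < n" for i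
    proof -
      have "bij_betw \<sigma> ({..<n} - {i}) ({..<n} - {\<sigma> i})"
        using permutes_imp_bij[OF \<sigma>] that permutes_in_image[OF \<sigma>, of i] by (intro bij_betw_DiffI) auto
      then show ?thesis using prod.reindex_bij_betw[of \<sigma> _ _ "\<lambda>j. [:- x j, 1:]"] by blast
    qed
    then have "?g (x \<circ> \<sigma>) = (\<Sum>i<n. smult (poly k (x (\<sigma> i))) (\<Prod>j\<in>{..<n} - {\<sigma> i}. [:- x j, 1:]))"
      by (intro sum.cong) auto
    also have "\<dots> = ?g x"
      using sum.reindex_bij_betw[OF permutes_imp_bij[OF \<sigma>], of "\<lambda>i. smult (poly k (x i)) (\<Prod>j\<in>{..<n} - {i}. [:- x j, 1:])"] .
    finally show "coeff (?g (x \<circ> \<sigma>)) c = coeff (?g x) c" by (rule arg_cong)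
  qed
  moreover have "?g \<alpha> \<in> polys O\<^sub>v"
    using O k(2) by (intro closed_ring_sum[OF closed_ring_polys[OF closed_ring_O]] smult_in_polys[OF closed_ring_O]
      closed_ring_prod[OF closed_ring_polys[OF closed_ring_O]] linear_factor_in_polys[OF closed_ring_O]) auto
  ultimately have "?g \<alpha> \<in> polys (F \<inter> O\<^sub>v)" by (auto simp: polys_def)
  moreover have "poly (?g \<alpha>) (\<alpha> 0) = poly k (\<alpha> 0) * (\<Prod>j\<in>{0<..<n}. \<alpha> 0 - \<alpha> j)"
  proof -
    have "poly (\<Prod>j\<in>{..<n} - {i}. [:- \<alpha> j, 1:]) (\<alpha> 0) = 0" if "i \<in> {..<n} - {0}" for i
      using that \<alpha>(2) by (auto simp: poly_prod prod_zero_iff)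
    then have "poly (?g \<alpha>) (\<alpha> 0) = (\<Sum>i\<in>{0}. poly k (\<alpha> i) * poly (\<Prod>j\<in>{..<n} - {i}. [:- \<alpha> j, 1:]) (\<alpha> 0))"
      unfolding poly_sum poly_smult using \<alpha>(2) by (intro sum.mono_neutral_right) auto
    moreover have "{..<n} - {0} = {0<..<n}" by auto
    ultimately show ?thesis by (simp add: poly_prod)
  qed
  ultimately show ?thesis by blast
qed

text \<open>For R contained in \<open>O\<^sub>v\<close> this is the localization of R at R \<inter>
  \<open>M\<^sub>v\<close>, formed inside the field; the defining condition avoids division.\<close>

definition frac :: "'k set \<Rightarrow> 'k set"
  where "frac R = {u. \<exists>s\<in>R. s \<notin> M\<^sub>v \<and> s * u \<in> R}"

lemma frac_incl: "closed_ring R \<Longrightarrow> R \<subseteq> frac R"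
  using closed_ring_one one_notin_M by (fastforce simp: frac_def)

lemma frac_mono: "R \<subseteq> R' \<Longrightarrow> frac R \<subseteq> frac R'"
  by (auto simp: frac_def)

lemma frac_integral: assumes "R \<subseteq> O\<^sub>v" shows "frac R \<subseteq> O\<^sub>v"
proof
  fix u assume "u \<in> frac R"
  then obtain s where s: "s \<in> O\<^sub>v" "s \<notin> M\<^sub>v" "s * u \<in> O\<^sub>v" using assms by (auto simp: frac_def)
  then have "s \<noteq> 0" using zero_M by auto
  then have "inverse s * (s * u) = u" by simp
  moreover have "inverse s * (s * u) \<in> O\<^sub>v"
    by (rule closed_ring_mult[OF closed_ring_O conjunct1[OF inverse_unit[OF s(1,2)]] s(3)])
  ultimately show "u \<in> O\<^sub>v" by (simp only:)
qed

lemma closed_ring_frac: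
  assumes R: "closed_ring R" "R \<subseteq> O\<^sub>v" shows "closed_ring (frac R)"
proof -
  have "x - y \<in> frac R \<and> x * y \<in> frac R" if xy: "x \<in> frac R" "y \<in> frac R" for x y
  proof -
    obtain s t where st: "s \<in> R" "s \<notin> M\<^sub>v" "s * x \<in> R" "t \<in> R" "t \<notin> M\<^sub>v" "t * y \<in> R"
      using xy by (auto simp: frac_def)
    have "s \<in> O\<^sub>v" "t \<in> O\<^sub>v" using st R(2) by auto
    then have u: "s * t \<notin> M\<^sub>v" using st by (intro not_M_mult)
    have r: "s * t \<in> R" using st R(1) by (intro closed_ring_mult)
    have e: "(s * t) * (x - y) = t * (s * x) - s * (t * y)" "(s * t) * (x * y) = (s * x) * (t * y)"
      by (simp_all add: algebra_simps)
    have "(s * t) * (x - y) \<in> R" "(s * t) * (x * y) \<in> R"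
      unfolding e using st R(1) by (auto intro!: closed_ring_diff closed_ring_mult)
    then show ?thesis using u r unfolding frac_def by (auto intro!: bexI[of _ "s * t"])
  qed
  moreover have "1 \<in> frac R" using frac_incl[OF R(1)] closed_ring_one[OF R(1)] by blast
  ultimately show ?thesis by (simp add: closed_ring_def)
qed

lemma frac_idem:
  assumes R: "closed_ring R" "R \<subseteq> O\<^sub>v" shows "frac (frac R) \<subseteq> frac R"
proof
  fix u assume "u \<in> frac (frac R)"
  then obtain s where s: "s \<in> frac R" "s \<notin> M\<^sub>v" "s * u \<in> frac R" by (auto simp: frac_def)
  then obtain a b where ab: "a \<in> R" "a \<notin> M\<^sub>v" "a * s \<in> R" "b \<in> R" "b \<notin> M\<^sub>v" "b * (s * u) \<in> R"
    by (auto simp: frac_def)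
  have "b * (a * s) \<in> R" by (rule closed_ring_mult[OF R(1) ab(4,3)])
  moreover have "b * (a * s) \<notin> M\<^sub>v"
  proof -
    have "s \<in> O\<^sub>v" using s frac_integral[OF R(2)] by auto
    then have as: "a * s \<notin> M\<^sub>v" using ab s R(2) not_M_mult by blast
    have "b \<in> O\<^sub>v" "a * s \<in> O\<^sub>v" using ab R(2) by auto
    then show ?thesis using ab(5) as by (rule not_M_mult)
  qed
  moreover have "b * (a * s) * u \<in> R"
    using closed_ring_mult[OF R(1) ab(1,6)] by (simp add: algebra_simps)
  ultimately show "u \<in> frac R" unfolding frac_def by blast
qed

text \<open>The conjugates of an integral x need not be integral, so interpolation does not apply to
  x. For x in \<open>M\<^sub>v\<close> a power of a is used to arrange that no conjugate y_i of y =
  x a^m has value 0. Then 1/(1 + y) and y/(1 + y) have only integral conjugates; times the unit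
  \<delta> both are polynomials in a over F \<inter> \<open>O\<^sub>v\<close>, and their quotient is
  y. Units are reduced to this case by subtracting an approximation from F.\<close>

lemma hensel_root_integers:
  assumes F: "alg_base F" and a: "hensel_root F a"
  shows "adj F a \<inter> O\<^sub>v \<subseteq> frac (adj (F \<inter> O\<^sub>v) a)"
proof -
  note R = alg_base_ring[OF F]
  obtain n \<alpha> where \<alpha>: "minpoly F a (root_poly n \<alpha>)" "0 < n" "\<alpha> 0 = a" "\<And>i. 0 < i \<Longrightarrow> i < n \<Longrightarrow> \<alpha> i \<in> M\<^sub>v"
    using hensel_root_minpoly[OF F a] by blast
  have \<alpha>F: "root_poly n \<alpha> \<in> polys F" using \<alpha>(1) by (simp add: minpoly_def)
  have aU: "a \<in> O\<^sub>v" "a \<notin> M\<^sub>v" using a by (auto simp: hensel_root_def)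
  have \<alpha>O: "\<alpha> i \<in> O\<^sub>v" if "i < n" for i using \<alpha>(3,4) aU that M_subset_O by (cases "i = 0") auto
  have FO: "closed_ring (F \<inter> O\<^sub>v)" using R closed_ring_O by (auto simp: closed_ring_def)
  note A = closed_ring_adj[OF FO, of a]
  have AO: "adj (F \<inter> O\<^sub>v) a \<subseteq> O\<^sub>v" using closed_ring_O aU by (intro adj_least) auto
  define \<delta> where "\<delta> = (\<Prod>j\<in>{0<..<n}. \<alpha> 0 - \<alpha> j)"
  have unit_diff: "a - \<alpha> j \<in> O\<^sub>v" "a - \<alpha> j \<notin> M\<^sub>v" if "j \<in> {0<..<n}" for j
    using \<alpha>(4)[of j] that aU add_M_unit[of a "- \<alpha> j"] M_uminus[of "\<alpha> j"] \<alpha>O[of j] closed_ring_diff[OF closed_ring_O, of a "\<alpha> j"]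
    by auto
  have \<delta>: "\<delta> \<in> O\<^sub>v" "\<delta> \<notin> M\<^sub>v"
    unfolding \<delta>_def \<alpha>(3)
    by (rule closed_ring_prod[OF closed_ring_O unit_diff(1)], assumption)
      (rule not_M_prod[OF unit_diff], assumption)
  have pos: "x \<in> frac (adj (F \<inter> O\<^sub>v) a)" if x: "x \<in> adj F a" "x \<in> M\<^sub>v" for x
  proof -
    obtain p where p: "p \<in> polys F" "x = poly p a" using x by (auto simp: adj_def)
    \<comment> \<open>Value 0 is excluded because a conjugate congruent to -1 would spoil the
      denominator 1 + y_i; in all other cases either 1 or y_i dominates.\<close>
    have "\<exists>m. \<forall>i. 0 < i \<longrightarrow> i < n \<longrightarrow> poly p (\<alpha> i) * \<alpha> i ^ m = 0 \<or> v (poly p (\<alpha> i) * \<alpha> i ^ m) \<noteq> 0"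
      by (rule avoid_value[OF \<alpha>(4)])
    then obtain m where m: "\<forall>i. 0 < i \<longrightarrow> i < n \<longrightarrow> poly p (\<alpha> i) * \<alpha> i ^ m = 0 \<or> v (poly p (\<alpha> i) * \<alpha> i ^ m) \<noteq> 0" ..
    define q where "q = p * monom 1 m"
    have q: "q \<in> polys F" unfolding q_def
      using p R by (intro closed_ring_mult[OF closed_ring_polys] monom_in_polys closed_ring_one)
    define y where "y i = poly q (\<alpha> i)" for i
    have y0: "y 0 = x * a ^ m" using \<alpha>(3) p by (simp add: y_def q_def poly_monom)
    have "y 0 \<in> M\<^sub>v" unfolding y0 using x aU closed_ring_power[OF closed_ring_O] by (intro M_mult)
    then have y: "y i \<in> M\<^sub>v \<or> y i \<notin> O\<^sub>v" if "i < n" for i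
      using m[rule_format, of i] that unit_iff[of "y i"] by (cases "i = 0") (auto simp: y_def q_def poly_monom)
    have good: "1 + y i \<noteq> 0 \<and> inverse (1 + y i) \<in> O\<^sub>v \<and> y i * inverse (1 + y i) \<in> O\<^sub>v" if "i < n" for i
      using y[OF that]
    proof
      assume yM: "y i \<in> M\<^sub>v"
      then have "1 + y i \<in> O\<^sub>v" "1 + y i \<notin> M\<^sub>v" using one_unit[of "1 + y i"] by auto
      moreover have "1 + y i \<noteq> 0" using \<open>1 + y i \<notin> M\<^sub>v\<close> zero_M by auto
      ultimately show ?thesis
        using inverse_unit yM M_subset_O closed_ring_mult[OF closed_ring_O] by blast
    next
      assume yO: "y i \<notin> O\<^sub>v"
      have y0: "y i \<noteq> 0" using yO closed_ring_zero[OF closed_ring_O] by auto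
      have iM: "inverse (y i) \<in> M\<^sub>v" using inverse_not_O[OF yO] .
      then have u: "1 + inverse (y i) \<in> O\<^sub>v" "1 + inverse (y i) \<notin> M\<^sub>v" using one_unit[of "1 + inverse (y i)"] by auto
      then have nz: "1 + inverse (y i) \<noteq> 0" using zero_M by auto
      have e: "1 + y i = y i * (1 + inverse (y i))" using y0 by (simp add: algebra_simps)
      have e1: "inverse (1 + y i) = inverse (y i) * inverse (1 + inverse (y i))"
        and e2: "y i * inverse (1 + y i) = inverse (1 + inverse (y i))"
        unfolding e using y0 nz by simp_all
      have "1 + y i \<noteq> 0" unfolding e using y0 nz by simp
      moreover have "inverse (1 + y i) \<in> O\<^sub>v" unfolding e1
        using inverse_unit[OF u] iM M_subset_O by (intro closed_ring_mult[OF closed_ring_O]) auto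
      moreover have "y i * inverse (1 + y i) \<in> O\<^sub>v" unfolding e2 using inverse_unit[OF u] by blast
      ultimately show ?thesis by blast
    qed
    have a\<alpha>: "poly q a = y 0" using \<alpha>(3) by (simp add: y_def)
    have "inverse (1 + y 0) \<in> adj F a"
    proof -
      have "poly (1 + q) a \<in> adj F a"
        unfolding adj_def using q R by (intro imageI closed_ring_add[OF closed_ring_polys] closed_ring_one[OF closed_ring_polys])
      then show ?thesis using closed_field_inverse[OF alg_base_field[OF alg_base_adj[OF F]]] a\<alpha> by simp
    qed
    then obtain k where k: "k \<in> polys F" "inverse (1 + y 0) = poly k a" by (auto simp: adj_def)
    \<comment> \<open>The relation k (1 + q) = 1 holds at a, hence modulo the minimal polynomial,
      hence at every conjugate.\<close>
    have "k * (1 + q) - 1 \<in> polys F"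
      using k q closed_ring_polys[OF R] by (auto intro: closed_ring_intros)
    moreover have "poly (k * (1 + q) - 1) a = 0" using k good[OF \<alpha>(2)] a\<alpha> by (simp flip: k(2))
    ultimately have dvd: "root_poly n \<alpha> dvd k * (1 + q) - 1" using \<alpha>(1) by (auto simp: minpoly_def)
    have kv: "poly k (\<alpha> i) = inverse (1 + y i)" if "i < n" for i
    proof -
      have "poly (k * (1 + q) - 1) (\<alpha> i) = 0"
        using dvd by (rule dvd_root) (use that in \<open>auto simp: poly_root_poly_eq_0_iff\<close>)
      then show ?thesis using good[OF that] by (simp add: y_def field_simps)
    qed
    obtain G1 where G1: "G1\<in>polys (F \<inter> O\<^sub>v)" "poly G1 (\<alpha> 0) = poly k (\<alpha> 0) * \<delta>"
      using interpolation_integral[OF R \<alpha>F \<alpha>(2) \<alpha>O k(1)] kv good unfolding \<delta>_def by auto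
    have qk: "q * k \<in> polys F" using q k closed_ring_polys[OF R] by (auto intro: closed_ring_intros)
    obtain G2 where G2: "G2\<in>polys (F \<inter> O\<^sub>v)" "poly G2 (\<alpha> 0) = poly (q * k) (\<alpha> 0) * \<delta>"
      using interpolation_integral[OF R \<alpha>F \<alpha>(2) \<alpha>O qk] kv good unfolding \<delta>_def by (auto simp: y_def)
    let ?s = "a ^ m * poly G1 a"
    have "?s \<in> adj (F \<inter> O\<^sub>v) a"
      using G1 A adj_mem[OF FO] by (intro closed_ring_mult closed_ring_power) (auto simp: adj_def)
    moreover have "?s \<notin> M\<^sub>v"
    proof -
      have "poly G1 a = inverse (1 + y 0) * \<delta>" using G1(2) kv[OF \<alpha>(2)] \<alpha>(3) by simp
      moreover have "inverse (1 + y 0) \<notin> M\<^sub>v" "inverse (1 + y 0) \<in> O\<^sub>v"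
        using inverse_unit one_unit[of "1 + y 0"] \<open>y 0 \<in> M\<^sub>v\<close> by auto
      ultimately have "poly G1 a \<in> O\<^sub>v" "poly G1 a \<notin> M\<^sub>v"
        using \<delta> closed_ring_O by (auto intro: closed_ring_mult simp: not_M_mult)
      then show ?thesis using aU closed_ring_O by (intro not_M_mult not_M_power closed_ring_power)
    qed
    moreover have "?s * x = poly G2 a"
      using G1(2) G2(2) \<alpha>(3) a\<alpha> y0 by simp
    moreover have "poly G2 a \<in> adj (F \<inter> O\<^sub>v) a" using G2 by (auto simp: adj_def)
    ultimately show ?thesis unfolding frac_def by auto
  qed
  show ?thesis
  proof
    fix x assume x: "x \<in> adj F a \<inter> O\<^sub>v"
    show "x \<in> frac (adj (F \<inter> O\<^sub>v) a)"
    proof (cases "x \<in> M\<^sub>v")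
      case False
      then have "x \<noteq> 0" using zero_M by auto
      then obtain c where c: "c \<in> F" "c \<noteq> 0" "x / c - 1 \<in> M\<^sub>v"
        using hensel_root_immediate[OF F a] x by (auto simp: immediate_def)
      have "v (x / c) = 0" using one_unit[OF c(3)] unit_iff[of "x / c"] by auto
      then have "v c = 0" using c(2) \<open>x \<noteq> 0\<close> False x unit_iff[of x] by (simp add: v_divide)
      then have cO: "c \<in> O\<^sub>v" by (rule O_I)
      have "c * (x / c - 1) \<in> M\<^sub>v" using cO c(3) by (rule M_mult2)
      moreover have "c * (x / c - 1) = x - c" using c(2) by (simp add: right_diff_distrib)
      ultimately have "x - c \<in> M\<^sub>v" by simp
      moreover have "x - c \<in> adj F a"
        using x c adj_incl[OF R, of a] closed_ring_adj[OF R] by (auto intro: closed_ring_diff)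
      ultimately have "x - c \<in> frac (adj (F \<inter> O\<^sub>v) a)" using pos by blast
      moreover have "c \<in> frac (adj (F \<inter> O\<^sub>v) a)"
        using c cO adj_incl[OF FO, of a] frac_incl[OF A] by auto
      ultimately have "(x - c) + c \<in> frac (adj (F \<inter> O\<^sub>v) a)"
        by (rule closed_ring_add[OF closed_ring_frac[OF A AO]])
      then show ?thesis by simp
    qed (use x pos in auto)
  qed
qed

end

section \<open>Towers of Hensel roots and the henselization\<close>

context valued_alg_closed
begin

inductive hensel_tower :: "'k set \<Rightarrow> 'k set \<Rightarrow> bool" for F where
  refl: "hensel_tower F F"
| step: "hensel_tower F E \<Longrightarrow> hensel_root E a \<Longrightarrow> hensel_tower F (adj E a)"

lemma immediate_trans:
  assumes "immediate F E" "immediate E G" shows "immediate F G"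
  unfolding immediate_def
proof (intro ballI impI)
  fix x assume x: "x \<in> G" "x \<noteq> 0"
  then obtain c where c: "c \<in> E" "c \<noteq> 0" "x / c - 1 \<in> M\<^sub>v" using assms(2) by (auto simp: immediate_def)
  then obtain d where d: "d \<in> F" "d \<noteq> 0" "c / d - 1 \<in> M\<^sub>v" using assms(1) by (auto simp: immediate_def)
  have "x / c * (c / d) - 1 \<in> M\<^sub>v" using c(3) d(3) by (rule unit_ratio_mult)
  moreover have "x / c * (c / d) = x / d" using c(2) by simp
  ultimately show "\<exists>c\<in>F. c \<noteq> 0 \<and> x / c - 1 \<in> M\<^sub>v" using d by (intro bexI[of _ d]) simp_all
qed

lemma hensel_tower_base:
  "hensel_tower F E \<Longrightarrow> alg_base F \<Longrightarrow> alg_base E \<and> F \<subseteq> E \<and> immediate F E"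
proof (induction rule: hensel_tower.induct)
  case refl
  have "x / x - 1 \<in> M\<^sub>v" if "x \<noteq> 0" for x using that by (simp add: zero_M)
  then show ?case using refl by (auto simp: immediate_def)
next
  case (step E a)
  then have E: "alg_base E" "F \<subseteq> E" "immediate F E" by auto
  then have "alg_base (adj E a)" "immediate F (adj E a)"
    using alg_base_adj immediate_trans hensel_root_immediate[OF E(1) step(2)] by blast+
  moreover have "F \<subseteq> adj E a" using E adj_incl[OF alg_base_ring[OF E(1)]] by blast
  ultimately show ?case by blast
qed

lemma hensel_tower_trans: "hensel_tower E G \<Longrightarrow> hensel_tower F E \<Longrightarrow> hensel_tower F G"
  by (induction rule: hensel_tower.induct) (auto intro: hensel_tower.intros)

text \<open>Adjoining the roots of the tower to L step by step works because a Hensel root stays one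
  over a larger field. The last clause identifies L' as the compositum of L and E.\<close>

lemma hensel_tower_join:
  assumes "hensel_tower F E" "alg_base F" "alg_base L" "F \<subseteq> L"
  shows "\<exists>L'. hensel_tower L L' \<and> E \<subseteq> L' \<and> (\<forall>U. closed_ring U \<longrightarrow> L \<subseteq> U \<longrightarrow> E \<subseteq> U \<longrightarrow> L' \<subseteq> U)"
  using assms
proof (induction rule: hensel_tower.induct)
  case refl
  then show ?case by (intro exI[of _ L]) (auto intro: hensel_tower.refl)
next
  case (step E a)
  then obtain L' where L': "hensel_tower L L'" "E \<subseteq> L'"
    "\<And>U. closed_ring U \<Longrightarrow> L \<subseteq> U \<Longrightarrow> E \<subseteq> U \<Longrightarrow> L' \<subseteq> U" by metis
  note ER = alg_base_ring[OF conjunct1[OF hensel_tower_base[OF step(1) step.prems(1)]]]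
  have "hensel_tower L (adj L' a)"
    using L' hensel_root_mono[OF step(2)] by (intro hensel_tower.step)
  moreover have "adj E a \<subseteq> adj L' a" using polys_mono[OF L'(2)] by (auto simp: adj_def)
  moreover have "adj L' a \<subseteq> U" if "closed_ring U" "L \<subseteq> U" "adj E a \<subseteq> U" for U
    using that L'(3)[OF that(1,2)] adj_incl[OF ER, of a] adj_mem[OF ER, of a] by (intro adj_least) auto
  ultimately show ?case by blast
qed

section \<open>The union of all towers\<close>

definition hensel_closure :: "'k set \<Rightarrow> 'k set"
  where "hensel_closure F = \<Union>{E. hensel_tower F E}"

context
  fixes F :: "'k set"
  assumes F: "alg_base F"
begin

text \<open>Towers are directed: the roots of one can be adjoined on top of another. Statements
  about the union follow by moving the finitely many elements involved into one tower.\<close>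

lemma hensel_closure_finite:
  assumes "finite A" "A \<subseteq> hensel_closure F" shows "\<exists>E. hensel_tower F E \<and> A \<subseteq> E"
  using assms
proof (induction A rule: finite_induct)
  case empty
  then show ?case by (auto intro: hensel_tower.refl)
next
  case (insert x A)
  then obtain E1 E2 where E: "hensel_tower F E1" "A \<subseteq> E1" "hensel_tower F E2" "x \<in> E2"
    by (auto simp: hensel_closure_def)
  obtain L' where "hensel_tower E1 L'" "E2 \<subseteq> L'"
    using hensel_tower_join[OF E(3) F] hensel_tower_base[OF E(1) F] by blast
  moreover have "E1 \<subseteq> L'" using hensel_tower_base[OF \<open>hensel_tower E1 L'\<close>] hensel_tower_base[OF E(1) F] by blast
  ultimately show ?case using E hensel_tower_trans by (intro exI[of _ L']) auto
qed

lemma hensel_closure_incl: "F \<subseteq> hensel_closure F"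
  by (auto simp: hensel_closure_def intro: hensel_tower.refl)

lemma closed_field_hensel_closure: "closed_field (hensel_closure F)"
proof -
  have "x - y \<in> hensel_closure F \<and> x * y \<in> hensel_closure F"
    if xy: "x \<in> hensel_closure F" "y \<in> hensel_closure F" for x y
  proof -
    obtain E where E: "hensel_tower F E" "x \<in> E" "y \<in> E" using hensel_closure_finite[of "{x, y}"] xy by auto
    then have "x - y \<in> E \<and> x * y \<in> E"
      using alg_base_ring[OF conjunct1[OF hensel_tower_base[OF E(1) F]]] by (auto simp: closed_ring_def)
    then show ?thesis using E by (auto simp: hensel_closure_def)
  qed
  then have "closed_ring (hensel_closure F)"
    using hensel_closure_incl closed_ring_one[OF alg_base_ring[OF F]] by (auto simp: closed_ring_def)
  then show ?thesis using closed_field_if_ring[OF F _ hensel_closure_incl] by blast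
qed

lemma alg_base_hensel_closure: "alg_base (hensel_closure F)"
  using alg_base_mono[OF F hensel_closure_incl closed_field_hensel_closure] .

lemma immediate_hensel_closure: "immediate F (hensel_closure F)"
  using hensel_tower_base[OF _ F] by (fastforce simp: immediate_def hensel_closure_def)

lemma hensel_closed_hensel_closure: "hensel_closed (hensel_closure F)"
  unfolding hensel_closed_def
proof (intro allI impI)
  fix a assume "hensel_root (hensel_closure F) a"
  then obtain n \<alpha> where \<alpha>: "0 < n" "\<alpha> 0 = a" "a \<in> O\<^sub>v" "a \<notin> M\<^sub>v"
    "\<forall>i. 0 < i \<longrightarrow> i < n \<longrightarrow> \<alpha> i \<in> M\<^sub>v" "root_poly n \<alpha> \<in> polys (hensel_closure F)" unfolding hensel_root_def by blast
  have "range (coeff (root_poly n \<alpha>)) \<subseteq> hensel_closure F" using \<alpha>(6) by (auto simp: polys_def)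
  then obtain E where E: "hensel_tower F E" "range (coeff (root_poly n \<alpha>)) \<subseteq> E"
    using hensel_closure_finite[OF finite_range_coeff] by blast
  then have "root_poly n \<alpha> \<in> polys E" by (auto simp: polys_def)
  then have "hensel_root E a" unfolding hensel_root_def using \<alpha> by blast
  then have "hensel_tower F (adj E a)" by (rule hensel_tower.step[OF E(1)])
  moreover have "a \<in> adj E a"
    using adj_mem[OF alg_base_ring] hensel_tower_base[OF E(1) F] by blast
  ultimately show "a \<in> hensel_closure F" by (auto simp: hensel_closure_def)
qed

lemma hensel_closure_least:
  assumes G: "closed_field G" "F \<subseteq> G" "hensel_closed G" shows "hensel_closure F \<subseteq> G"
proof -
  have "E \<subseteq> G" if "hensel_tower F E" for E
    using that
  proof (induction rule: hensel_tower.induct)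
    case (step E a)
    then have "a \<in> G" using G(3) hensel_root_mono by (auto simp: hensel_closed_def)
    then show ?case using step closed_field_ring[OF G(1)] by (intro adj_least)
  qed (use G in auto)
  then show ?thesis by (auto simp: hensel_closure_def)
qed

end

section \<open>Essentially finite generation along towers\<close>

lemma frac_gen_subset:
  assumes "closed_ring R" "R \<subseteq> O\<^sub>v" "A \<subseteq> frac R" shows "frac (gen A) \<subseteq> frac R"
  using gen_least[OF closed_ring_frac[OF assms(1,2)] assms(3)] frac_mono frac_idem[OF assms(1,2)] by blast

definition frac_fin_gen :: "'k set \<Rightarrow> 'k set \<Rightarrow> bool"
  where "frac_fin_gen A B \<longleftrightarrow> (\<exists>G. finite G \<and> G \<subseteq> B \<and> B \<subseteq> frac (gen (A \<union> G)))"

lemma frac_fin_gen_trans: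
  assumes "frac_fin_gen A B" "frac_fin_gen B C" "A \<subseteq> B" "B \<subseteq> C" "C \<subseteq> O\<^sub>v"
  shows "frac_fin_gen A C"
proof -
  obtain G H where G: "finite G" "G \<subseteq> B" "B \<subseteq> frac (gen (A \<union> G))"
    and H: "finite H" "H \<subseteq> C" "C \<subseteq> frac (gen (B \<union> H))"
    using assms by (auto simp: frac_fin_gen_def)
  let ?R = "gen (A \<union> (G \<union> H))"
  have "A \<union> (G \<union> H) \<subseteq> O\<^sub>v" using assms G H by blast
  then have R: "closed_ring ?R" "?R \<subseteq> O\<^sub>v" using closed_ring_gen gen_least[OF closed_ring_O] by auto
  have "B \<subseteq> frac ?R" using G(3) frac_mono[OF gen_mono[of "A \<union> G" "A \<union> (G \<union> H)"]] by blast
  moreover have "H \<subseteq> frac ?R" using frac_incl[OF R(1)] gen_incl[of "A \<union> (G \<union> H)"] by blast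
  ultimately have "B \<union> H \<subseteq> frac ?R" by blast
  from frac_gen_subset[OF R this] have "C \<subseteq> frac ?R" using H(3) by blast
  then show ?thesis unfolding frac_fin_gen_def using G H assms by (intro exI[of _ "G \<union> H"]) auto
qed

lemma hensel_tower_fin_gen:
  "hensel_tower F E \<Longrightarrow> alg_base F \<Longrightarrow> frac_fin_gen (F \<inter> O\<^sub>v) (E \<inter> O\<^sub>v)"
proof (induction rule: hensel_tower.induct)
  case refl
  have "F \<inter> O\<^sub>v \<subseteq> frac (gen (F \<inter> O\<^sub>v))" using gen_incl frac_incl[OF closed_ring_gen] by blast
  then show ?case unfolding frac_fin_gen_def by (intro exI[of _ "{}"]) auto
next
  case (step E a)
  have E: "alg_base E" "F \<subseteq> E" using hensel_tower_base[OF step(1) step.prems] by auto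
  have EO: "closed_ring (E \<inter> O\<^sub>v)" using alg_base_ring[OF E(1)] closed_ring_O by (auto simp: closed_ring_def)
  have aO: "a \<in> O\<^sub>v" using step(2) by (auto simp: hensel_root_def)
  have incl: "E \<subseteq> adj E a" using adj_incl[OF alg_base_ring[OF E(1)]] .
  have "adj (E \<inter> O\<^sub>v) a \<subseteq> gen ((E \<inter> O\<^sub>v) \<union> {a})"
    using gen_incl[of "(E \<inter> O\<^sub>v) \<union> {a}"] by (intro adj_least closed_ring_gen) auto
  then have "adj E a \<inter> O\<^sub>v \<subseteq> frac (gen ((E \<inter> O\<^sub>v) \<union> {a}))"
    using hensel_root_integers[OF E(1) step(2)] frac_mono by blast
  then have "frac_fin_gen (E \<inter> O\<^sub>v) (adj E a \<inter> O\<^sub>v)"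
    unfolding frac_fin_gen_def using adj_mem[OF alg_base_ring[OF E(1)], of a] aO by (intro exI[of _ "{a}"]) auto
  then show ?case using step.IH[OF step.prems] E incl
    by (auto intro: frac_fin_gen_trans[of "F \<inter> O\<^sub>v" "E \<inter> O\<^sub>v" "adj E a \<inter> O\<^sub>v"])
qed

text \<open>A relation \<open>s w = t\<close> between polynomials in the Hensel root is reduced modulo its minimal
  polynomial over \<open>L\<close>; comparing coefficients gives relations over \<open>L\<close>, one of them with a unit.\<close>

lemma descent_step:
  assumes L: "alg_base L" and a: "hensel_root L a" and V: "V \<subseteq> L \<inter> O\<^sub>v"
    and fg: "frac_fin_gen V (adj L a \<inter> O\<^sub>v)"
  shows "frac_fin_gen V (L \<inter> O\<^sub>v)"
proof -
  note R = alg_base_ring[OF L]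
  have LO: "closed_ring (L \<inter> O\<^sub>v)" using R closed_ring_O by (auto simp: closed_ring_def)
  have aO: "a \<in> O\<^sub>v" "a \<notin> M\<^sub>v" using a by (auto simp: hensel_root_def)
  obtain n \<alpha> where \<alpha>: "minpoly L a (root_poly n \<alpha>)" "0 < n" "\<alpha> 0 = a" "\<And>i. 0 < i \<Longrightarrow> i < n \<Longrightarrow> \<alpha> i \<in> M\<^sub>v"
    using hensel_root_minpoly[OF L a] by blast
  define h where "h = root_poly n \<alpha>"
  have \<alpha>O: "\<alpha> i \<in> O\<^sub>v" if "i \<in> {..<n}" for i using \<alpha>(3,4) aO that M_subset_O by (cases "i = 0") auto
  have "h \<in> polys O\<^sub>v" unfolding h_def root_poly_def
    by (rule closed_ring_prod[OF closed_ring_polys[OF closed_ring_O]]) (rule linear_factor_in_polys[OF closed_ring_O \<alpha>O])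
  moreover have hL: "h \<in> polys L" "lead_coeff h = 1" "\<And>p. p \<in> polys L \<Longrightarrow> poly p a = 0 \<Longrightarrow> h dvd p"
    using \<alpha>(1) by (auto simp: h_def minpoly_def)
  ultimately have hLO: "h \<in> polys (L \<inter> O\<^sub>v)" by (auto simp: polys_def)
  obtain G where G: "finite G" "G \<subseteq> adj L a \<inter> O\<^sub>v" "adj L a \<inter> O\<^sub>v \<subseteq> frac (gen (V \<union> G))"
    using fg by (auto simp: frac_fin_gen_def)
  have "\<exists>s t. s \<in> polys (L \<inter> O\<^sub>v) \<and> t \<in> polys (L \<inter> O\<^sub>v) \<and> poly s a \<notin> M\<^sub>v \<and> poly s a * g = poly t a" if g: "g \<in> G" for g
  proof -
    have "g \<in> frac (adj (L \<inter> O\<^sub>v) a)" using g G(2) hensel_root_integers[OF L a] by blast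
    then obtain s t where "s \<in> polys (L \<inter> O\<^sub>v)" "t \<in> polys (L \<inter> O\<^sub>v)" "poly s a \<notin> M\<^sub>v" "poly s a * g = poly t a"
      unfolding frac_def adj_def by blast
    then show ?thesis by blast
  qed
  then obtain s t where st: "\<And>g. g \<in> G \<Longrightarrow> s g \<in> polys (L \<inter> O\<^sub>v)" "\<And>g. g \<in> G \<Longrightarrow> t g \<in> polys (L \<inter> O\<^sub>v)"
    "\<And>g. g \<in> G \<Longrightarrow> poly (s g) a \<notin> M\<^sub>v" "\<And>g. g \<in> G \<Longrightarrow> poly (s g) a * g = poly (t g) a" by metis
  \<comment> \<open>The coefficients of the minimal polynomial and of the numerators and
    denominators of all generators. Over the ring C that they generate together with V, both the
    generators and the reduction modulo h are available, and C stays inside L.\<close>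
  define H where "H = range (coeff h) \<union> (\<Union>g\<in>G. range (coeff (s g)) \<union> range (coeff (t g)))"
  have finH: "finite H" unfolding H_def using G(1) finite_range_coeff by blast
  have HLO: "H \<subseteq> L \<inter> O\<^sub>v" unfolding H_def using hLO st(1,2) by (auto simp: polys_def)
  define C where "C = gen (V \<union> H)"
  have C: "closed_ring C" "V \<union> H \<subseteq> C" "C \<subseteq> L \<inter> O\<^sub>v"
    unfolding C_def using closed_ring_gen gen_incl[of "V \<union> H"] gen_least[OF LO, of "V \<union> H"] V HLO by blast+
  have hC: "h \<in> polys C" and stC: "\<And>g. g \<in> G \<Longrightarrow> s g \<in> polys C" "\<And>g. g \<in> G \<Longrightarrow> t g \<in> polys C"
  proof -
    have "range (coeff h) \<subseteq> C" "\<And>g. g \<in> G \<Longrightarrow> range (coeff (s g)) \<subseteq> C" "\<And>g. g \<in> G \<Longrightarrow> range (coeff (t g)) \<subseteq> C"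
      using C(2) unfolding H_def by blast+
    then show "h \<in> polys C" "\<And>g. g \<in> G \<Longrightarrow> s g \<in> polys C" "\<And>g. g \<in> G \<Longrightarrow> t g \<in> polys C"
      unfolding polys_def by blast+
  qed
  define A where "A = adj C a"
  have A: "closed_ring A" "A \<subseteq> O\<^sub>v"
    unfolding A_def using closed_ring_adj[OF C(1)] adj_least[OF closed_ring_O] C(3) aO by auto
  have "G \<subseteq> frac A"
  proof
    fix g assume g: "g \<in> G"
    have "poly (s g) a \<in> A" "poly (t g) a \<in> A" using stC[OF g] by (auto simp: A_def adj_def)
    then show "g \<in> frac A" unfolding frac_def using st(3,4)[OF g] by (intro CollectI bexI[of _ "poly (s g) a"]) simp_all
  qed
  moreover have "V \<subseteq> frac A" using C(2) adj_incl[OF C(1), of a] frac_incl[OF A(1)] unfolding A_def by blast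
  ultimately have "frac (gen (V \<union> G)) \<subseteq> frac A" by (intro frac_gen_subset[OF A]) auto
  then have LA: "adj L a \<inter> O\<^sub>v \<subseteq> frac A" using G(3) by blast
  have "w \<in> frac C" if w: "w \<in> L \<inter> O\<^sub>v" for w
  proof -
    have "w \<in> frac A" using w LA adj_incl[OF R, of a] by auto
    then obtain P Q where PQ: "P \<in> polys C" "Q \<in> polys C" "poly P a \<notin> M\<^sub>v" "poly P a * w = poly Q a"
      unfolding frac_def A_def adj_def by blast
    obtain P1 P2 where P: "P2 \<in> polys C" "P = P1 * h + P2" "\<forall>i\<ge>degree h. coeff P2 i = 0"
      using division_by_monic[OF C(1) hC hL(2) PQ(1)] by blast
    obtain Q1 Q2 where Q: "Q2 \<in> polys C" "Q = Q1 * h + Q2" "\<forall>i\<ge>degree h. coeff Q2 i = 0"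
      using division_by_monic[OF C(1) hC hL(2) PQ(2)] by blast
    have ha: "poly h a = 0" using \<alpha>(1) by (simp add: h_def minpoly_def)
    let ?D = "smult w P2 - Q2"
    have CL: "polys C \<subseteq> polys L" using C(3) by (intro polys_mono) auto
    have "?D \<in> polys L"
      using P(1) Q(1) CL w closed_ring_polys[OF R] by (intro closed_ring_diff smult_in_polys[OF R]) auto
    moreover have "poly ?D a = 0" using PQ(4) P(2) Q(2) ha by (simp add: mult.commute)
    ultimately have "h dvd ?D" by (rule hL(3))
    have "?D = 0"
    proof (rule ccontr)
      assume "?D \<noteq> 0"
      then have "degree h \<le> degree ?D" using \<open>h dvd ?D\<close> by (intro dvd_imp_degree_le)
      then have "lead_coeff ?D = 0" using P(3) Q(3) by simp
      with \<open>?D \<noteq> 0\<close> show False using leading_coeff_0_iff by blast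
    qed
    then have eq: "w * coeff P2 i = coeff Q2 i" for i
    proof -
      have "coeff ?D i = 0" unfolding \<open>?D = 0\<close> by simp
      then show ?thesis by (simp only: coeff_diff coeff_smult right_minus_eq)
    qed
    \<comment> \<open>Otherwise P2(a) would lie in \<open>M\<^sub>v\<close>; but it equals the
      denominator P(a).\<close>
    have "\<exists>i. coeff P2 i \<notin> M\<^sub>v"
    proof (rule ccontr)
      assume "\<not> ?thesis"
      then have "P2 \<in> polys M\<^sub>v" by (auto simp: polys_def)
      from poly_M[OF this aO(1)] have "poly P2 a \<in> M\<^sub>v" .
      then show False using PQ(3) P(2) ha by simp
    qed
    then obtain i where i: "coeff P2 i \<notin> M\<^sub>v" by blast
    have "coeff P2 i * w = coeff Q2 i" by (subst mult.commute) (rule eq)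
    then have "coeff P2 i \<in> C" "coeff P2 i * w \<in> C" using polysD[OF P(1)] polysD[OF Q(1)] by simp_all
    then show ?thesis unfolding frac_def using i by blast
  qed
  then show ?thesis unfolding frac_fin_gen_def using finH HLO C_def by (intro exI[of _ H]) auto
qed

lemma descent:
  "hensel_tower L E \<Longrightarrow> alg_base L \<Longrightarrow> V \<subseteq> L \<inter> O\<^sub>v \<Longrightarrow> frac_fin_gen V (E \<inter> O\<^sub>v) \<Longrightarrow> frac_fin_gen V (L \<inter> O\<^sub>v)"
proof (induction rule: hensel_tower.induct)
  case (step E a)
  have E: "alg_base E" "L \<subseteq> E" using hensel_tower_base[OF step(1) step.prems(1)] by auto
  have "V \<subseteq> E \<inter> O\<^sub>v" using step.prems(2) E(2) by auto
  from descent_step[OF E(1) step(2) this step.prems(3)]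
  show ?case by (rule step.IH[OF step.prems(1,2)])
qed

text \<open>Choose a tower E that contains the coordinates of a finite spanning family of L over K.
  The E-span U of the b_i contains L, hence the products b_i b_j, and is therefore a ring; so it
  contains the compositum L' of L and E. By \<open>int\<close>, integral elements of L' have
  integral coordinates, so the b_i generate the integers of L' over those of E. The tower E over K
  and descent along L' over L finish the argument.\<close>

lemma fin_gen_of_integral_basis:
  fixes b u :: "nat \<Rightarrow> 'k"
  assumes K: "alg_base K" and L: "closed_field L" "K \<subseteq> L"
    and u: "\<And>l. l < m \<Longrightarrow> u l \<in> L" "\<And>x. x \<in> L \<Longrightarrow> \<exists>k. (\<forall>l<m. k l \<in> K) \<and> x = (\<Sum>l<m. k l * u l)"
    and b: "\<And>i. i < N \<Longrightarrow> b i \<in> L \<inter> O\<^sub>v"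
    and span: "\<And>x. x \<in> L \<Longrightarrow> \<exists>c. (\<forall>i<N. c i \<in> hensel_closure K) \<and> x = (\<Sum>i<N. c i * b i)"
    and int: "\<And>c. (\<forall>i<N. c i \<in> hensel_closure K) \<Longrightarrow> (\<Sum>i<N. c i * b i) \<in> O\<^sub>v \<Longrightarrow> \<forall>i<N. c i \<in> O\<^sub>v"
  shows "frac_fin_gen (K \<inter> O\<^sub>v) (L \<inter> O\<^sub>v)"
proof -
  have Lb: "alg_base L" using alg_base_mono[OF K L(2,1)] .
  note LR = closed_field_ring[OF L(1)]
  obtain c where c: "\<And>x i. x \<in> L \<Longrightarrow> i < N \<Longrightarrow> c x i \<in> hensel_closure K" "\<And>x. x \<in> L \<Longrightarrow> x = (\<Sum>i<N. c x i * b i)"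
    using span by metis
  have "finite ((\<lambda>(l, i). c (u l) i) ` ({..<m} \<times> {..<N}))" by auto
  moreover have "(\<lambda>(l, i). c (u l) i) ` ({..<m} \<times> {..<N}) \<subseteq> hensel_closure K" using c(1) u(1) by auto
  ultimately obtain E where E: "hensel_tower K E" "(\<lambda>(l, i). c (u l) i) ` ({..<m} \<times> {..<N}) \<subseteq> E"
    using hensel_closure_finite[OF K] by blast
  have EB: "alg_base E" "K \<subseteq> E" using hensel_tower_base[OF E(1) K] by auto
  note ER = alg_base_ring[OF EB(1)]
  have EH: "E \<subseteq> hensel_closure K" using E(1) by (auto simp: hensel_closure_def)
  define U where "U = {\<Sum>i<N. e i * b i | e. \<forall>i<N. e i \<in> E}"
  have UI: "(\<Sum>i<N. e i * b i) \<in> U" if "\<And>i. i < N \<Longrightarrow> e i \<in> E" for e using that by (auto simp: U_def)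
  have U_diff: "x - y \<in> U" if xy: "x \<in> U" "y \<in> U" for x y
  proof -
    obtain e where e: "\<forall>i<N. e i \<in> E" "x = (\<Sum>i<N. e i * b i)" using xy(1) unfolding U_def by blast
    obtain f where f: "\<forall>i<N. f i \<in> E" "y = (\<Sum>i<N. f i * b i)" using xy(2) unfolding U_def by blast
    note ef = e(1)[rule_format] f(1)[rule_format] e(2) f(2)
    have "x - y = (\<Sum>i<N. (e i - f i) * b i)" unfolding ef(3,4) by (simp add: sum_subtractf left_diff_distrib)
    then show ?thesis using ef ER by (auto intro!: UI closed_ring_diff)
  qed
  have U_smult: "e * x \<in> U" if ex: "e \<in> E" "x \<in> U" for e x
  proof -
    obtain f where "\<forall>i<N. f i \<in> E" "x = (\<Sum>i<N. f i * b i)" using ex(2) unfolding U_def by blast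
    note f = this(1)[rule_format] this(2)
    have "e * x = (\<Sum>i<N. (e * f i) * b i)" unfolding f(2) sum_distrib_left by (simp add: mult.assoc)
    then show ?thesis using f ex(1) ER by (auto intro!: UI closed_ring_mult)
  qed
  have U0: "0 \<in> U" using UI[of "\<lambda>_. 0"] closed_ring_zero[OF ER] by simp
  have U_add: "x + y \<in> U" if "x \<in> U" "y \<in> U" for x y
    using U_diff[OF that(1) U_diff[OF U0 that(2)]] by simp
  have U_sum: "sum f I \<in> U" if "\<And>i. i \<in> I \<Longrightarrow> f i \<in> U" for f :: "'z \<Rightarrow> 'k" and I
    using that by (induction I rule: infinite_finite_induct) (auto intro: U0 U_add)
  have LU: "L \<subseteq> U"
  proof
    fix x assume "x \<in> L"
    then obtain k where k': "\<forall>l<m. k l \<in> K" "x = (\<Sum>l<m. k l * u l)" using u(2) by blast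
    have "u l \<in> U" if l: "l < m" for l
    proof -
      have "(\<Sum>i<N. c (u l) i * b i) \<in> U" using E(2) l by (intro UI) auto
      then show ?thesis using c(2)[OF u(1)[OF l]] by simp
    qed
    then show "x \<in> U" unfolding k'(2) using k'(1) EB(2) by (intro U_sum U_smult) auto
  qed
  have U_ring: "closed_ring U"
    unfolding closed_ring_def
  proof (intro conjI ballI)
    show "1 \<in> U" using LU closed_ring_one[OF LR] by auto
    fix x y assume xy: "x \<in> U" "y \<in> U"
    then show "x - y \<in> U" by (rule U_diff)
    obtain e where e: "\<forall>i<N. e i \<in> E" "x = (\<Sum>i<N. e i * b i)" using xy(1) unfolding U_def by blast
    obtain f where f: "\<forall>i<N. f i \<in> E" "y = (\<Sum>i<N. f i * b i)" using xy(2) unfolding U_def by blast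
    note ef = e(1)[rule_format] f(1)[rule_format] e(2) f(2)
    have "x * y = (\<Sum>i<N. e i * (\<Sum>j<N. f j * (b i * b j)))"
      unfolding ef(3,4) sum_product by (simp add: sum_distrib_left algebra_simps)
    moreover have bb: "b i * b j \<in> U" if "i < N" "j < N" for i j
      using LU closed_ring_mult[OF LR] b that by blast
    have "f j * (b i * b j) \<in> U" if "i < N" "j < N" for i j
      by (rule U_smult[OF ef(2)[OF that(2)] bb[OF that]])
    then have "(\<Sum>j<N. f j * (b i * b j)) \<in> U" if "i < N" for i using that by (intro U_sum) simp
    then have "(\<Sum>i<N. e i * (\<Sum>j<N. f j * (b i * b j))) \<in> U"
      using U_smult[OF ef(1)] by (intro U_sum) simp
    ultimately show "x * y \<in> U" by simp
  qed
  have EU: "E \<subseteq> U" using U_smult[OF _ closed_ring_one[OF U_ring]] by auto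
  from hensel_tower_join[OF E(1) K Lb L(2)] obtain L' where L'0: "hensel_tower L L'" "E \<subseteq> L'"
    "\<forall>U. closed_ring U \<longrightarrow> L \<subseteq> U \<longrightarrow> E \<subseteq> U \<longrightarrow> L' \<subseteq> U" by (elim exE conjE)
  have "L' \<subseteq> U" by (rule L'0(3)[rule_format, OF U_ring LU EU])
  note L' = L'0(1,2) this
  have LL': "L \<subseteq> L'" using hensel_tower_base[OF L'(1) Lb] by blast
  let ?R = "gen ((E \<inter> O\<^sub>v) \<union> b ` {..<N})"
  have "w \<in> frac ?R" if w: "w \<in> L' \<inter> O\<^sub>v" for w
  proof -
    have "w \<in> U" using w L'(3) by auto
    then obtain e where e': "\<forall>i<N. e i \<in> E" "w = (\<Sum>i<N. e i * b i)" unfolding U_def by blast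
    note e = e'(1)[rule_format] e'(2)
    have "\<forall>i<N. e i \<in> hensel_closure K" using e'(1) EH by blast
    moreover have "(\<Sum>i<N. e i * b i) \<in> O\<^sub>v" using w e(2) by (simp only: Int_iff)
    ultimately have "\<forall>i<N. e i \<in> O\<^sub>v" by (rule int)
    then have "w \<in> ?R" unfolding e(2) using e(1) gen_incl[of "(E \<inter> O\<^sub>v) \<union> b ` {..<N}"]
      by (intro closed_ring_sum[OF closed_ring_gen] closed_ring_mult[OF closed_ring_gen]) auto
    then show ?thesis using frac_incl[OF closed_ring_gen] by blast
  qed
  then have "frac_fin_gen (E \<inter> O\<^sub>v) (L' \<inter> O\<^sub>v)"
    unfolding frac_fin_gen_def using b LL' by (intro exI[of _ "b ` {..<N}"]) auto
  then have "frac_fin_gen (K \<inter> O\<^sub>v) (L' \<inter> O\<^sub>v)"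
    using hensel_tower_fin_gen[OF E(1) K] EB(2) L'(2)
    by (auto intro: frac_fin_gen_trans[of "K \<inter> O\<^sub>v" "E \<inter> O\<^sub>v" "L' \<inter> O\<^sub>v"])
  then show ?thesis using descent[OF L'(1) Lb] L(2) by blast
qed

text \<open>The value of the sum is the least value of its nonzero terms c_ij z_j. Terms of least
  value share one index j0, and after division by one of them the sum reduces to a combination of
  the residues of the y_i that is not zero. For an integral sum this gives v(c) + v(z) >= 0
  termwise, and v(c) < 0 is impossible because v(z) lies below every positive value of K.\<close>

lemma standard_basis_value:
  fixes y z :: "nat \<Rightarrow> 'k"
  assumes K: "closed_field K" and KH: "closed_field H" "immediate K H"
    and y: "\<And>i. i < f \<Longrightarrow> y i \<in> O\<^sub>v"
    and indep: "\<And>d. (\<forall>i<f. d i \<in> K \<inter> O\<^sub>v) \<Longrightarrow> (\<Sum>i<f. d i * y i) \<in> M\<^sub>v \<Longrightarrow> \<forall>i<f. d i \<in> M\<^sub>v"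
    and z: "\<And>j. j < e \<Longrightarrow> z j \<noteq> 0 \<and> 0 \<le> v (z j)" "inj_on (v \<circ> z) {..<e}"
    and small: "\<And>j k. j < e \<Longrightarrow> k \<in> K \<Longrightarrow> k \<noteq> 0 \<Longrightarrow> 0 < v k \<Longrightarrow> v (z j) < v k"
    and c: "\<And>i j. i < f \<Longrightarrow> j < e \<Longrightarrow> c i j \<in> H"
    and nz: "i1 < f" "j1 < e" "c i1 j1 \<noteq> 0"
  shows "(\<Sum>i<f. \<Sum>j<e. c i j * (y i * z j)) \<noteq> 0"
    and "(\<Sum>i<f. \<Sum>j<e. c i j * (y i * z j)) \<in> O\<^sub>v \<Longrightarrow> c i1 j1 \<in> O\<^sub>v"
proof -
  note KR = closed_field_ring[OF K] and HR = closed_field_ring[OF KH(1)]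
  define P where "P = {(i, j). i < f \<and> j < e \<and> c i j \<noteq> 0}"
  have "P \<subseteq> {..<f} \<times> {..<e}" by (auto simp: P_def)
  then have finP: "finite P" by (rule finite_subset) auto
  have P1: "(i1, j1) \<in> P" using nz by (simp add: P_def)
  define val where "val p = v (c (fst p) (snd p)) + v (z (snd p))" for p
  have "Min (val ` P) \<in> val ` P" using finP P1 by (intro Min_in) auto
  then obtain p0 where p0: "p0 \<in> P" "val p0 = Min (val ` P)" by auto
  obtain i0 j0 where ij0: "p0 = (i0, j0)" by (cases p0)
  have 0: "i0 < f" "j0 < e" "c i0 j0 \<noteq> 0" using p0 by (auto simp: P_def ij0)
  have min: "v (c i0 j0) + v (z j0) \<le> v (c i j) + v (z j)" if "(i, j) \<in> P" for i j
  proof -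
    have "val p0 \<le> val (i, j)"
      unfolding p0(2) by (rule Min_le[OF finite_imageI[OF finP] imageI[OF that]])
    then show ?thesis by (simp add: val_def ij0)
  qed
  have valK: "\<exists>k\<in>K. k \<noteq> 0 \<and> v k = v x" if x: "x \<in> H" "x \<noteq> 0" for x
  proof -
    obtain k where k: "k \<in> K" "k \<noteq> 0" "x / k - 1 \<in> M\<^sub>v" using KH(2) x by (auto simp: immediate_def)
    then have "v (x / k) = 0" using one_unit[OF k(3)] unit_iff[of "x / k"] by auto
    then have "v k = v x" using k(2) x(2) by (simp add: v_divide)
    then show ?thesis using k by blast
  qed
  \<comment> \<open>If two terms of least value had different v(z), the difference of these would be
    a positive value of K. It exceeds the larger v(z) by \<open>small\<close>, yet it is at most
    that, because the smaller one is nonnegative.\<close>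
  have same: "j = j0" if ij: "(i, j) \<in> P" "v (c i j) + v (z j) = v (c i0 j0) + v (z j0)" for i j
  proof -
    have ij': "i < f" "j < e" "c i j \<noteq> 0" using ij by (auto simp: P_def)
    have "\<not> v (z j0) < v (z j)" 
    proof
      assume lt: "v (z j0) < v (z j)"
      have q: "c i0 j0 / c i j \<in> H" "c i0 j0 / c i j \<noteq> 0"
        using c 0 ij' KH(1) by (auto intro: closed_field_divide)
      have vq: "v (c i0 j0 / c i j) = v (z j) - v (z j0)"
        using 0 ij' ij(2) by (simp add: v_divide algebra_simps)
      obtain k where k: "k \<in> K" "k \<noteq> 0" "v k = v (z j) - v (z j0)" using valK[OF q] vq by auto
      then have "v (z j) < v k" using small[OF ij'(2) k(1,2)] lt by simp
      then show False using k z(1)[OF 0(2)] by (auto simp: less_diff_eq dest: leD)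
    qed
    moreover have "\<not> v (z j) < v (z j0)"
    proof
      assume lt: "v (z j) < v (z j0)"
      have q: "c i j / c i0 j0 \<in> H" "c i j / c i0 j0 \<noteq> 0"
        using c 0 ij' KH(1) by (auto intro: closed_field_divide)
      have vq: "v (c i j / c i0 j0) = v (z j0) - v (z j)"
        using 0 ij' ij(2) by (simp add: v_divide algebra_simps)
      obtain k where k: "k \<in> K" "k \<noteq> 0" "v k = v (z j0) - v (z j)" using valK[OF q] vq by auto
      then have "v (z j0) < v k" using small[OF 0(2) k(1,2)] lt by simp
      then show False using k z(1)[OF ij'(2)] by (auto simp: less_diff_eq dest: leD)
    qed
    ultimately have "v (z j) = v (z j0)" by simp
    then show ?thesis using inj_onD[OF z(2), of j j0] ij'(2) 0(2) by simp
  qed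
  define m where "m = c i0 j0 * z j0"
  have m: "m \<noteq> 0" "v m = v (c i0 j0) + v (z j0)" using 0 z(1)[OF 0(2)] by (auto simp: m_def v_mult)
  define r where "r i j = c i j * z j / m" for i j
  have r_M: "r i j \<in> M\<^sub>v" if "i < f" "j < e" "j \<noteq> j0" for i j
  proof (cases "c i j = 0")
    case False
    then have "(i, j) \<in> P" using that by (simp add: P_def)
    then have "v m < v (c i j) + v (z j)" using min[of i j] same[of i j] that(3) m(2)
      by (auto simp: less_le)
    then show ?thesis using False z(1)[OF that(2)] m(1) by (simp add: r_def divide_M v_mult)
  qed (simp add: r_def zero_M)
  have r_eq: "r i j0 = c i j0 / c i0 j0" for i using z(1)[OF 0(2)] by (simp add: r_def m_def)
  have r_O: "r i j0 \<in> O\<^sub>v" if "i < f" for i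
  proof (cases "c i j0 = 0")
    case False
    then have "(i, j0) \<in> P" using that 0 by (simp add: P_def)
    then show ?thesis using min[of i j0] False 0 by (simp add: r_eq divide_O)
  qed (simp add: r_eq closed_ring_zero[OF closed_ring_O])
  \<comment> \<open>Immediateness replaces coefficients in H by elements of K with the same residue,
    to which \<open>indep\<close> applies.\<close>
  have "\<exists>d\<in>K \<inter> O\<^sub>v. r i j0 - d \<in> M\<^sub>v" if i: "i < f" for i
  proof (cases "r i j0 \<in> M\<^sub>v")
    case True
    then show ?thesis using closed_ring_zero[OF KR] closed_ring_zero[OF closed_ring_O] by (intro bexI[of _ 0]) auto
  next
    case False
    then have rnz: "r i j0 \<noteq> 0" using zero_M by auto
    have "r i j0 \<in> H" unfolding r_eq using c i 0 KH(1) by (auto intro: closed_field_divide)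
    then obtain d where d: "d \<in> K" "d \<noteq> 0" "r i j0 / d - 1 \<in> M\<^sub>v" using KH(2) rnz by (auto simp: immediate_def)
    have "v (r i j0 / d) = 0" using one_unit[OF d(3)] unit_iff[of "r i j0 / d"] by auto
    then have "v d = 0" using d(2) rnz False r_O[OF i] unit_iff[of "r i j0"] by (simp add: v_divide)
    then have dO: "d \<in> O\<^sub>v" by (rule O_I)
    have "d * (r i j0 / d - 1) \<in> M\<^sub>v" using dO d(3) by (rule M_mult2)
    moreover have "d * (r i j0 / d - 1) = r i j0 - d" using d(2) by (simp add: right_diff_distrib)
    ultimately show ?thesis using d(1) dO by (intro bexI[of _ d]) auto
  qed
  then obtain d where d: "\<And>i. i < f \<Longrightarrow> d i \<in> K \<inter> O\<^sub>v" "\<And>i. i < f \<Longrightarrow> r i j0 - d i \<in> M\<^sub>v" by metis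
  have "r i0 j0 = 1" using 0(3) by (simp add: r_eq)
  then have "d i0 \<notin> M\<^sub>v" using d(2)[OF 0(1)] M_add[of "1 - d i0" "d i0"] one_notin_M by auto
  then have dM: "(\<Sum>i<f. d i * y i) \<notin> M\<^sub>v" using indep[of d] d(1) 0(1) by blast
  have dO: "(\<Sum>i<f. d i * y i) \<in> O\<^sub>v"
    using d(1) y by (intro closed_ring_sum[OF closed_ring_O] closed_ring_mult[OF closed_ring_O]) auto
  define S where "S = (\<Sum>i<f. \<Sum>j<e. c i j * (y i * z j))"
  have S: "S / m = (\<Sum>i<f. (\<Sum>j<e. r i j) * y i)"
    unfolding S_def sum_divide_distrib sum_distrib_right
    by (intro sum.cong HOL.refl) (simp_all add: r_def)
  have "S / m - (\<Sum>i<f. d i * y i) = (\<Sum>i<f. ((\<Sum>j<e. r i j) - d i) * y i)"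
    unfolding S by (simp add: sum_subtractf left_diff_distrib)
  moreover have "((\<Sum>j<e. r i j) - d i) * y i \<in> M\<^sub>v" if i: "i < f" for i
  proof -
    have "(\<Sum>j<e. r i j) = r i j0 + (\<Sum>j\<in>{..<e} - {j0}. r i j)" using 0(2) by (simp add: sum.remove)
    then have "(\<Sum>j<e. r i j) - d i = (r i j0 - d i) + (\<Sum>j\<in>{..<e} - {j0}. r i j)" by simp
    also have "\<dots> \<in> M\<^sub>v" using d(2)[OF i] r_M i by (intro M_add M_sum) auto
    finally show ?thesis using y[OF i] by (rule M_mult)
  qed
  ultimately have "S / m - (\<Sum>i<f. d i * y i) \<in> M\<^sub>v" using M_sum[of "{..<f}"] by simp
  from add_M_unit[OF dO dM this] have SM: "S / m \<notin> M\<^sub>v" by simp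
  have "(\<Sum>i<f. d i * y i) + (S / m - (\<Sum>i<f. d i * y i)) \<in> O\<^sub>v"
    using \<open>S / m - _ \<in> M\<^sub>v\<close> M_subset_O dO by (intro closed_ring_add[OF closed_ring_O]) auto
  then have "S / m \<in> O\<^sub>v" by simp
  then have Sm: "S \<noteq> 0" "v (S / m) = 0" using SM unit_iff[of "S / m"] by auto
  then show "(\<Sum>i<f. \<Sum>j<e. c i j * (y i * z j)) \<noteq> 0" by (simp add: S_def)
  have vS: "v S = v m" using Sm m by (simp add: v_divide)
  assume "(\<Sum>i<f. \<Sum>j<e. c i j * (y i * z j)) \<in> O\<^sub>v"
  then have "0 \<le> v m" using vS Sm(1) by (auto simp: S_def O\<^sub>v_def)
  then have ge: "0 \<le> v (c i1 j1) + v (z j1)" using min[OF P1] m(2) by simp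
  show "c i1 j1 \<in> O\<^sub>v"
  proof (rule ccontr)
    assume "c i1 j1 \<notin> O\<^sub>v"
    then have neg: "v (c i1 j1) < 0" by (auto simp: O\<^sub>v_def)
    obtain k where k: "k \<in> K" "k \<noteq> 0" "v k = v (c i1 j1)" using valK c nz by blast
    have "v (z j1) < v (inverse k)"
      using small[OF nz(2), of "inverse k"] k neg closed_field_inverse[OF K k(1)] by (simp add: v_inverse)
    then have "v (z j1) < - v (c i1 j1)" using k by (simp add: v_inverse)
    from add_strict_left_mono[OF this, of "v (c i1 j1)"] have "v (c i1 j1) + v (z j1) < 0" by simp
    then show False using ge by simp
  qed
qed

end

section \<open>Transfer to HOL-Algebra\<close>

definition products :: "('a, 'm) ring_scheme \<Rightarrow> 'a list \<Rightarrow> 'a list \<Rightarrow> 'a list"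
  where "products R ys zs = map (\<lambda>(y, z). y \<otimes>\<^bsub>R\<^esub> z) (List.product ys zs)"

text \<open>The condition on combinations says, without mentioning residue fields, that the residues
  of \<open>ys\<close> are linearly independent over the residue field of K.\<close>

definition standard_family ::
    "('a, 'm) ring_scheme \<Rightarrow> ('a \<Rightarrow> 'g::linordered_ab_group_add) \<Rightarrow> 'a set \<Rightarrow> 'a set \<Rightarrow> 'a list \<Rightarrow> 'a list \<Rightarrow> bool"
  where "standard_family R v K L ys zs \<longleftrightarrow> set ys \<subseteq> val_ring R L v \<and> set zs \<subseteq> val_ring R L v - {\<zero>\<^bsub>R\<^esub>} \<and>
    (\<forall>Ks. set Ks \<subseteq> val_ring R K v \<and> length Ks = length ys \<and> ring.combine R Ks ys \<in> val_ideal R L v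
      \<longrightarrow> set Ks \<subseteq> val_ideal R L v) \<and>
    distinct (map v zs) \<and> (\<forall>z \<in> set zs. \<forall>k \<in> K - {\<zero>\<^bsub>R\<^esub>}. 0 < v k \<longrightarrow> v z < v k)"

definition localized_fin_gen ::
    "('a, 'm) ring_scheme \<Rightarrow> ('a \<Rightarrow> 'g::linordered_ab_group_add) \<Rightarrow> 'a set \<Rightarrow> 'a set \<Rightarrow> bool"
  where "localized_fin_gen R v K L \<longleftrightarrow> (\<exists>G. finite G \<and> G \<subseteq> val_ring R L v \<and>
    (\<forall>w \<in> val_ring R L v. \<exists>s \<in> generate_ring R (val_ring R K v \<union> G).
      s \<notin> val_ideal R L v \<and> s \<otimes>\<^bsub>R\<^esub> w \<in> generate_ring R (val_ring R K v \<union> G)))"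

definition list_span :: "('a, 'm) ring_scheme \<Rightarrow> 'a set \<Rightarrow> 'a list \<Rightarrow> 'a set"
  where "list_span R K us = {ring.combine R Ks us | Ks. set Ks \<subseteq> K \<and> length Ks = length us}"

text \<open>Collects what is needed about the henselization in a predicate of \<open>R\<close>, \<open>v\<close> and \<open>K\<close> only, so
  that it can be transferred from a field given by a type class to an arbitrary field.\<close>

definition henselian_structure ::
    "('a, 'm) ring_scheme \<Rightarrow> ('a \<Rightarrow> 'g::linordered_ab_group_add) \<Rightarrow> 'a set \<Rightarrow> bool"
  where "henselian_structure R v K \<longleftrightarrow> (\<exists>H. subfield H R \<and> K \<subseteq> H \<and> unique_extension R v H \<and>
    (\<forall>F. subfield F R \<and> K \<subseteq> F \<and> unique_extension R v F \<longrightarrow> H \<subseteq> F) \<and>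
    (\<forall>L ys zs xs. subfield L R \<and> K \<subseteq> L \<and> standard_family R v K L ys zs \<longrightarrow>
      (\<forall>Ks. set Ks \<subseteq> H \<and> length Ks = length (products R ys zs) \<and>
        ring.combine R Ks (products R ys zs) = \<zero>\<^bsub>R\<^esub> \<longrightarrow> set Ks \<subseteq> {\<zero>\<^bsub>R\<^esub>}) \<and>
      (set xs \<subseteq> L \<and> L \<subseteq> list_span R K xs \<and> L \<subseteq> list_span R H (products R ys zs)
        \<longrightarrow> localized_fin_gen R v K L)))"

text \<open>Algebraic closedness for monic polynomials, with coefficient lists headed by the leading
  coefficient. Only evaluation occurs, so the property passes easily to isomorphic copies.\<close>

definition root_closed :: "('a, 'm) ring_scheme \<Rightarrow> bool"
  where "root_closed R \<longleftrightarrow> (\<forall>cs. set cs \<subseteq> carrier R \<and> cs \<noteq> [] \<longrightarrow>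
    (\<exists>x \<in> carrier R. ring.eval R (\<one>\<^bsub>R\<^esub> # cs) x = \<zero>\<^bsub>R\<^esub>))"

section \<open>A carrier field isomorphic to a field given by a type\<close>

locale typed_field = field \<Omega> for \<Omega> :: "('a, 'm) ring_scheme" (structure) +
  fixes \<phi> :: "'k::field \<Rightarrow> 'a"
  assumes bij: "bij_betw \<phi> UNIV (carrier \<Omega>)"
    and \<phi>_add: "\<phi> (x + y) = \<phi> x \<oplus> \<phi> y" and \<phi>_mult: "\<phi> (x * y) = \<phi> x \<otimes> \<phi> y" and \<phi>_one: "\<phi> 1 = \<one>"
begin

lemma \<phi>_carrier: "\<phi> x \<in> carrier \<Omega>"
  using bij by (auto simp: bij_betw_def)

lemma \<phi>_inj: "\<phi> x = \<phi> y \<longleftrightarrow> x = y"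
  using bij by (auto simp: bij_betw_def dest: injD)

lemma \<phi>_image_iff: "\<phi> x \<in> \<phi> ` A \<longleftrightarrow> x \<in> A"
  by (auto simp: \<phi>_inj)

lemma \<phi>_zero: "\<phi> 0 = \<zero>"
proof -
  have "\<phi> 0 \<oplus> \<phi> 0 = \<phi> 0" by (simp flip: \<phi>_add)
  then show ?thesis using \<phi>_carrier by (simp add: add.l_cancel_one')
qed

lemma \<phi>_eq_zero: "\<phi> x = \<zero> \<longleftrightarrow> x = 0"
  using \<phi>_inj[of x 0] by (simp add: \<phi>_zero)

lemma \<phi>_uminus: "\<phi> (- x) = \<ominus> \<phi> x"
proof -
  have "\<phi> (- x) \<oplus> \<phi> x = \<zero>" by (simp add: \<phi>_zero flip: \<phi>_add)
  then show ?thesis using minus_equality \<phi>_carrier by metis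
qed

lemma \<phi>_inverse: "x \<noteq> 0 \<Longrightarrow> \<phi> (inverse x) = inv \<phi> x"
proof -
  assume "x \<noteq> 0"
  then have "\<phi> x \<otimes> \<phi> (inverse x) = \<one>" by (simp add: \<phi>_one flip: \<phi>_mult)
  then show ?thesis using comm_inv_char \<phi>_carrier by metis
qed

lemma \<phi>_image_vimage: "F \<subseteq> carrier \<Omega> \<Longrightarrow> \<phi> ` (\<phi> -` F) = F"
  using bij by (auto simp: bij_betw_def)

lemma \<phi>_combine: "length ks = length us \<Longrightarrow> combine (map \<phi> ks) (map \<phi> us) = \<phi> (\<Sum>i<length us. ks ! i * us ! i)"
proof (induction ks us rule: list_induct2)
  case (Cons k ks u us)
  then show ?case
    unfolding list.size by (simp add: \<phi>_add \<phi>_mult sum.lessThan_Suc_shift del: sum.lessThan_Suc)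
qed (simp add: \<phi>_zero)

lemma \<phi>_pow: "\<phi> x [^] n = \<phi> (x ^ n)" for n :: nat
  by (induction n) (auto simp: \<phi>_one \<phi>_mult \<phi>_carrier m_comm)

lemma \<phi>_eval: "eval (map \<phi> ps) (\<phi> x) = \<phi> (poly (Poly (rev ps)) x)"
  by (induction ps) (auto simp: \<phi>_zero \<phi>_add \<phi>_mult \<phi>_pow Poly_snoc poly_monom \<phi>_carrier a_comm m_comm)

lemma subfield_image:
  assumes "closed_field A" shows "subfield (\<phi> ` A) \<Omega>"
proof (rule subfieldI')
  note R = closed_field_ring[OF assms]
  show "subring (\<phi> ` A) \<Omega>"
  proof (rule subringI)
    show "\<phi> ` A \<subseteq> carrier \<Omega>" using \<phi>_carrier by auto
    show "\<one> \<in> \<phi> ` A" using closed_ring_one[OF R] by (metis \<phi>_one imageI)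
    show "\<ominus> h \<in> \<phi> ` A" if "h \<in> \<phi> ` A" for h
      using that closed_ring_uminus[OF R] by (auto simp flip: \<phi>_uminus)
    show "h1 \<otimes> h2 \<in> \<phi> ` A" "h1 \<oplus> h2 \<in> \<phi> ` A" if "h1 \<in> \<phi> ` A" "h2 \<in> \<phi> ` A" for h1 h2
      using that closed_ring_mult[OF R] closed_ring_add[OF R] by (auto simp flip: \<phi>_mult \<phi>_add)
  qed
  fix k assume "k \<in> \<phi> ` A - {\<zero>}"
  then obtain a where "a \<in> A" "k = \<phi> a" "a \<noteq> 0" by (auto simp: \<phi>_eq_zero)
  then show "inv k \<in> \<phi> ` A" using closed_field_inverse[OF assms] by (auto simp flip: \<phi>_inverse)
qed

lemma subfield_vimage:
  assumes F: "subfield F \<Omega>" shows "closed_field (\<phi> -` F)" "\<phi> ` (\<phi> -` F) = F"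
proof -
  note S = subfieldE(1)[OF F]
  show "\<phi> ` (\<phi> -` F) = F" by (rule \<phi>_image_vimage) (rule subringE(1)[OF S])
  have "closed_ring (\<phi> -` F)"
    unfolding closed_ring_def
  proof (intro conjI ballI)
    show "1 \<in> \<phi> -` F" using subringE(3)[OF S] by (simp add: \<phi>_one)
    fix x y assume "x \<in> \<phi> -` F" "y \<in> \<phi> -` F"
    then show "x - y \<in> \<phi> -` F" "x * y \<in> \<phi> -` F"
      using subringE(5,6,7)[OF S] \<phi>_add[of x "- y"] by (auto simp: \<phi>_uminus \<phi>_mult)
  qed
  moreover have "inverse x \<in> \<phi> -` F" if "x \<in> \<phi> -` F" for x
    using that subfield_m_inv(1)[OF F, of "\<phi> x"] \<phi>_inj[of x 0] by (cases "x = 0") (auto simp: \<phi>_inverse \<phi>_zero)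
  ultimately show "closed_field (\<phi> -` F)" by (simp add: closed_field_def)
qed

lemma gen_image: "x \<in> gen A \<Longrightarrow> \<phi> x \<in> generate_ring \<Omega> (\<phi> ` A)"
proof -
  have "closed_ring (\<phi> -` generate_ring \<Omega> (\<phi> ` A))"
    unfolding closed_ring_def
  proof (intro conjI ballI)
    show "1 \<in> \<phi> -` generate_ring \<Omega> (\<phi> ` A)" using generate_ring.one[of \<Omega>] by (simp add: \<phi>_one)
    fix x y assume "x \<in> \<phi> -` generate_ring \<Omega> (\<phi> ` A)" "y \<in> \<phi> -` generate_ring \<Omega> (\<phi> ` A)"
    then show "x - y \<in> \<phi> -` generate_ring \<Omega> (\<phi> ` A)" "x * y \<in> \<phi> -` generate_ring \<Omega> (\<phi> ` A)"
      using generate_ring.intros(3-5)[of _ \<Omega> "\<phi> ` A"] \<phi>_add[of x "- y"] by (auto simp: \<phi>_uminus \<phi>_mult)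
  qed
  moreover have "A \<subseteq> \<phi> -` generate_ring \<Omega> (\<phi> ` A)" by (auto intro: generate_ring.incl)
  ultimately show "x \<in> gen A \<Longrightarrow> \<phi> x \<in> generate_ring \<Omega> (\<phi> ` A)" using gen_least by blast
qed

lemma alg_base_vimage:
  assumes K: "subfield K \<Omega>" and alg: "\<And>x. x \<in> carrier \<Omega> \<Longrightarrow> (algebraic over K) x"
  shows "alg_base (\<phi> -` K)"
  unfolding alg_base_def
proof (intro conjI allI)
  show "closed_field (\<phi> -` K)" by (rule subfield_vimage(1)[OF K])
  fix x
  obtain p where p: "p \<in> carrier (K[X])" "p \<noteq> []" "eval p (\<phi> x) = \<zero>"
    using algebraicE[OF subfieldE(1)[OF K] \<phi>_carrier alg[OF \<phi>_carrier]] by blast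
  have pK: "set p \<subseteq> K" "hd p \<noteq> \<zero>"
    using p by (auto simp: univ_poly_carrier[symmetric] polynomial_def)
  have "set p \<subseteq> range \<phi>" using pK(1) subfieldE(3)[OF K] bij by (auto simp: bij_betw_def)
  then obtain ps where ps: "p = map \<phi> ps" by (metis ex_map_conv subsetD rangeE)
  let ?p = "Poly (rev ps)"
  have psne: "ps \<noteq> []" using p ps by auto
  have "hd ps \<noteq> 0" using pK(2) psne by (auto simp: ps \<phi>_zero hd_map)
  moreover have "Polynomial.coeff ?p (length ps - 1) = hd ps"
    using psne by (cases ps) (auto simp: coeff_Poly_eq nth_default_def nth_append)
  ultimately have "Polynomial.coeff ?p (length ps - 1) \<noteq> 0" by (simp only: not_False_eq_True)
  then have "?p \<noteq> 0" by (metis Polynomial.coeff_0)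
  moreover have "Polynomial.coeff ?p i \<in> \<phi> -` K" for i
    using pK(1) subringE(2)[OF subfieldE(1)[OF K]]
    by (auto simp: ps coeff_Poly_eq nth_default_def \<phi>_zero image_subset_iff) (metis length_rev nth_mem set_rev)
  then have "?p \<in> polys (\<phi> -` K)" by (auto simp: polys_def)
  moreover have "poly ?p x = 0" using p(3) \<phi>_eval[of ps x] \<phi>_inj[of _ 0] by (simp add: ps \<phi>_zero)
  ultimately show "\<exists>p\<in>polys (\<phi> -` K). p \<noteq> 0 \<and> poly p x = 0" by blast
qed

context
  fixes v :: "'a \<Rightarrow> 'g::linordered_ab_group_add"
  assumes v: "valuation_on \<Omega> (carrier \<Omega>) v"
begin

lemma valuation_comp: "valuation (v \<circ> \<phi>)"
proof -
  have nz: "\<phi> x \<in> carrier \<Omega> - {\<zero>}" if "x \<noteq> 0" for x using that \<phi>_carrier by (auto simp: \<phi>_eq_zero)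
  have "v (\<phi> x \<otimes> \<phi> y) = v (\<phi> x) + v (\<phi> y) \<and>
      (\<phi> x \<oplus> \<phi> y \<noteq> \<zero> \<longrightarrow> min (v (\<phi> x)) (v (\<phi> y)) \<le> v (\<phi> x \<oplus> \<phi> y))" if "x \<noteq> 0" "y \<noteq> 0" for x y
    using v nz[OF that(1)] nz[OF that(2)] unfolding valuation_on_def by blast
  then show ?thesis unfolding valuation_def comp_apply \<phi>_add[symmetric] \<phi>_mult[symmetric] \<phi>_eq_zero by blast
qed

lemma val_ring_image: "val_ring \<Omega> (\<phi> ` A) v = \<phi> ` (A \<inter> valued_field.O\<^sub>v (v \<circ> \<phi>))"
  and val_ideal_image: "val_ideal \<Omega> (\<phi> ` A) v = \<phi> ` (A \<inter> valued_field.M\<^sub>v (v \<circ> \<phi>))"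
proof -
  interpret V: valued_field "v \<circ> \<phi>" by unfold_locales (rule valuation_comp)
  show "val_ring \<Omega> (\<phi> ` A) v = \<phi> ` (A \<inter> V.O\<^sub>v)" "val_ideal \<Omega> (\<phi> ` A) v = \<phi> ` (A \<inter> V.M\<^sub>v)"
    using \<phi>_inj[of _ 0] by (auto simp: val_ring_def val_ideal_def V.O\<^sub>v_def V.M\<^sub>v_def \<phi>_zero)
qed

end

end

text \<open>Valuations are carried in both directions, by composition with \<phi> and with its
  inverse. The group \<open>'g\<close> is the same on both sides, so the two quantifications over w
  match.\<close>

lemma (in typed_field) unique_extension_image:
  fixes v :: "'a \<Rightarrow> 'g::linordered_ab_group_add"
  shows "unique_extension \<Omega> v (\<phi> ` A) \<longleftrightarrow>
    (\<forall>w :: 'k \<Rightarrow> 'g. valuation w \<longrightarrow> (\<forall>x\<in>A. x \<noteq> 0 \<longrightarrow> w x = v (\<phi> x)) \<longrightarrow> (\<forall>x. x \<noteq> 0 \<longrightarrow> w x = v (\<phi> x)))"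
proof
  assume u: "unique_extension \<Omega> v (\<phi> ` A)"
  show "\<forall>w :: 'k \<Rightarrow> 'g. valuation w \<longrightarrow> (\<forall>x\<in>A. x \<noteq> 0 \<longrightarrow> w x = v (\<phi> x)) \<longrightarrow> (\<forall>x. x \<noteq> 0 \<longrightarrow> w x = v (\<phi> x))"
  proof (intro allI impI)
    fix w :: "'k \<Rightarrow> 'g" and x :: 'k
    assume w: "valuation w" and eq: "\<forall>x\<in>A. x \<noteq> 0 \<longrightarrow> w x = v (\<phi> x)" and x: "x \<noteq> 0"
    define \<psi> where "\<psi> = inv_into UNIV \<phi>"
    have \<psi>: "\<psi> (\<phi> x) = x" for x using bij by (auto simp: \<psi>_def bij_betw_def)
    have ex: "\<exists>b. a = \<phi> b" if "a \<in> carrier \<Omega>" for a using that bij by (auto simp: bij_betw_def)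
    have "valuation_on \<Omega> (carrier \<Omega>) (w \<circ> \<psi>)"
      unfolding valuation_on_def
    proof (intro ballI)
      fix a b assume ab: "a \<in> carrier \<Omega> - {\<zero>}" "b \<in> carrier \<Omega> - {\<zero>}"
      then obtain a' b' where a'b': "a = \<phi> a'" "b = \<phi> b'" "a' \<noteq> 0" "b' \<noteq> 0" using ex \<phi>_zero by blast
      show "(w \<circ> \<psi>) (a \<otimes> b) = (w \<circ> \<psi>) a + (w \<circ> \<psi>) b \<and>
        (a \<oplus> b \<noteq> \<zero> \<longrightarrow> min ((w \<circ> \<psi>) a) ((w \<circ> \<psi>) b) \<le> (w \<circ> \<psi>) (a \<oplus> b))"
        unfolding a'b'(1,2) comp_apply \<phi>_add[symmetric] \<phi>_mult[symmetric] \<phi>_eq_zero \<psi>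
        using w a'b'(3,4) unfolding valuation_def by blast
    qed
    moreover have "valuation_extends \<Omega> (\<phi> ` A) v (w \<circ> \<psi>)"
      using eq \<phi>_zero by (auto simp: valuation_extends_def \<psi>)
    moreover have "\<phi> x \<in> carrier \<Omega> - {\<zero>}" using x \<phi>_carrier by (simp add: \<phi>_eq_zero)
    ultimately have "(w \<circ> \<psi>) (\<phi> x) = v (\<phi> x)"
      using u unfolding unique_extension_def by blast
    then show "w x = v (\<phi> x)" by (simp add: \<psi>)
  qed
next
  assume u: "\<forall>w :: 'k \<Rightarrow> 'g. valuation w \<longrightarrow> (\<forall>x\<in>A. x \<noteq> 0 \<longrightarrow> w x = v (\<phi> x)) \<longrightarrow> (\<forall>x. x \<noteq> 0 \<longrightarrow> w x = v (\<phi> x))"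
  show "unique_extension \<Omega> v (\<phi> ` A)"
    unfolding unique_extension_def
  proof (intro allI impI ballI)
    fix w :: "'a \<Rightarrow> 'g" and x
    assume w: "valuation_on \<Omega> (carrier \<Omega>) w \<and> valuation_extends \<Omega> (\<phi> ` A) v w" and x: "x \<in> carrier \<Omega> - {\<zero>}"
    obtain y where y: "x = \<phi> y" "y \<noteq> 0" using x bij \<phi>_zero by (auto simp: bij_betw_def)
    have "valuation (w \<circ> \<phi>)" using w valuation_comp by blast
    moreover have "\<forall>x\<in>A. x \<noteq> 0 \<longrightarrow> (w \<circ> \<phi>) x = v (\<phi> x)"
      using w \<phi>_inj[of _ 0] by (auto simp: valuation_extends_def \<phi>_zero)
    ultimately have "(w \<circ> \<phi>) y = v (\<phi> y)" using u y(2) by blast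
    then show "w x = v x" by (simp add: y)
  qed
qed

lemma (in typed_field) \<phi>_list: "set us \<subseteq> \<phi> ` A \<Longrightarrow> \<exists>us'. us = map \<phi> us' \<and> set us' \<subseteq> A"
proof (induction us)
  case (Cons a us)
  then obtain us' a' where "us = map \<phi> us'" "set us' \<subseteq> A" "a = \<phi> a'" "a' \<in> A" by auto
  then show ?case by (intro exI[of _ "a' # us'"]) simp
qed simp

lemma (in typed_field) products_map:
  assumes "ys = map \<phi> ys'" "zs = map \<phi> zs'"
  shows "products \<Omega> ys zs = map \<phi> (map (\<lambda>n. ys' ! (n div length zs') * zs' ! (n mod length zs')) [0..<length ys' * length zs'])"
proof (rule nth_equalityI)
  fix n assume "n < length (products \<Omega> ys zs)"
  then have n: "n < length ys' * length zs'" by (simp add: products_def assms)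
  then have "0 < length zs'" by (metis length_0_conv length_greater_0_conv mult_0_right not_less0)
  then have "n mod length zs' < length zs'" "n div length zs' < length ys'"
    using n by (simp_all add: less_mult_imp_div_less)
  then show "products \<Omega> ys zs ! n = map \<phi> (map (\<lambda>n. ys' ! (n div length zs') * zs' ! (n mod length zs')) [0..<length ys' * length zs']) ! n"
    using n by (simp add: products_def assms product_nth \<phi>_mult)
qed (simp add: products_def assms)

lemma sum_div_mod:
  fixes f :: "nat \<Rightarrow> nat \<Rightarrow> nat \<Rightarrow> 'a::comm_monoid_add"
  shows "(\<Sum>n<a * b. f n (n div b) (n mod b)) = (\<Sum>i<a. \<Sum>j<b. f (i * b + j) i j)"
proof -
  have "(\<Sum>n<a * b. f n (n div b) (n mod b)) = (\<Sum>i<a. \<Sum>n\<in>{i * b..<i * b + b}. f n (n div b) (n mod b))"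
    by (rule sum.nat_group[symmetric])
  also have "\<dots> = (\<Sum>i<a. \<Sum>j<b. f (i * b + j) i j)"
  proof (rule sum.cong[OF HOL.refl])
    fix i
    have "(\<Sum>n\<in>{i * b..<i * b + b}. f n (n div b) (n mod b)) = (\<Sum>j\<in>{0..<b}. f (j + i * b) ((j + i * b) div b) ((j + i * b) mod b))"
      using sum.shift_bounds_nat_ivl[of "\<lambda>n. f n (n div b) (n mod b)" 0 "i * b" b] by (simp add: add.commute)
    also have "\<dots> = (\<Sum>j<b. f (i * b + j) i j)"
      unfolding atLeast0LessThan by (intro sum.cong) (auto simp: add.commute)
    finally show "(\<Sum>n\<in>{i * b..<i * b + b}. f n (n div b) (n mod b)) = (\<Sum>j<b. f (i * b + j) i j)" .
  qed
  finally show ?thesis .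
qed

text \<open>H is the image of the Hensel closure: it extends v uniquely because it is Hensel closed,
  and it is least because every field with unique extension is Hensel closed. The remaining clauses
  are \<open>standard_basis_value\<close> and \<open>fin_gen_of_integral_basis\<close> for lists,
  the pair (i, j) being stored at index i * e + j.\<close>

lemma henselian_structure_typed:
  fixes \<Omega> :: "('a, 'm) ring_scheme" and \<phi> :: "'k::alg_closed_field \<Rightarrow> 'a"
    and v :: "'a \<Rightarrow> 'g::linordered_ab_group_add"
  assumes typed: "typed_field \<Omega> \<phi>" and v: "valuation_on \<Omega> (carrier \<Omega>) v"
    and K: "subfield K \<Omega>" and alg: "\<And>x. x \<in> carrier \<Omega> \<Longrightarrow> (ring.algebraic \<Omega> over K) x"
  shows "henselian_structure \<Omega> v K"
proof -
  interpret typed_field \<Omega> \<phi> by (rule typed)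
  interpret V: valued_alg_closed "v \<circ> \<phi>" by unfold_locales (rule valuation_comp[OF v])
  define K' where "K' = \<phi> -` K"
  have K': "alg_base K'" "\<phi> ` K' = K"
    unfolding K'_def using alg_base_vimage[OF K alg] subfield_vimage(2)[OF K] by auto
  define H' where "H' = V.hensel_closure K'"
  have H': "alg_base H'" "closed_field H'" "K' \<subseteq> H'"
    unfolding H'_def using V.alg_base_hensel_closure[OF K'(1)] V.closed_field_hensel_closure[OF K'(1)]
      V.hensel_closure_incl[OF K'(1)] by auto
  have uniq: "unique_extension \<Omega> v (\<phi> ` A) \<longleftrightarrow> V.uniquely_extending A" for A
    unfolding unique_extension_image V.uniquely_extending_def by simp
  have least: "\<phi> ` H' \<subseteq> F" if F: "subfield F \<Omega>" "K \<subseteq> F" "unique_extension \<Omega> v F" for F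
  proof -
    have F': "closed_field (\<phi> -` F)" "\<phi> ` (\<phi> -` F) = F" by (rule subfield_vimage[OF F(1)])+
    have KF: "K' \<subseteq> \<phi> -` F" using F(2) by (auto simp: K'_def)
    have "V.hensel_closed (\<phi> -` F)"
      using V.uniquely_extending_imp_hensel_closed[OF alg_base_mono[OF K'(1) KF F'(1)]] uniq[of "\<phi> -` F"] F(3) F'(2) by simp
    then have "H' \<subseteq> \<phi> -` F" unfolding H'_def using V.hensel_closure_least[OF K'(1) F'(1) KF] by blast
    then show ?thesis by auto
  qed
  have uH: "unique_extension \<Omega> v (\<phi> ` H')"
    unfolding uniq H'_def
    using V.hensel_closed_imp_uniquely_extending[OF V.alg_base_hensel_closure[OF K'(1)] V.hensel_closed_hensel_closure[OF K'(1)]] .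
  have main: "(\<forall>Ks. set Ks \<subseteq> \<phi> ` H' \<and> length Ks = length (products \<Omega> ys zs) \<and>
        combine Ks (products \<Omega> ys zs) = \<zero>\<^bsub>\<Omega>\<^esub> \<longrightarrow> set Ks \<subseteq> {\<zero>\<^bsub>\<Omega>\<^esub>}) \<and>
      (set xs \<subseteq> L \<and> L \<subseteq> list_span \<Omega> K xs \<and> L \<subseteq> list_span \<Omega> (\<phi> ` H') (products \<Omega> ys zs)
        \<longrightarrow> localized_fin_gen \<Omega> v K L)"
    if L: "subfield L \<Omega>" "K \<subseteq> L" and std: "standard_family \<Omega> v K L ys zs" for L ys zs xs
  proof -
    define L' where "L' = \<phi> -` L"
    have L': "closed_field L'" "\<phi> ` L' = L" "K' \<subseteq> L'"
      unfolding L'_def K'_def using subfield_vimage[OF L(1)] L(2) by auto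
    note LR = closed_field_ring[OF L'(1)]
    have rings: "val_ring \<Omega> L v = \<phi> ` (L' \<inter> V.O\<^sub>v)" "val_ideal \<Omega> L v = \<phi> ` (L' \<inter> V.M\<^sub>v)" "val_ring \<Omega> K v = \<phi> ` (K' \<inter> V.O\<^sub>v)"
      using val_ring_image[OF v, of L'] val_ideal_image[OF v, of L'] val_ring_image[OF v, of K'] L'(2) K'(2) by simp_all
    have stdD: "set ys \<subseteq> val_ring \<Omega> L v" "set zs \<subseteq> val_ring \<Omega> L v - {\<zero>\<^bsub>\<Omega>\<^esub>}"
      "\<And>Ks. set Ks \<subseteq> val_ring \<Omega> K v \<Longrightarrow> length Ks = length ys \<Longrightarrow> combine Ks ys \<in> val_ideal \<Omega> L v \<Longrightarrow> set Ks \<subseteq> val_ideal \<Omega> L v"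
      "distinct (map v zs)" "\<And>z k. z \<in> set zs \<Longrightarrow> k \<in> K \<Longrightarrow> k \<noteq> \<zero>\<^bsub>\<Omega>\<^esub> \<Longrightarrow> 0 < v k \<Longrightarrow> v z < v k"
      using std unfolding standard_family_def by auto
    obtain ys' where ys': "ys = map \<phi> ys'" "set ys' \<subseteq> L' \<inter> V.O\<^sub>v" using \<phi>_list stdD(1) unfolding rings by blast
    have "set zs \<subseteq> \<phi> ` (L' \<inter> V.O\<^sub>v - {0})" 
    proof
      fix a assume "a \<in> set zs"
      then obtain a' where a': "a = \<phi> a'" "a' \<in> L' \<inter> V.O\<^sub>v" "a \<noteq> \<zero>\<^bsub>\<Omega>\<^esub>"
        using stdD(2) unfolding rings by blast
      then have "a' \<noteq> 0" using \<phi>_zero by auto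
      then show "a \<in> \<phi> ` (L' \<inter> V.O\<^sub>v - {0})" unfolding a'(1) using a'(2) by (intro imageI) simp
    qed
    then obtain zs' where zs': "zs = map \<phi> zs'" "set zs' \<subseteq> L' \<inter> V.O\<^sub>v - {0}" using \<phi>_list by blast
    define f where "f = length ys'"
    define e where "e = length zs'"
    define y where "y i = ys' ! i" for i
    define z where "z j = zs' ! j" for j
    define b where "b n = y (n div e) * z (n mod e)" for n
    have prods: "products \<Omega> ys zs = map \<phi> (map b [0..<f * e])"
      unfolding products_map[OF ys'(1) zs'(1)] by (simp add: b_def[abs_def] f_def e_def y_def z_def)
    have y: "y i \<in> L'" "y i \<in> V.O\<^sub>v" if "i < f" for i using subsetD[OF ys'(2), of "y i"] that by (simp_all add: y_def f_def)
    have z: "z j \<in> L'" "z j \<in> V.O\<^sub>v" "z j \<noteq> 0" if "j < e" for j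
      using subsetD[OF zs'(2), of "z j"] that by (simp_all add: z_def e_def)
    have zv: "z j \<noteq> 0 \<and> 0 \<le> (v \<circ> \<phi>) (z j)" if "j < e" for j using z[OF that] by (auto simp: V.O\<^sub>v_def)
    have zinj: "inj_on ((v \<circ> \<phi>) \<circ> z) {..<e}"
      using stdD(4) by (auto simp: zs'(1) distinct_conv_nth inj_on_def e_def z_def)
    have small: "(v \<circ> \<phi>) (z j) < (v \<circ> \<phi>) k" if "j < e" "k \<in> K'" "k \<noteq> 0" "0 < (v \<circ> \<phi>) k" for j k
      using stdD(5)[of "\<phi> (z j)" "\<phi> k"] that by (simp add: zs'(1) e_def z_def K'_def \<phi>_eq_zero)
    have indep: "\<forall>i<f. d i \<in> V.M\<^sub>v" if d: "\<forall>i<f. d i \<in> K' \<inter> V.O\<^sub>v" "(\<Sum>i<f. d i * y i) \<in> V.M\<^sub>v" for d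
    proof -
      let ?Ks = "map \<phi> (map d [0..<f])"
      have "combine ?Ks ys = \<phi> (\<Sum>i<f. d i * y i)"
        unfolding ys'(1) by (subst \<phi>_combine) (auto simp: f_def y_def intro!: arg_cong[of _ _ \<phi>] sum.cong)
      moreover have "(\<Sum>i<f. d i * y i) \<in> L'"
        using d(1) L'(3) y(1) by (intro closed_ring_sum[OF LR] closed_ring_mult[OF LR]) auto
      ultimately have "combine ?Ks ys \<in> val_ideal \<Omega> L v" using d(2) unfolding rings by blast
      moreover have "set ?Ks \<subseteq> val_ring \<Omega> K v" using d(1) unfolding rings by auto
      ultimately have "set ?Ks \<subseteq> val_ideal \<Omega> L v" using stdD(3)[of ?Ks] by (simp add: ys'(1) f_def)
      then have "\<phi> (d i) \<in> \<phi> ` (L' \<inter> V.M\<^sub>v)" if "i < f" for i using that unfolding rings by auto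
      then show ?thesis unfolding \<phi>_image_iff by blast
    qed
    have imm: "V.immediate K' H'" unfolding H'_def by (rule V.immediate_hensel_closure[OF K'(1)])
    have basis: "(\<Sum>i<f. \<Sum>j<e. c i j * (y i * z j)) \<noteq> 0"
      "(\<Sum>i<f. \<Sum>j<e. c i j * (y i * z j)) \<in> V.O\<^sub>v \<Longrightarrow> c i1 j1 \<in> V.O\<^sub>v"
      if c: "\<And>i j. i < f \<Longrightarrow> j < e \<Longrightarrow> c i j \<in> H'" "i1 < f" "j1 < e" "c i1 j1 \<noteq> 0" for c i1 j1
    proof -
      note K'_field = alg_base_field[OF K'(1)]
      note facts = K'_field H'(2) imm zinj c(2-4)
      show "(\<Sum>i<f. \<Sum>j<e. c i j * (y i * z j)) \<noteq> 0"
        by (rule V.standard_basis_value(1)[of K' H' f y e z c i1 j1];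
            (rule facts | (rule y(2) indep zv small c(1); assumption)))
      show "c i1 j1 \<in> V.O\<^sub>v" if "(\<Sum>i<f. \<Sum>j<e. c i j * (y i * z j)) \<in> V.O\<^sub>v"
        by (rule V.standard_basis_value(2)[of K' H' f y e z c i1 j1];
            (rule facts that | (rule y(2) indep zv small c(1); assumption)))
    qed
    have comb: "(\<Sum>n<f * e. c n * b n) = (\<Sum>i<f. \<Sum>j<e. c (i * e + j) * (y i * z j))" for c
      unfolding b_def by (rule sum_div_mod)
    have idx: "n div e < f" "n mod e < e" "(n div e) * e + n mod e = n" if "n < f * e" for n
    proof -
      have "0 < e" using that by (cases e) auto
      then show "n div e < f" "n mod e < e" "(n div e) * e + n mod e = n" using that by (auto simp: less_mult_imp_div_less)
    qed
    have idx2: "i * e + j < f * e" if "i < f" "j < e" for i j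
    proof -
      have "i * e + j < Suc i * e" using that by simp
      also have "\<dots> \<le> f * e" using that by (intro mult_right_mono) auto
      finally show ?thesis .
    qed
    have part1: "set Ks \<subseteq> {\<zero>\<^bsub>\<Omega>\<^esub>}"
      if Ks: "set Ks \<subseteq> \<phi> ` H'" "length Ks = length (products \<Omega> ys zs)" "combine Ks (products \<Omega> ys zs) = \<zero>\<^bsub>\<Omega>\<^esub>" for Ks
    proof -
      obtain ks where ks: "Ks = map \<phi> ks" "set ks \<subseteq> H'" using \<phi>_list[OF Ks(1)] by blast
      have len: "length ks = f * e" using Ks(2) by (simp add: ks prods)
      have "combine Ks (products \<Omega> ys zs) = \<phi> (\<Sum>n<f * e. ks ! n * b n)"
        unfolding ks(1) prods by (subst \<phi>_combine) (auto simp: len intro!: arg_cong[of _ _ \<phi>] sum.cong)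
      then have zero: "(\<Sum>n<f * e. ks ! n * b n) = 0" using Ks(3) \<phi>_eq_zero by metis
      have kH: "ks ! (i * e + j) \<in> H'" if "i < f" "j < e" for i j
        using subsetD[OF ks(2), of "ks ! (i * e + j)"] idx2[OF that] by (simp add: len)
      have "ks ! n = 0" if n: "n < f * e" for n
      proof (rule ccontr)
        assume "ks ! n \<noteq> 0"
        then have "ks ! ((n div e) * e + n mod e) \<noteq> 0" by (simp only: idx(3)[OF n] not_False_eq_True)
        from basis(1)[of "\<lambda>i j. ks ! (i * e + j)" "n div e" "n mod e", OF kH idx(1,2)[OF n] this] show False
          using zero unfolding comb by blast
      qed
      then show ?thesis by (auto simp: ks(1) len in_set_conv_nth \<phi>_zero)
    qed
    have part2: "localized_fin_gen \<Omega> v K L"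
      if xs: "set xs \<subseteq> L" "L \<subseteq> list_span \<Omega> K xs" and sp: "L \<subseteq> list_span \<Omega> (\<phi> ` H') (products \<Omega> ys zs)"
    proof -
      obtain xs' where xs': "xs = map \<phi> xs'" "set xs' \<subseteq> L'" using \<phi>_list[of xs L'] xs(1) L'(2) by auto
      have "V.frac_fin_gen (K' \<inter> V.O\<^sub>v) (L' \<inter> V.O\<^sub>v)"
      proof (rule V.fin_gen_of_integral_basis[OF K'(1) L'(1,3)])
        show "xs' ! l \<in> L'" if "l < length xs'" for l using subsetD[OF xs'(2), of "xs' ! l"] that by simp
        show "b n \<in> L' \<inter> V.O\<^sub>v" if "n < f * e" for n
          using y z idx[OF that] unfolding b_def
          by (auto intro!: closed_ring_mult[OF LR] closed_ring_mult[OF V.closed_ring_O])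
      next
        fix x assume "x \<in> L'"
        then have "\<phi> x \<in> L" using L'(2) by auto
        then obtain Ks where Ks: "set Ks \<subseteq> \<phi> ` K'" "length Ks = length xs" "\<phi> x = combine Ks xs"
          using xs(2) K'(2) unfolding list_span_def by blast
        obtain ks where ks: "Ks = map \<phi> ks" "set ks \<subseteq> K'" using \<phi>_list[OF Ks(1)] by blast
        have "x = (\<Sum>l<length xs'. ks ! l * xs' ! l)"
          using Ks(2,3) by (simp add: ks xs' \<phi>_combine \<phi>_inj)
        moreover have "ks ! l \<in> K'" if "l < length xs'" for l
          using Ks(2) subsetD[OF ks(2), of "ks ! l"] that by (simp add: ks(1) xs'(1))
        ultimately show "\<exists>k. (\<forall>l<length xs'. k l \<in> K') \<and> x = (\<Sum>l<length xs'. k l * xs' ! l)"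
          by (intro exI[of _ "\<lambda>l. ks ! l"]) auto
      next
        fix x assume "x \<in> L'"
        then have "\<phi> x \<in> L" using L'(2) by auto
        then obtain Ks where Ks: "set Ks \<subseteq> \<phi> ` H'" "length Ks = length (products \<Omega> ys zs)" "\<phi> x = combine Ks (products \<Omega> ys zs)"
          using sp unfolding list_span_def by blast
        obtain ks where ks: "Ks = map \<phi> ks" "set ks \<subseteq> H'" using \<phi>_list[OF Ks(1)] by blast
        have len: "length ks = f * e" using Ks(2) by (simp add: ks prods)
        have "combine Ks (products \<Omega> ys zs) = \<phi> (\<Sum>n<f * e. ks ! n * b n)"
          unfolding ks(1) prods by (subst \<phi>_combine) (auto simp: len intro!: arg_cong[of _ _ \<phi>] sum.cong)
        then have "x = (\<Sum>n<f * e. ks ! n * b n)" using Ks(3) by (simp add: \<phi>_inj)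
        moreover have "ks ! n \<in> H'" if "n < f * e" for n using subsetD[OF ks(2), of "ks ! n"] that len by simp
        ultimately show "\<exists>c. (\<forall>n<f * e. c n \<in> V.hensel_closure K') \<and> x = (\<Sum>n<f * e. c n * b n)"
          unfolding H'_def by (intro exI[of _ "\<lambda>n. ks ! n"]) auto
      next
        fix c assume c: "\<forall>n<f * e. c n \<in> V.hensel_closure K'" "(\<Sum>n<f * e. c n * b n) \<in> V.O\<^sub>v"
        have cH: "c (i * e + j) \<in> H'" if "i < f" "j < e" for i j using c(1) idx2[OF that] by (simp add: H'_def)
        show "\<forall>n<f * e. c n \<in> V.O\<^sub>v"
        proof (intro allI impI)
          fix n assume n: "n < f * e"
          show "c n \<in> V.O\<^sub>v"
          proof (cases "c n = 0")
            case False
            then have "c ((n div e) * e + n mod e) \<noteq> 0" by (simp only: idx(3)[OF n] not_False_eq_True)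
            from basis(2)[of "\<lambda>i j. c (i * e + j)" "n div e" "n mod e", OF cH idx(1,2)[OF n] this] show ?thesis
              using c(2) unfolding comb idx(3)[OF n] by blast
          qed (simp add: closed_ring_zero[OF V.closed_ring_O])
        qed
      qed
      then obtain G where G: "finite G" "G \<subseteq> L' \<inter> V.O\<^sub>v" "L' \<inter> V.O\<^sub>v \<subseteq> V.frac (gen (K' \<inter> V.O\<^sub>v \<union> G))"
        by (auto simp: V.frac_fin_gen_def)
      show ?thesis
        unfolding localized_fin_gen_def rings
      proof (intro exI[of _ "\<phi> ` G"] conjI ballI)
        fix w assume "w \<in> \<phi> ` (L' \<inter> V.O\<^sub>v)"
        then obtain w' where w': "w = \<phi> w'" "w' \<in> V.frac (gen (K' \<inter> V.O\<^sub>v \<union> G))" using G(3) by blast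
        then obtain s where s: "s \<in> gen (K' \<inter> V.O\<^sub>v \<union> G)" "s \<notin> V.M\<^sub>v" "s * w' \<in> gen (K' \<inter> V.O\<^sub>v \<union> G)"
          by (auto simp: V.frac_def)
        have "\<phi> s \<notin> \<phi> ` (L' \<inter> V.M\<^sub>v)" using s(2) by (auto simp: \<phi>_inj)
        then show "\<exists>s\<in>generate_ring \<Omega> (\<phi> ` (K' \<inter> V.O\<^sub>v) \<union> \<phi> ` G). s \<notin> \<phi> ` (L' \<inter> V.M\<^sub>v) \<and>
            s \<otimes>\<^bsub>\<Omega>\<^esub> w \<in> generate_ring \<Omega> (\<phi> ` (K' \<inter> V.O\<^sub>v) \<union> \<phi> ` G)"
          using gen_image[OF s(1)] gen_image[OF s(3)] unfolding w'(1) image_Un \<phi>_mult by blast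
      qed (use G in auto)
    qed
    show ?thesis using part1 part2 by blast
  qed
  show ?thesis
    unfolding henselian_structure_def
  proof (intro exI[of _ "\<phi> ` H'"] conjI)
    show "subfield (\<phi> ` H') \<Omega>" by (rule subfield_image[OF H'(2)])
    show "K \<subseteq> \<phi> ` H'" using image_mono[OF H'(3), of \<phi>] unfolding K'(2) .
    show "unique_extension \<Omega> v (\<phi> ` H')" by (rule uH)
    show "\<forall>F. subfield F \<Omega> \<and> K \<subseteq> F \<and> unique_extension \<Omega> v F \<longrightarrow> \<phi> ` H' \<subseteq> F"
      by (intro allI impI, elim conjE) (rule least)
  qed (intro allI impI, elim conjE, rule main)
qed

section \<open>Algebraic closedness for types and isomorphic copies\<close>

lemma typed_field_of_type: "typed_field (ring_of_type_algebra :: 'k::field ring) id"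
proof -
  interpret field "ring_of_type_algebra :: 'k ring" by (rule field_from_type_algebra)
  show ?thesis by unfold_locales (auto simp: ring_of_type_algebra_def)
qed

lemma root_closed_of_type: "root_closed (ring_of_type_algebra :: 'k::alg_closed_field ring)"
  unfolding root_closed_def
proof (intro allI impI)
  interpret typed_field "ring_of_type_algebra :: 'k ring" id by (rule typed_field_of_type)
  fix cs :: "'k list" assume cs: "set cs \<subseteq> carrier ring_of_type_algebra \<and> cs \<noteq> []"
  have p: "Poly (rev (1 # cs)) = Poly (rev cs) + Polynomial.monom 1 (length cs)" by (simp add: Poly_snoc)
  have "Polynomial.coeff (Poly (rev (1 # cs))) (length cs) = 1"
    by (simp add: coeff_Poly_eq nth_default_def nth_append)
  then have "length cs \<le> Polynomial.degree (Poly (rev (1 # cs)))" by (intro le_degree) simp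
  then obtain x where "poly (Poly (rev (1 # cs))) x = 0"
    using alg_closed_imp_poly_has_root[of "Poly (rev (1 # cs))"] cs by fastforce
  then show "\<exists>x\<in>carrier ring_of_type_algebra. eval (\<one>\<^bsub>ring_of_type_algebra\<^esub> # cs) x = \<zero>\<^bsub>ring_of_type_algebra\<^esub>"
    using \<phi>_eval[of "1 # cs" x] by (intro bexI[of _ x]) (auto simp: ring_of_type_algebra_def)
qed

lemma root_closed_image:
  assumes R: "field R" "root_closed R" and f: "inj_on f (carrier R)"
  shows "root_closed (image_ring f R)"
  unfolding root_closed_def
proof (intro allI impI)
  have iso: "f \<in> ring_iso R (image_ring f R)" by (rule inj_imp_image_ring_iso[OF f])
  interpret R: field R by (rule R(1))
  interpret I: field "image_ring f R" by (rule R.inj_imp_image_ring_is_field[OF f])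
  interpret h: ring_hom_ring R "image_ring f R" f
    using iso by (intro ring_hom_ringI2 R.ring_axioms I.ring_axioms) (simp add: ring_iso_def)
  fix cs assume cs: "set cs \<subseteq> carrier (image_ring f R) \<and> cs \<noteq> []"
  then have im: "c \<in> f ` carrier R" if "c \<in> set cs" for c using that unfolding image_ring_carrier by auto
  define ds where "ds = map (inv_into (carrier R) f) cs"
  have ds: "cs = map f ds" "set ds \<subseteq> carrier R"
    unfolding ds_def using im by (auto simp: f_inv_into_f inv_into_into intro!: nth_equalityI)
  then obtain x where x: "x \<in> carrier R" "R.eval (\<one>\<^bsub>R\<^esub> # ds) x = \<zero>\<^bsub>R\<^esub>"
    using R(2) cs unfolding root_closed_def by blast
  have "I.eval (map f (\<one>\<^bsub>R\<^esub> # ds)) (f x) = f \<zero>\<^bsub>R\<^esub>"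
    using h.eval_hom'[of x "\<one>\<^bsub>R\<^esub> # ds"] x ds(2) by simp
  then show "\<exists>x\<in>carrier (image_ring f R). I.eval (\<one>\<^bsub>image_ring f R\<^esub> # cs) x = \<zero>\<^bsub>image_ring f R\<^esub>"
    using x(1) by (intro bexI[of _ "f x"]) (simp_all add: ds(1))
qed

lemma (in algebraically_closed) root_closed: "root_closed L"
  unfolding root_closed_def
proof (intro allI impI)
  fix cs assume cs: "set cs \<subseteq> carrier L \<and> cs \<noteq> []"
  let ?p = "\<one> # cs"
  have p: "?p \<in> carrier (poly_ring L)" using cs by (simp add: univ_poly_carrier[symmetric] polynomial_def)
  have "size (roots ?p) = length cs" using roots_over_carrier[OF p] by (simp add: splitted_def)
  then have "roots ?p \<noteq> {#}" using cs by auto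
  then obtain a where "a \<in># roots ?p" by auto
  then have "is_root ?p a" using roots_mem_iff_is_root[OF p] by simp
  then show "\<exists>x\<in>carrier L. eval ?p x = \<zero>" by (auto simp: is_root_def)
qed

text \<open>To apply results about the class \<open>alg_closed_field\<close> to an arbitrary algebraically closed field,
  suppose that \<open>henselian_structure\<close> fails for some field. A type cannot depend on that field, but
  it can depend on a choice of one field violating the claim, with the complex numbers as default.
  The claim for this type then gives a contradiction.\<close>

definition counterexample :: "'g
::linordered_ab_group_add itself \<Rightarrow> ('a, 'm) ring_scheme \<Rightarrow> bool"
  where "counterexample _ R \<longleftrightarrow> field R \<and> root_closed R \<and>
    (\<exists>(v :: 'a \<Rightarrow> 'g) K. valuation_on R (carrier R) v \<and> subfield K R \<and>
      (\<forall>x \<in> carrier R. (ring.algebraic R over K) x) \<and> \<not> henselian_structure R v K)"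

text \<open>The sum type gives both alternatives, the chosen field and the complex numbers, a
  carrier in the same type.\<close>

definition model_ring ::
    "('a, 'm) ring_scheme itself \<Rightarrow> 'g::linordered_ab_group_add itself \<Rightarrow> ('a + complex) ring"
  where "model_ring _ _ =
    (if \<exists>R :: ('a, 'm) ring_scheme. counterexample TYPE('g) R
     then image_ring Inl (SOME R :: ('a, 'm) ring_scheme. counterexample TYPE('g) R)
     else image_ring Inr (ring_of_type_algebra :: complex ring))"

lemma
  fixes a :: "('a, 'm) ring_scheme itself" and g :: "'g::linordered_ab_group_add itself"
  shows field_model_ring: "field (model_ring a g)" and root_closed_model_ring: "root_closed (model_ring a g)"
proof -
  have "field (model_ring a g) \<and> root_closed (model_ring a g)"
  proof (cases "\<exists>R :: ('a, 'm) ring_scheme. counterexample TYPE('g) R")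
    case True
    define R0 where "R0 = (SOME R :: ('a, 'm) ring_scheme. counterexample TYPE('g) R)"
    have "counterexample TYPE('g) R0" unfolding R0_def by (rule someI_ex[OF True])
    then have "field R0" "root_closed R0" by (simp_all add: counterexample_def)
    moreover have "model_ring a g = image_ring Inl R0" using True by (simp add: model_ring_def R0_def)
    ultimately show ?thesis
      using field.inj_imp_image_ring_is_field[of R0 Inl] root_closed_image[of R0 Inl] by simp
  next
    case False
    then have "model_ring a g = image_ring Inr (ring_of_type_algebra :: complex ring)" by (simp add: model_ring_def)
    then show ?thesis
      using field.inj_imp_image_ring_is_field[OF field_from_type_algebra, of Inr]
        root_closed_image[OF field_from_type_algebra root_closed_of_type, of Inr] by simp
  qed
  then show "field (model_ring a g)" "root_closed (model_ring a g)" by auto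
qed

typedef (overloaded) ('a, 'm, 'g) model =
  "carrier (model_ring TYPE(('a, 'm) ring_scheme) TYPE('g::linordered_ab_group_add))"
proof -
  interpret field "model_ring TYPE(('a, 'm) ring_scheme) TYPE('g)" by (rule field_model_ring)
  show ?thesis using zero_closed by blast
qed

instantiation model :: (type, type, linordered_ab_group_add) field
begin

definition "0 = Abs_model \<zero>\<^bsub>model_ring TYPE(('a, 'b) ring_scheme) TYPE('c)\<^esub>"
definition "1 = Abs_model \<one>\<^bsub>model_ring TYPE(('a, 'b) ring_scheme) TYPE('c)\<^esub>"
definition "x + y = Abs_model (Rep_model x \<oplus>\<^bsub>model_ring TYPE(('a, 'b) ring_scheme) TYPE('c)\<^esub> Rep_model y)"
  for x :: "('a, 'b, 'c) model"
definition "x * y = Abs_model (Rep_model x \<otimes>\<^bsub>model_ring TYPE(('a, 'b) ring_scheme) TYPE('c)\<^esub> Rep_model y)"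
  for x :: "('a, 'b, 'c) model"
definition "- x = Abs_model (\<ominus>\<^bsub>model_ring TYPE(('a, 'b) ring_scheme) TYPE('c)\<^esub> Rep_model x)"
  for x :: "('a, 'b, 'c) model"
definition "x - y = x + (- y)" for x :: "('a, 'b, 'c) model"
definition "inverse x = (if x = 0 then 0 else Abs_model (inv\<^bsub>model_ring TYPE(('a, 'b) ring_scheme) TYPE('c)\<^esub> Rep_model x))"
  for x :: "('a, 'b, 'c) model"
definition "x div y = x * inverse y" for x :: "('a, 'b, 'c) model"

context
begin

interpretation M: field "model_ring TYPE(('a, 'b) ring_scheme) TYPE('c)" by (rule field_model_ring)

lemma Rep_model_ops:
  fixes x y :: "('a, 'b, 'c) model"
  shows "Rep_model (0 :: ('a, 'b, 'c) model) = \<zero>\<^bsub>model_ring TYPE(('a, 'b) ring_scheme) TYPE('c)\<^esub>"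
    and "Rep_model (1 :: ('a, 'b, 'c) model) = \<one>\<^bsub>model_ring TYPE(('a, 'b) ring_scheme) TYPE('c)\<^esub>"
    and "Rep_model (x + y) = Rep_model x \<oplus>\<^bsub>model_ring TYPE(('a, 'b) ring_scheme) TYPE('c)\<^esub> Rep_model y"
    and "Rep_model (x * y) = Rep_model x \<otimes>\<^bsub>model_ring TYPE(('a, 'b) ring_scheme) TYPE('c)\<^esub> Rep_model y"
    and "Rep_model (- x) = \<ominus>\<^bsub>model_ring TYPE(('a, 'b) ring_scheme) TYPE('c)\<^esub> Rep_model x"
  using Rep_model[of x] Rep_model[of y]
  by (auto simp: zero_model_def one_model_def plus_model_def times_model_def uminus_model_def Abs_model_inverse)

instance
proof
  fix x y z :: "('a, 'b, 'c) model"
  note R = Rep_model[of x] Rep_model[of y] Rep_model[of z]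
  show "x + y + z = x + (y + z)"
    unfolding Rep_model_inject[symmetric] Rep_model_ops by (rule M.a_assoc[OF R])
  show "x + y = y + x"
    unfolding Rep_model_inject[symmetric] Rep_model_ops by (rule M.a_comm[OF R(1,2)])
  show "0 + x = x"
    unfolding Rep_model_inject[symmetric] Rep_model_ops by (rule M.l_zero[OF R(1)])
  show "- x + x = 0"
    unfolding Rep_model_inject[symmetric] Rep_model_ops by (rule M.l_neg[OF R(1)])
  show "x * y * z = x * (y * z)"
    unfolding Rep_model_inject[symmetric] Rep_model_ops by (rule M.m_assoc[OF R])
  show "x * y = y * x"
    unfolding Rep_model_inject[symmetric] Rep_model_ops by (rule M.m_comm[OF R(1,2)])
  show "1 * x = x"
    unfolding Rep_model_inject[symmetric] Rep_model_ops by (rule M.l_one[OF R(1)])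
  show "(x + y) * z = x * z + y * z"
    unfolding Rep_model_inject[symmetric] Rep_model_ops by (rule M.l_distr[OF R])
  show "0 \<noteq> (1 :: ('a, 'b, 'c) model)"
    unfolding Rep_model_inject[symmetric] Rep_model_ops using M.one_not_zero by simp
  show "x - y = x + - y" "x div y = x * inverse y" by (simp_all add: minus_model_def divide_model_def)
  show "inverse (0 :: ('a, 'b, 'c) model) = 0" by (simp add: inverse_model_def)
  show "inverse x * x = 1" if "x \<noteq> 0"
  proof -
    have "Rep_model x \<noteq> \<zero>\<^bsub>model_ring TYPE(('a, 'b) ring_scheme) TYPE('c)\<^esub>"
      using that unfolding Rep_model_inject[symmetric] Rep_model_ops .
    then have "Rep_model x \<in> Units (model_ring TYPE(('a, 'b) ring_scheme) TYPE('c))"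
      using R(1) by (simp add: M.field_Units)
    then have "Rep_model (inverse x) = inv\<^bsub>model_ring TYPE(('a, 'b) ring_scheme) TYPE('c)\<^esub> Rep_model x"
      and "inv\<^bsub>model_ring TYPE(('a, 'b) ring_scheme) TYPE('c)\<^esub> Rep_model x \<otimes>\<^bsub>model_ring TYPE(('a, 'b) ring_scheme) TYPE('c)\<^esub> Rep_model x = \<one>\<^bsub>model_ring TYPE(('a, 'b) ring_scheme) TYPE('c)\<^esub>"
      using that by (simp_all add: inverse_model_def Abs_model_inverse)
    then show ?thesis unfolding Rep_model_inject[symmetric] Rep_model_ops by simp
  qed
qed

end

end

lemma typed_field_model:
  "typed_field (model_ring TYPE(('a, 'm) ring_scheme) TYPE('g::linordered_ab_group_add)) (Rep_model :: ('a, 'm, 'g) model \<Rightarrow> _)"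
proof -
  interpret field "model_ring TYPE(('a, 'm) ring_scheme) TYPE('g)" by (rule field_model_ring)
  show ?thesis
  proof unfold_locales
    show "bij_betw (Rep_model :: ('a, 'm, 'g) model \<Rightarrow> _) UNIV (carrier (model_ring TYPE(('a, 'm) ring_scheme) TYPE('g)))"
      using type_definition.Rep_range[OF type_definition_model]
      by (auto simp: bij_betw_def inj_on_def Rep_model_inject)
  qed (simp_all add: Rep_model_ops)
qed

instance model :: (type, type, linordered_ab_group_add) alg_closed_field
proof
  fix p :: "('a, 'b, 'c) model poly" assume p: "Polynomial.degree p > 0" "Polynomial.lead_coeff p = 1"
  interpret typed_field "model_ring TYPE(('a, 'b) ring_scheme) TYPE('c)" "Rep_model :: ('a, 'b, 'c) model \<Rightarrow> _"
    by (rule typed_field_model)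
  have "p \<noteq> 0" using p by auto
  then have "coeffs p \<noteq> []" "last (coeffs p) = 1" using p(2) by (simp_all add: last_coeffs_eq_coeff_degree)
  \<comment> \<open>The coefficients of p in ascending order without the leading 1; they are
    reversed below because \<open>root_closed\<close> expects descending order.\<close>
  then obtain ds where ds: "coeffs p = ds @ [1]" by (metis append_butlast_last_id)
  have "length (coeffs p) = Suc (Polynomial.degree p)" using \<open>p \<noteq> 0\<close> by (simp add: length_coeffs_degree)
  then have "ds \<noteq> []" using p(1) ds by auto
  then have "\<exists>z\<in>carrier (model_ring TYPE(('a, 'b) ring_scheme) TYPE('c)). eval (\<one>\<^bsub>model_ring TYPE(('a, 'b) ring_scheme) TYPE('c)\<^esub> # map Rep_model (rev ds)) z = \<zero>\<^bsub>model_ring TYPE(('a, 'b) ring_scheme) TYPE('c)\<^esub>"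
    using root_closed_model_ring[of "TYPE(('a, 'b) ring_scheme)" "TYPE('c)"] \<phi>_carrier unfolding root_closed_def
    by (elim allE[of _ "map Rep_model (rev ds)"]) auto
  then obtain z where z: "z \<in> carrier (model_ring TYPE(('a, 'b) ring_scheme) TYPE('c))"
    "eval (map Rep_model (1 # rev ds)) z = \<zero>\<^bsub>model_ring TYPE(('a, 'b) ring_scheme) TYPE('c)\<^esub>" by (auto simp: \<phi>_one)
  then obtain x :: "('a, 'b, 'c) model" where x: "z = Rep_model x" by (metis Abs_model_inverse)
  have "Poly (rev (1 # rev ds)) = p" using ds by (metis Poly_coeffs rev.simps(2) rev_rev_ident)
  then have "Rep_model (poly p x) = \<zero>\<^bsub>model_ring TYPE(('a, 'b) ring_scheme) TYPE('c)\<^esub>"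
    using z(2) \<phi>_eval[of "1 # rev ds" x] by (simp only: x)
  then show "\<exists>x. poly p x = 0" by (auto simp: \<phi>_eq_zero)
qed

theorem henselian_structure_exists:
  fixes R :: "('a, 'm) ring_scheme" and v :: "'a \<Rightarrow> 'g::linordered_ab_group_add"
  assumes "field R" "root_closed R" "valuation_on R (carrier R) v" "subfield K R"
    "\<And>x. x \<in> carrier R \<Longrightarrow> (ring.algebraic R over K) x"
  shows "henselian_structure R v K"
proof (rule ccontr)
  assume "\<not> ?thesis"
  then have "counterexample TYPE('g) R" using assms by (auto simp: counterexample_def)
  then have ex: "\<exists>R :: ('a, 'm) ring_scheme. counterexample TYPE('g) R" by blast
  \<comment> \<open>R0 is the field that the model was built from and may differ from R. It violates
    the claim for a valuation and a subfield of its own, which is all that the contradiction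
    needs.\<close>
  define R0 where "R0 = (SOME R :: ('a, 'm) ring_scheme. counterexample TYPE('g) R)"
  have R0: "counterexample TYPE('g) R0" unfolding R0_def by (rule someI_ex[OF ex])
  let ?M = "model_ring TYPE(('a, 'm) ring_scheme) TYPE('g)"
  have M: "?M = image_ring Inl R0" using ex by (simp add: model_ring_def R0_def)
  have hom: "Inl \<in> ring_hom R0 ?M"
    unfolding M using inj_imp_image_ring_iso[of "Inl :: 'a \<Rightarrow> 'a + complex" R0] by (simp add: ring_iso_def)
  have car: "carrier ?M = Inl ` carrier R0" unfolding M by (rule image_ring_carrier)
  define \<phi> :: "('a, 'm, 'g) model \<Rightarrow> 'a" where "\<phi> x = projl (Rep_model x)" for x
  have \<phi>: "Rep_model x = Inl (\<phi> x)" "\<phi> x \<in> carrier R0" for x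
    using Rep_model[of x] unfolding car by (auto simp: \<phi>_def)
  interpret field R0 using R0 by (simp add: counterexample_def)
  have "typed_field R0 \<phi>"
  proof unfold_locales
    show "bij_betw \<phi> UNIV (carrier R0)"
    proof (rule bij_betwI[where g = "\<lambda>a. Abs_model (Inl a)"])
      show "Abs_model (Inl (\<phi> x)) = x" for x by (simp add: Rep_model_inverse flip: \<phi>(1))
      show "\<phi> (Abs_model (Inl a)) = a" if "a \<in> carrier R0" for a
        using that by (simp add: \<phi>_def Abs_model_inverse car)
    qed (use \<phi>(2) in auto)
    fix x y
    have "Inl (\<phi> (x + y)) = (Inl (\<phi> x \<oplus>\<^bsub>R0\<^esub> \<phi> y) :: 'a + complex)"
      using ring_hom_add[OF hom \<phi>(2) \<phi>(2)] by (simp add: Rep_model_ops flip: \<phi>(1))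
    then show "\<phi> (x + y) = \<phi> x \<oplus>\<^bsub>R0\<^esub> \<phi> y" by simp
    have "Inl (\<phi> (x * y)) = (Inl (\<phi> x \<otimes>\<^bsub>R0\<^esub> \<phi> y) :: 'a + complex)"
      using ring_hom_mult[OF hom \<phi>(2) \<phi>(2)] by (simp add: Rep_model_ops flip: \<phi>(1))
    then show "\<phi> (x * y) = \<phi> x \<otimes>\<^bsub>R0\<^esub> \<phi> y" by simp
    have "Inl (\<phi> 1) = (Inl \<one>\<^bsub>R0\<^esub> :: 'a + complex)"
      using ring_hom_one[OF hom] by (simp add: Rep_model_ops flip: \<phi>(1))
    then show "\<phi> 1 = \<one>\<^bsub>R0\<^esub>" by simp
  qed
  from henselian_structure_typed[OF this] show False
    using R0 by (auto simp: counterexample_def)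
qed

section \<open>Generation of the valuation ring\<close>

text \<open>Serves to exclude an infinite residue field extension, for which a statement about
  \<open>dim\<close> would carry no information.\<close>

lemma (in ring) independent_list_exists:
  assumes "subfield K R" "infinite_dimension K (carrier R)"
  shows "\<exists>Us. independent K Us \<and> length Us = n"
proof (induction n)
  case (Suc n)
  then obtain Us where Us: "independent K Us" "length Us = n" by blast
  then have "Span K Us \<noteq> carrier R"
    using assms(2) dimension_independent finite_dimensionI by metis
  moreover have "Span K Us \<subseteq> carrier R"
    using Span_subgroup_props(1)[OF assms(1) independent_in_carrier[OF Us(1)]] .
  ultimately obtain u where "u \<in> carrier R" "u \<notin> Span K Us" by blast
  with Us show ?case by (intro exI[of _ "u # Us"]) (auto intro: li_Cons)
qed auto

lemma unique_extension_mono: "unique_extension R v F \<Longrightarrow> F \<subseteq> E \<Longrightarrow> unique_extension R v E"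
  unfolding unique_extension_def valuation_extends_def by blast

section \<open>Valuation ring, residue field and lifts in a carrier field\<close>

locale valued_extension = field \<Omega> for \<Omega> :: "('a, 'm) ring_scheme" (structure) +
  fixes v :: "'a \<Rightarrow> 'g::linordered_ab_group_add" and K L :: "'a set"
  assumes valuation: "valuation_on \<Omega> (carrier \<Omega>) v"
    and subfield_K: "subfield K \<Omega>" and subfield_L: "subfield L \<Omega>" and K_sub_L: "K \<subseteq> L"
begin

abbreviation "V \<equiv> val_ring \<Omega> K v"
abbreviation "W \<equiv> val_ring \<Omega> L v"
abbreviation "M \<equiv> val_ideal \<Omega> L v"
abbreviation "Ow \<equiv> \<Omega>\<lparr>carrier := W\<rparr>"

lemma v_mult: "x \<in> carrier \<Omega> \<Longrightarrow> y \<in> carrier \<Omega> \<Longrightarrow> x \<noteq> \<zero> \<Longrightarrow> y \<noteq> \<zero> \<Longrightarrow> v (x \<otimes> y) = v x + v y"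
  and v_add: "x \<in> carrier \<Omega> \<Longrightarrow> y \<in> carrier \<Omega> \<Longrightarrow> x \<noteq> \<zero> \<Longrightarrow> y \<noteq> \<zero> \<Longrightarrow> x \<oplus> y \<noteq> \<zero> \<Longrightarrow>
    min (v x) (v y) \<le> v (x \<oplus> y)"
  using valuation unfolding valuation_on_def by blast+

lemma v_one: "v \<one> = 0"
  using v_mult[of \<one> \<one>] by simp

lemma v_minus: "x \<in> carrier \<Omega> \<Longrightarrow> x \<noteq> \<zero> \<Longrightarrow> v (\<ominus> x) = v x"
proof -
  assume x: "x \<in> carrier \<Omega>" "x \<noteq> \<zero>"
  have nz: "\<ominus> \<one> \<noteq> \<zero>" using minus_minus[OF one_closed] by (metis minus_zero one_not_zero)
  have "\<ominus> \<one> \<otimes> \<ominus> \<one> = \<one>" by (simp add: l_minus r_minus)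
  then have "v (\<ominus> \<one>) + v (\<ominus> \<one>) = 0" using v_mult[of "\<ominus> \<one>" "\<ominus> \<one>"] nz v_one by simp
  then have "v (\<ominus> \<one>) = 0" by (simp add: double_zero)
  then show ?thesis using v_mult[of "\<ominus> \<one>" x] nz x by (simp add: l_minus)
qed

lemma inv_nonzero: "x \<in> carrier \<Omega> \<Longrightarrow> x \<noteq> \<zero> \<Longrightarrow> inv x \<in> carrier \<Omega> \<and> inv x \<noteq> \<zero> \<and> x \<otimes> inv x = \<one>"
proof -
  assume x: "x \<in> carrier \<Omega>" "x \<noteq> \<zero>"
  then have u: "x \<in> Units \<Omega>" by (simp add: field_Units)
  then have i: "inv x \<in> carrier \<Omega>" "x \<otimes> inv x = \<one>" by (simp_all add: Units_inv_closed Units_r_inv)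
  then have "inv x \<noteq> \<zero>" using x by (metis r_null one_not_zero)
  with i show ?thesis by blast
qed

lemma v_inv: "x \<in> carrier \<Omega> \<Longrightarrow> x \<noteq> \<zero> \<Longrightarrow> v (inv x) = - v x"
proof -
  assume x: "x \<in> carrier \<Omega>" "x \<noteq> \<zero>"
  then have "v x + v (inv x) = 0" using v_mult[of x "inv x"] inv_nonzero[of x] v_one by simp
  then show ?thesis by (simp add: eq_neg_iff_add_eq_0 add.commute)
qed

lemma L_carrier: "x \<in> L \<Longrightarrow> x \<in> carrier \<Omega>"
  using subfieldE(3)[OF subfield_L] by auto

lemma W_carrier: "x \<in> W \<Longrightarrow> x \<in> carrier \<Omega>"
  using L_carrier by (auto simp: val_ring_def)

lemma M_sub_W: "M \<subseteq> W"
  by (auto simp: val_ring_def val_ideal_def)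

lemma subring_val_ring: assumes "subfield F \<Omega>" shows "subring (val_ring \<Omega> F v) \<Omega>"
proof -
  have car: "x \<in> F \<Longrightarrow> x \<in> carrier \<Omega>" for x using subfieldE(3)[OF assms] by auto
  note F = subringE[OF subfieldE(1)[OF assms]]
  show ?thesis
  proof (rule subringI)
    fix x y assume xy: "x \<in> val_ring \<Omega> F v" "y \<in> val_ring \<Omega> F v"
    then have c: "x \<in> carrier \<Omega>" "y \<in> carrier \<Omega>" "x \<in> F" "y \<in> F" using car by (auto simp: val_ring_def)
    show "x \<otimes> y \<in> val_ring \<Omega> F v"
    proof (cases "x = \<zero> \<or> y = \<zero>")
      case True then show ?thesis using c xy by (auto simp: val_ring_def F(2))
    next
      case False then show ?thesis using c xy v_mult[of x y] by (auto simp: val_ring_def F(6))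
    qed
    show "x \<oplus> y \<in> val_ring \<Omega> F v"
    proof (cases "x = \<zero> \<or> y = \<zero> \<or> x \<oplus> y = \<zero>")
      case True then show ?thesis using c xy by (auto simp: val_ring_def F(2))
    next
      case False
      moreover have "0 \<le> v x" "0 \<le> v y" using False xy by (auto simp: val_ring_def)
      ultimately have "0 \<le> v (x \<oplus> y)" using v_add[OF c(1,2)] by (meson min.bounded_iff order_trans)
      then show ?thesis using c by (auto simp: val_ring_def F(7))
    qed
    show "\<ominus> x \<in> val_ring \<Omega> F v"
      using c xy v_minus[of x] F(2,5) by (cases "x = \<zero>") (auto simp: val_ring_def)
  qed (use car F v_one in \<open>auto simp: val_ring_def\<close>)
qed

lemma ring_Ow: "cring Ow"
  using subcring_iff[OF subringE(1)] subcringI' subring_val_ring[OF subfield_L] by blast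

lemma ideal_M: "ideal M Ow"
proof -
  interpret O: cring Ow by (rule ring_Ow)
  note W = subringE[OF subring_val_ring[OF subfield_L]] and F = subringE[OF subfieldE(1)[OF subfield_L]]
  have mult: "a \<otimes> x \<in> M" if "a \<in> M" "x \<in> W" for a x
  proof (cases "a = \<zero> \<or> x = \<zero>")
    case True
    then show ?thesis using that F(2) L_carrier by (auto simp: val_ring_def val_ideal_def)
  next
    case False
    then show ?thesis
      using that v_mult[of a x] L_carrier F(6) by (auto simp: val_ring_def val_ideal_def add_pos_nonneg)
  qed
  show ?thesis
  proof (rule idealI)
    show "ring Ow" by (rule O.ring_axioms)
    show "subgroup M (add_monoid Ow)"
    proof (rule O.add.subgroupI)
      fix a b assume ab: "a \<in> M" "b \<in> M"
      then have c: "a \<in> carrier \<Omega>" "b \<in> carrier \<Omega>" "a \<in> L" "b \<in> L" using L_carrier by (auto simp: val_ideal_def)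
      have "\<ominus> \<one> \<in> W" using W(3,5) by auto
      then have "a \<otimes> \<ominus> \<one> \<in> M" using mult[OF ab(1)] by blast
      then have "\<ominus> a \<in> M" using c by (simp add: r_minus)
      moreover have "\<ominus>\<^bsub>Ow\<^esub> a = \<ominus> a"
        using O.minus_equality[of "\<ominus> a" a] calculation M_sub_W ab c by (auto simp: l_neg)
      ultimately show "\<ominus>\<^bsub>Ow\<^esub> a \<in> M" by (simp only:)
      show "a \<oplus>\<^bsub>Ow\<^esub> b \<in> M"
      proof (cases "a = \<zero> \<or> b = \<zero> \<or> a \<oplus> b = \<zero>")
        case True then show ?thesis using c ab by (auto simp: val_ideal_def F(2))
      next
        case False
        moreover have "0 < v a" "0 < v b" using False ab by (auto simp: val_ideal_def)
        ultimately have "0 < v (a \<oplus> b)" using v_add[OF c(1,2)] by (auto simp: min_def split: if_splits)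
        then show ?thesis using c by (auto simp: val_ideal_def F(7))
      qed
    qed (use M_sub_W F(2) in \<open>auto simp: val_ideal_def\<close>)
    fix a x assume ax: "a \<in> M" "x \<in> carrier Ow"
    then show "a \<otimes>\<^bsub>Ow\<^esub> x \<in> M" using mult by simp
    moreover have "x \<otimes> a = a \<otimes> x" using ax M_sub_W W_carrier by (auto intro: m_comm)
    ultimately show "x \<otimes>\<^bsub>Ow\<^esub> a \<in> M" by simp
  qed
qed

lemma val_unit: "s \<in> W - M \<Longrightarrow> s \<noteq> \<zero> \<and> v s = 0 \<and> inv s \<in> W"
proof -
  assume s: "s \<in> W - M"
  then have s': "s \<in> L" "s \<noteq> \<zero>" "v s = 0" by (auto simp: val_ring_def val_ideal_def)
  then have "inv s \<in> L" using subfield_m_inv[OF subfield_L] by auto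
  then show ?thesis using s' v_inv[of s] L_carrier[of s] by (auto simp: val_ring_def)
qed

lemma residue_field: "field (Ow Quot M)"
proof -
  have "maximalideal M Ow"
  proof (rule maximalidealI)
    show "carrier Ow \<noteq> M"
      using subringE(3)[OF subring_val_ring[OF subfield_L]] v_one by (auto simp: val_ideal_def)
    fix J assume J: "ideal J Ow" "M \<subseteq> J" "J \<subseteq> carrier Ow"
    interpret J: ideal J Ow by (rule J)
    show "J = M \<or> J = carrier Ow"
    proof (rule disjCI)
      assume "J \<noteq> carrier Ow"
      have False if "s \<in> J" "s \<notin> M" for s
      proof -
        have s: "s \<in> W - M" using that J(3) by auto
        then have "s \<otimes> inv s \<in> J" using J.I_r_closed[OF that(1), of "inv s"] val_unit[OF s] by simp
        then have "\<one> \<in> J" using inv_nonzero[of s] val_unit[OF s] s W_carrier by auto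
        then show False using J.one_imp_carrier \<open>J \<noteq> carrier Ow\<close> by auto
      qed
      then show "J = M" using J(2) by blast
    qed
  qed (rule ideal_M)
  then show ?thesis using maximalideal.quotient_is_field[OF _ ring_Ow] by blast
qed

lemma V_sub_W: "V \<subseteq> W"
  using K_sub_L by (auto simp: val_ring_def)

lemma subfield_residue: "subfield ((+>\<^bsub>Ow\<^esub>) M ` V) (Ow Quot M)"
proof -
  interpret Q: field "Ow Quot M" by (rule residue_field)
  interpret h: ring_hom_ring Ow "Ow Quot M" "(+>\<^bsub>Ow\<^esub>) M" by (rule ideal.rcos_ring_hom_ring[OF ideal_M])
  interpret I: ideal M Ow by (rule ideal_M)
  have "subring V Ow"
    using ring.ring_incl_imp_subring[OF cring.axioms(1)[OF ring_Ow], of V] V_sub_W subring_is_ring[OF subring_val_ring[OF subfield_K]] by simp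
  then have sub: "subring ((+>\<^bsub>Ow\<^esub>) M ` V) (Ow Quot M)"
    using h.img_is_subring by blast
  show ?thesis
  proof (rule Q.subfieldI'[OF sub])
    fix k assume k: "k \<in> (+>\<^bsub>Ow\<^esub>) M ` V - {\<zero>\<^bsub>Ow Quot M\<^esub>}"
    then obtain x where x: "x \<in> V" "k = M +>\<^bsub>Ow\<^esub> x" by auto
    have xW: "x \<in> W" using x V_sub_W by auto
    have "x \<notin> M" using k x I.a_rcos_const xW by (auto simp: FactRing_def)
    then have u: "x \<noteq> \<zero>" "v x = 0" using val_unit xW by auto
    then have iK: "inv x \<in> V"
      using subfield_m_inv[OF subfield_K, of x] x v_inv[of x] W_carrier[OF xW] by (auto simp: val_ring_def)
    then have iW: "inv x \<in> W" using V_sub_W by auto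
    have "k \<otimes>\<^bsub>Ow Quot M\<^esub> (M +>\<^bsub>Ow\<^esub> inv x) = M +>\<^bsub>Ow\<^esub> (x \<otimes>\<^bsub>Ow\<^esub> inv x)"
      using h.hom_mult[of x "inv x"] xW iW x by simp
    also have "\<dots> = \<one>\<^bsub>Ow Quot M\<^esub>" using h.hom_one inv_nonzero[of x] u W_carrier[OF xW] by simp
    finally have "inv\<^bsub>Ow Quot M\<^esub> k = M +>\<^bsub>Ow\<^esub> inv x"
      using Q.comm_inv_char[of k "M +>\<^bsub>Ow\<^esub> inv x"] h.hom_closed xW iW x by simp
    then show "inv\<^bsub>Ow Quot M\<^esub> k \<in> (+>\<^bsub>Ow\<^esub>) M ` V" using iK by auto
  qed
qed

lemma combine_Ow: "ring.combine Ow Ks Us = combine Ks Us"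
proof -
  interpret O: cring Ow by (rule ring_Ow)
  show ?thesis by (induction Ks Us rule: combine.induct) auto
qed

text \<open>A combination of the lifts lies in M exactly when the combination of the residues
  vanishes, so independence forces the residues of all coefficients to be zero.\<close>

lemma residue_lift:
  assumes "ring.independent (Ow Quot M) ((+>\<^bsub>Ow\<^esub>) M ` V) Bs"
  shows "\<exists>ys. set ys \<subseteq> W \<and> length ys = length Bs \<and>
    (\<forall>Ks. set Ks \<subseteq> V \<and> length Ks = length ys \<and> combine Ks ys \<in> M \<longrightarrow> set Ks \<subseteq> M)"
proof -
  let ?h = "(+>\<^bsub>Ow\<^esub>) M"
  interpret Q: field "Ow Quot M" by (rule residue_field)
  interpret h: ring_hom_ring Ow "Ow Quot M" ?h by (rule ideal.rcos_ring_hom_ring[OF ideal_M])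
  interpret I: ideal M Ow by (rule ideal_M)
  have "\<forall>B\<in>set Bs. \<exists>y. y \<in> W \<and> ?h y = B"
    using Q.independent_in_carrier[OF assms] by (auto simp: FactRing_def A_RCOSETS_def')
  then obtain g where "\<forall>B\<in>set Bs. g B \<in> W \<and> ?h (g B) = B" by (rule bchoice[THEN exE])
  then have g: "g B \<in> W" "?h (g B) = B" if "B \<in> set Bs" for B using that by blast+
  define ys where "ys = map g Bs"
  have ys: "set ys \<subseteq> W" "length ys = length Bs" using g(1) by (auto simp: ys_def)
  have map_ys: "map ?h ys = Bs" unfolding ys_def map_map comp_def using g(2) by (intro map_idI)
  have "set Ks \<subseteq> M" if Ks: "set Ks \<subseteq> V" "length Ks = length ys" "combine Ks ys \<in> M" for Ks
  proof -
    have KW: "set Ks \<subseteq> W" using Ks(1) V_sub_W by blast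
    have "Q.combine (map ?h Ks) (map ?h ys) = ?h (combine Ks ys)"
      using h.combine_hom[of Ks ys] KW ys(1) by (simp add: combine_Ow)
    also have "\<dots> = \<zero>\<^bsub>Ow Quot M\<^esub>" using I.a_rcos_const Ks(3) M_sub_W by (auto simp: FactRing_def)
    finally have "Q.combine (map ?h Ks) Bs = \<zero>\<^bsub>Ow Quot M\<^esub>" by (simp only: map_ys)
    then have "set (take (length Bs) (map ?h Ks)) \<subseteq> {\<zero>\<^bsub>Ow Quot M\<^esub>}"
      using Q.independent_imp_trivial_combine[OF subfield_residue assms, of "map ?h Ks"] Ks(1) by auto
    then have "?h k = M" if "k \<in> set Ks" for k
      using that Ks(2) ys(2) by (auto simp: FactRing_def)
    moreover have "k \<in> ?h k" if "k \<in> set Ks" for k using I.a_rcos_self that KW by auto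
    ultimately show ?thesis by blast
  qed
  with ys show ?thesis by blast
qed

text \<open>The index is a cardinality, and \<open>card\<close> is 0 on infinite sets; being
  nonzero, it counts a finite set that can be listed.\<close>

lemma value_lift:
  assumes "init_index \<Omega> K v L v \<noteq> 0"
  shows "\<exists>zs. set zs \<subseteq> W - {\<zero>} \<and> length zs = init_index \<Omega> K v L v \<and> distinct (map v zs) \<and>
    (\<forall>z \<in> set zs. \<forall>k \<in> K - {\<zero>}. 0 < v k \<longrightarrow> v z < v k)"
proof -
  define E where "E = {\<gamma> \<in> value_group \<Omega> L v. 0 \<le> \<gamma> \<and> (\<forall>\<delta> \<in> value_group \<Omega> K v. 0 < \<delta> \<longrightarrow> \<gamma> < \<delta>)}"
  have card: "card E = init_index \<Omega> K v L v" by (simp add: init_index_def E_def)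
  then have "finite E" using assms by (metis card.infinite)
  then obtain gs where gs: "set gs = E" "distinct gs" using finite_distinct_list by blast
  have "\<forall>\<gamma>\<in>E. \<exists>z. z \<in> L - {\<zero>} \<and> v z = \<gamma>" by (auto simp: value_group_def E_def)
  then obtain g where "\<forall>\<gamma>\<in>E. g \<gamma> \<in> L - {\<zero>} \<and> v (g \<gamma>) = \<gamma>" by (rule bchoice[THEN exE])
  then have g: "g \<gamma> \<in> L - {\<zero>}" "v (g \<gamma>) = \<gamma>" if "\<gamma> \<in> E" for \<gamma> using that by blast+
  have "map v (map g gs) = gs" unfolding map_map comp_def by (rule map_idI) (use g(2) gs(1) in blast)
  then have distinct: "distinct (map v (map g gs))" using gs(2) by (simp only:)
  have length: "length (map g gs) = init_index \<Omega> K v L v"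
    using distinct_card[OF gs(2)] gs(1) card by simp
  have zs: "z \<in> W - {\<zero>} \<and> (\<forall>k \<in> K - {\<zero>}. 0 < v k \<longrightarrow> v z < v k)" if "z \<in> set (map g gs)" for z
  proof -
    from that obtain \<gamma> where \<gamma>: "\<gamma> \<in> E" "z = g \<gamma>" using gs by auto
    have z: "z \<in> L - {\<zero>}" "v z = \<gamma>" "\<gamma> \<in> E" using g(1)[OF \<gamma>(1)] g(2)[OF \<gamma>(1)] \<gamma> by (simp_all only:)
    then have "0 \<le> v z" by (simp add: E_def)
    moreover have "v z < v k" if "k \<in> K - {\<zero>}" "0 < v k" for k
    proof -
      have "v k \<in> value_group \<Omega> K v" unfolding value_group_def using that(1) by (rule imageI)
      then show ?thesis using z that(2) by (simp add: E_def)
    qed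
    ultimately show ?thesis using z(1) by (simp add: val_ring_def)
  qed
  have sub: "set (map g gs) \<subseteq> W - {\<zero>}" by (rule subsetI) (rule zs[THEN conjunct1])
  have bound: "\<forall>z \<in> set (map g gs). \<forall>k \<in> K - {\<zero>}. 0 < v k \<longrightarrow> v z < v k"
    by (rule ballI) (rule zs[THEN conjunct2])
  show ?thesis by (rule exI[of _ "map g gs"], intro conjI sub length distinct bound)
qed

lemma products_one: "set ys \<subseteq> carrier \<Omega> \<Longrightarrow> products \<Omega> ys [\<one>] = ys"
  by (induction ys) (auto simp: products_def)

lemma products_in_L: "set ys \<subseteq> W \<Longrightarrow> set zs \<subseteq> W \<Longrightarrow> set (products \<Omega> ys zs) \<subseteq> L"
  using subringE(6)[OF subfieldE(1)[OF subfield_L]] by (auto simp: products_def val_ring_def)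

lemma length_products: "length (products \<Omega> ys zs) = length ys * length zs"
  by (simp add: products_def)

text \<open>Every element of the generated ring outside M is a unit of the valuation ring, so the
  multiplicative set can be taken to consist of all of them. The ring generated in \<Omega> lies in
  the one generated inside the valuation ring, since negatives agree there.\<close>

lemma essentially_fin_gen_val_ring:
  assumes "localized_fin_gen \<Omega> v K L" shows "essentially_fin_gen Ow V"
proof -
  interpret O: cring Ow by (rule ring_Ow)
  note W = subringE[OF subring_val_ring[OF subfield_L]]
  obtain G where G: "finite G" "G \<subseteq> W" and loc: "\<And>w. w \<in> W \<Longrightarrow>
      \<exists>s \<in> generate_ring \<Omega> (V \<union> G). s \<notin> M \<and> s \<otimes> w \<in> generate_ring \<Omega> (V \<union> G)"
    using assms unfolding localized_fin_gen_def by blast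
  have VG: "V \<union> G \<subseteq> carrier Ow" using V_sub_W G by auto
  have minus: "\<ominus>\<^bsub>Ow\<^esub> a = \<ominus> a" if "a \<in> W" for a
    using O.minus_equality[of "\<ominus> a" a] that W(5) W_carrier by (auto simp: l_neg)
  let ?C = "generate_ring Ow (V \<union> G)"
  have CW: "?C \<subseteq> W" using O.generate_ring_in_carrier[OF VG] by auto
  have "generate_ring \<Omega> (V \<union> G) \<subseteq> ?C"
  proof
    fix x assume "x \<in> generate_ring \<Omega> (V \<union> G)"
    then show "x \<in> ?C"
    proof induction
      case one show ?case using generate_ring.one[of Ow] by simp
    next
      case (incl h) then show ?case by (rule generate_ring.incl)
    next
      case (a_inv h)
      then have "h \<in> W" using CW by blast
      then show ?case using generate_ring.a_inv[OF a_inv.IH] by (simp only: minus)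
    next
      case (eng_add a b) show ?case using generate_ring.eng_add[OF eng_add.IH] by simp
    next
      case (eng_mult a b) show ?case using generate_ring.eng_mult[OF eng_mult.IH] by simp
    qed
  qed
  then have loc: "\<exists>s \<in> ?C. s \<notin> M \<and> s \<otimes> w \<in> ?C" if "w \<in> W" for w using loc[OF that] by blast
  define S where "S = ?C - M"
  have SW: "s \<in> W - M" if "s \<in> S" for s using that CW by (auto simp: S_def)
  have inv: "inv\<^bsub>Ow\<^esub> s = inv s \<and> s \<in> Units Ow" if "s \<in> S" for s
  proof -
    note s = SW[OF that] val_unit[OF SW[OF that]]
    have r: "s \<otimes>\<^bsub>Ow\<^esub> inv s = \<one>\<^bsub>Ow\<^esub>" using inv_nonzero[of s] s W_carrier by simp
    have c: "s \<in> carrier Ow" "inv s \<in> carrier Ow" using s by auto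
    have l: "inv s \<otimes>\<^bsub>Ow\<^esub> s = \<one>\<^bsub>Ow\<^esub>" using O.m_comm[OF c] r by (simp only:)
    have "s \<in> Units Ow" unfolding Units_def using c r l by blast
    moreover have "inv\<^bsub>Ow\<^esub> s = inv s" by (rule O.comm_inv_char[OF c r])
    ultimately show ?thesis by blast
  qed
  have "submonoid S Ow"
  proof
    show "S \<subseteq> carrier Ow" using CW by (auto simp: S_def)
    show "\<one>\<^bsub>Ow\<^esub> \<in> S" using generate_ring.one[of Ow] v_one by (auto simp: S_def val_ideal_def)
    fix s t assume st: "s \<in> S" "t \<in> S"
    then have "s \<otimes> t \<in> ?C" using generate_ring.eng_mult[of s Ow "V \<union> G" t] by (simp add: S_def)
    moreover have "s \<otimes> t \<notin> M"
    proof -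
      note s = val_unit[OF SW[OF st(1)]] and t = val_unit[OF SW[OF st(2)]]
      have c: "s \<in> carrier \<Omega>" "t \<in> carrier \<Omega>" using SW st W_carrier by auto
      then have "v (s \<otimes> t) = 0" "s \<otimes> t \<noteq> \<zero>" using v_mult[of s t] s t integral[of s t] by auto
      then show ?thesis by (auto simp: val_ideal_def)
    qed
    ultimately show "s \<otimes>\<^bsub>Ow\<^esub> t \<in> S" by (simp add: S_def)
  qed
  moreover have "carrier Ow = {c \<otimes>\<^bsub>Ow\<^esub> inv\<^bsub>Ow\<^esub> s | c s. c \<in> ?C \<and> s \<in> S}"
  proof (intro equalityI subsetI)
    fix w assume w: "w \<in> carrier Ow"
    then obtain s where s: "s \<in> ?C" "s \<notin> M" "s \<otimes> w \<in> ?C" using loc[of w] by auto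
    then have sS: "s \<in> S" by (simp add: S_def)
    then have c: "s \<in> carrier \<Omega>" "s \<noteq> \<zero>" "w \<in> carrier \<Omega>" using SW[OF sS] val_unit[OF SW[OF sS]] W_carrier w by auto
    then have "w = (s \<otimes> w) \<otimes> inv s"
      using inv_nonzero[OF c(1,2)] by (metis l_one m_assoc m_comm)
    then have "w = (s \<otimes> w) \<otimes>\<^bsub>Ow\<^esub> inv\<^bsub>Ow\<^esub> s" using inv[OF sS] by simp
    then show "w \<in> {c \<otimes>\<^bsub>Ow\<^esub> inv\<^bsub>Ow\<^esub> s | c s. c \<in> ?C \<and> s \<in> S}" using s sS by blast
  next
    fix w assume "w \<in> {c \<otimes>\<^bsub>Ow\<^esub> inv\<^bsub>Ow\<^esub> s | c s. c \<in> ?C \<and> s \<in> S}"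
    then obtain c s where w: "w = c \<otimes>\<^bsub>Ow\<^esub> inv\<^bsub>Ow\<^esub> s" and "c \<in> ?C" "s \<in> S" by blast
    then have "c \<in> carrier Ow" "s \<in> Units Ow" using CW inv by auto
    then show "w \<in> carrier Ow" unfolding w by (intro O.m_closed O.Units_inv_closed)
  qed
  ultimately show ?thesis
    unfolding essentially_fin_gen_def using G inv
    by (intro exI[of _ G] exI[of _ S] conjI) (simp_all add: S_def subset_iff)
qed

text \<open>The e f products of residue and value lifts are independent over H and lie in HL, whose
  dimension over H is e f, so they span HL and in particular L. Before that, \<open>dim\<close> has
  to be given its meaning: HL must be shown finite over H, and the residue extension finite as
  well.\<close>

theorem localized_fin_gen_if_defectless:
  assumes alg: "\<And>x. x \<in> carrier \<Omega> \<Longrightarrow> (algebraic over K) x"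
    and fin: "finite_dimension K L" and hK: "henselian_structure \<Omega> v K" and hL: "henselian_structure \<Omega> v L"
    and defect: "dim (henselization \<Omega> v K) (henselization \<Omega> v L) = init_index \<Omega> K v L v * res_degree \<Omega> K v L v"
      "init_index \<Omega> K v L v \<noteq> 0" "res_degree \<Omega> K v L v \<noteq> 0"
  shows "localized_fin_gen \<Omega> v K L"
proof -
  obtain H where H: "subfield H \<Omega>" "K \<subseteq> H" "unique_extension \<Omega> v H"
    "\<forall>F. subfield F \<Omega> \<and> K \<subseteq> F \<and> unique_extension \<Omega> v F \<longrightarrow> H \<subseteq> F"
    and str: "\<forall>L ys zs xs. subfield L \<Omega> \<and> K \<subseteq> L \<and> standard_family \<Omega> v K L ys zs \<longrightarrow>
      (\<forall>Ks. set Ks \<subseteq> H \<and> length Ks = length (products \<Omega> ys zs) \<and>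
        combine Ks (products \<Omega> ys zs) = \<zero> \<longrightarrow> set Ks \<subseteq> {\<zero>}) \<and>
      (set xs \<subseteq> L \<and> L \<subseteq> list_span \<Omega> K xs \<and> L \<subseteq> list_span \<Omega> H (products \<Omega> ys zs)
        \<longrightarrow> localized_fin_gen \<Omega> v K L)"
    using hK unfolding henselian_structure_def by (elim exE conjE)
  note str = str[rule_format, OF conjI[OF subfield_L conjI[OF K_sub_L]]]
  obtain HL where HL: "subfield HL \<Omega>" "L \<subseteq> HL" "unique_extension \<Omega> v HL"
    "\<forall>F. subfield F \<Omega> \<and> L \<subseteq> F \<and> unique_extension \<Omega> v F \<longrightarrow> HL \<subseteq> F"
    using hL unfolding henselian_structure_def by (elim exE conjE)
  have hens: "henselization \<Omega> v K = H" "henselization \<Omega> v L = HL"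
    unfolding henselization_def by (rule Least_equality; use H HL in blast)+
  have "H \<subseteq> HL" using H(4) HL K_sub_L by blast
  obtain n where n: "dimension n K L" using finite_dimensionE[OF subfield_K fin] by blast
  then obtain xs where xs: "set xs \<subseteq> carrier \<Omega>" "Span K xs = L"
    using exists_base[OF subfield_K] by blast
  then have xsL: "set xs \<subseteq> L" using Span_base_incl[OF subfield_K] by blast
  have span_K: "L \<subseteq> list_span \<Omega> K xs"
    using xs Span_eq_combine_set_length_version[OF subfield_K xs(1)] by (auto simp: list_span_def)
  \<comment> \<open>An upper bound for HL: E is finite over H, contains L, and has the unique
    extension property because it contains H. Minimality of HL then gives HL \<subseteq> E.\<close>
  define E where "E = finite_extension H xs"
  have algH: "\<And>x. x \<in> set xs \<Longrightarrow> (algebraic over H) x" using alg xs algebraic_mono[OF H(2)] by blast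
  have E: "subfield E \<Omega>" "finite_dimension H E" "H \<subseteq> E" "set xs \<subseteq> E"
    unfolding E_def
    using finite_extension_is_subfield[OF H(1)] finite_extension_finite_dimension[OF H(1)]
      finite_extension_incl[OF subfieldE(3)[OF H(1)]] finite_extension_mem[OF subfieldE(1)[OF H(1)]] algH xs
    by blast+
  have "L \<subseteq> E"
  proof -
    have "combine Ks xs \<in> E" if "set Ks \<subseteq> K" for Ks
      using that E(4)
    proof (induction Ks xs rule: combine.induct)
      case (1 k Ks u Us)
      then show ?case using H(2) E(3) subringE(6,7)[OF subfieldE(1)[OF E(1)]] by auto
    qed (use subringE(2)[OF subfieldE(1)[OF E(1)]] in auto)
    then show ?thesis using span_K by (auto simp: list_span_def)
  qed
  then have "HL \<subseteq> E" using HL(4) E unique_extension_mono[OF H(3) E(3)] by blast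
  moreover have "subalgebra H HL \<Omega>"
  proof (intro subalgebra.intro subalgebra_axioms.intro)
    show "subgroup HL (add_monoid \<Omega>)" using subring.axioms(1)[OF subfieldE(1)[OF HL(1)]] .
    show "k \<otimes> w \<in> HL" if "k \<in> H" "w \<in> HL" for k w
      using that \<open>H \<subseteq> HL\<close> subringE(6)[OF subfieldE(1)[OF HL(1)]] by blast
  qed
  ultimately have fin_HL: "finite_dimension H HL"
    using subalbegra_incl_imp_finite_dimension[OF H(1) E(2)] by blast
  define e f where "e = init_index \<Omega> K v L v" "f = res_degree \<Omega> K v L v"
  have dim: "dimension (e * f) H HL"
    using finite_dimensionE[OF H(1) fin_HL] defect(1) hens by (simp add: e_f_def over_def)
  have independent: "independent H (products \<Omega> ys zs)" if st: "standard_family \<Omega> v K L ys zs" for ys zs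
  proof (rule trivial_combine_imp_independent[OF H(1)])
    let ?U = "products \<Omega> ys zs"
    show U: "set ?U \<subseteq> carrier \<Omega>"
      using products_in_L[of ys zs] st L_carrier unfolding standard_family_def by blast
    fix Ks assume Ks: "set Ks \<subseteq> H" "combine Ks ?U = \<zero>"
    \<comment> \<open>The criterion for independence admits coefficient lists of any length, whereas
      \<open>str\<close> speaks of lists of the right length; the list is cut or padded with
      zeros.\<close>
    then obtain Ks' where Ks': "set (take (length ?U) Ks) \<subseteq> set Ks'" "set Ks' \<subseteq> set (take (length ?U) Ks) \<union> {\<zero>}"
      "length Ks' = length ?U" "combine Ks' ?U = \<zero>"
      using combine_normalize[of Ks ?U \<zero>] U subfieldE(3)[OF H(1)] by blast
    have "set Ks' \<subseteq> H"
      using Ks'(2) Ks(1) subringE(2)[OF subfieldE(1)[OF H(1)]] set_take_subset[of "length ?U" Ks] by blast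
    then show "set (take (length ?U) Ks) \<subseteq> {\<zero>}" using conjunct1[OF str[OF st]] Ks' by blast
  qed
  interpret Q: field "Ow Quot M" by (rule residue_field)
  let ?k = "(+>\<^bsub>Ow\<^esub>) M ` V"
  have "\<exists>Bs. Q.independent ?k Bs \<and> length Bs = f"
  proof (cases "Q.finite_dimension ?k (carrier (Ow Quot M))")
    case True
    have "Q.dimension f ?k (carrier (Ow Quot M))"
      using Q.finite_dimensionE[OF subfield_residue True] by (simp add: e_f_def res_degree_def Let_def over_def)
    then show ?thesis using Q.exists_base[OF subfield_residue] by blast
  next
    case False
    \<comment> \<open>One residue more than the dimension e f permits. With the single value
      representative one, their lifts form a standard family and would be independent in HL.\<close>
    then obtain Bs where Bs: "Q.independent ?k Bs" "length Bs = Suc (e * f)"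
      using Q.independent_list_exists[OF subfield_residue] by blast
    then obtain ys where ys: "set ys \<subseteq> W" "length ys = Suc (e * f)"
      "\<forall>Ks. set Ks \<subseteq> V \<and> length Ks = length ys \<and> combine Ks ys \<in> M \<longrightarrow> set Ks \<subseteq> M"
      using residue_lift[OF Bs(1)] by auto
    have "standard_family \<Omega> v K L ys [\<one>]"
      unfolding standard_family_def
      using ys subringE(3)[OF subring_val_ring[OF subfield_L]] v_one by auto
    then have "independent H (products \<Omega> ys [\<one>])" by (rule independent)
    then have "independent H ys" using products_one ys(1) W_carrier by (metis subsetI subset_iff)
    moreover have "set ys \<subseteq> HL" using ys(1) HL(2) by (auto simp: val_ring_def)
    ultimately show ?thesis using independent_length_le_dimension[OF H(1) dim] ys(2) by fastforce
  qed
  then obtain Bs where Bs: "Q.independent ?k Bs" "length Bs = f" by blast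
  then obtain ys where ys: "set ys \<subseteq> W" "length ys = f"
    "\<forall>Ks. set Ks \<subseteq> V \<and> length Ks = length ys \<and> combine Ks ys \<in> M \<longrightarrow> set Ks \<subseteq> M"
    using residue_lift[OF Bs(1)] by auto
  obtain zs where zs: "set zs \<subseteq> W - {\<zero>}" "length zs = e" "distinct (map v zs)"
    "\<forall>z \<in> set zs. \<forall>k \<in> K - {\<zero>}. 0 < v k \<longrightarrow> v z < v k"
    using value_lift defect(2) by (auto simp: e_f_def)
  let ?U = "products \<Omega> ys zs"
  have st: "standard_family \<Omega> v K L ys zs" unfolding standard_family_def using ys zs by auto
  have U: "set ?U \<subseteq> L" using products_in_L ys zs by blast
  then have "Span H ?U = HL"
    using independent_length_eq_dimension[OF H(1) dim independent[OF st]] HL(2) length_products ys zs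
    by (simp add: mult.commute)
  then have "L \<subseteq> list_span \<Omega> H ?U"
    using Span_eq_combine_set_length_version[OF H(1), of ?U] U L_carrier HL(2) by (auto simp: list_span_def)
  then show ?thesis using conjunct2[OF str[OF st]] xsL span_K by blast
qed

end

theorem theorem1p4:
  fixes \<Omega> :: "('a, 'm) ring_scheme"
    and R K L :: "'a set"
    and \<nu> \<omega> \<nu>bar :: "'a \<Rightarrow> 'g::linordered_ab_group_add"
  assumes "algebraic_closure \<Omega> L"
    and "subfield K \<Omega>" and "K \<subseteq> L"
    and "ring.finite_dimension \<Omega> K L" and "separable_extension \<Omega> K L"
    and "subring R \<Omega>" and "is_quotient_field \<Omega> R K"
    and "local_ring (\<Omega>\<lparr>carrier := R\<rparr>)" and "excellent_ring (\<Omega>\<lparr>carrier := R\<rparr>)"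
    and "krull_dim (\<Omega>\<lparr>carrier := R\<rparr>) = 2"
    and "valuation_on \<Omega> K \<nu>" and "centered_at \<Omega> K \<nu> R"
    and "valuation_on \<Omega> L \<omega>" and "valuation_extends \<Omega> K \<nu> \<omega>"
    and "valuation_on \<Omega> (carrier \<Omega>) \<nu>bar" and "valuation_extends \<Omega> L \<omega> \<nu>bar"
    and "defect \<Omega> \<nu>bar K \<nu> L \<omega> = 1"
    and "init_index \<Omega> K \<nu> L \<omega> = ram_index \<Omega> K \<nu> L \<omega>"
  shows "essentially_fin_gen (\<Omega>\<lparr>carrier := val_ring \<Omega> L \<omega>\<rparr>) (val_ring \<Omega> K \<nu>)"
proof -
  interpret algebraic_closure \<Omega> L by fact
  have sL: "subfield L \<Omega>" by (rule subfield_axioms)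
  interpret valued_extension \<Omega> \<nu>bar K L
    by (intro valued_extension.intro valued_extension_axioms.intro field_axioms assms sL)
  \<comment> \<open>From here on \<nu> and \<omega> are replaced by the one valuation on \<Omega>
    that extends both.\<close>
  have eqL: "\<And>x. x \<in> L \<Longrightarrow> x \<noteq> \<zero>\<^bsub>\<Omega>\<^esub> \<Longrightarrow> \<omega> x = \<nu>bar x"
    using assms(16) by (simp add: valuation_extends_def)
  then have eqK: "\<And>x. x \<in> K \<Longrightarrow> x \<noteq> \<zero>\<^bsub>\<Omega>\<^esub> \<Longrightarrow> \<nu> x = \<nu>bar x"
    using assms(3,14) unfolding valuation_extends_def by (metis DiffI singletonD subsetD)
  have vr: "val_ring \<Omega> L \<omega> = val_ring \<Omega> L \<nu>bar" "val_ring \<Omega> K \<nu> = val_ring \<Omega> K \<nu>bar"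
    "val_ideal \<Omega> L \<omega> = val_ideal \<Omega> L \<nu>bar"
    unfolding val_ring_def val_ideal_def by (rule Collect_cong, metis eqL eqK)+
  have vg: "value_group \<Omega> L \<omega> = value_group \<Omega> L \<nu>bar" "value_group \<Omega> K \<nu> = value_group \<Omega> K \<nu>bar"
    using eqL eqK by (auto simp: value_group_def intro!: image_cong)
  \<comment> \<open>Here \<epsilon> = e enters: the ramification index in the defect formula becomes
    the number of available z_j.\<close>
  have e: "ram_index \<Omega> K \<nu> L \<omega> = init_index \<Omega> K \<nu>bar L \<nu>bar"
    using assms(18) by (simp add: init_index_def vg)
  have f: "res_degree \<Omega> K \<nu> L \<omega> = res_degree \<Omega> K \<nu>bar L \<nu>bar"
    by (simp add: res_degree_def vr)
  let ?d = "dim (henselization \<Omega> \<nu>bar K) (henselization \<Omega> \<nu>bar L)"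
    and ?e = "init_index \<Omega> K \<nu>bar L \<nu>bar" and ?f = "res_degree \<Omega> K \<nu>bar L \<nu>bar"
  have d: "rat_of_nat ?d / (rat_of_nat ?e * rat_of_nat ?f) = 1"
    using assms(17) unfolding defect_def e f .
  \<comment> \<open>Division by zero yields 0, so a quotient equal to 1 excludes vanishing indices,
    and with them the default value of \<open>card\<close>.\<close>
  then have nz: "?e \<noteq> 0" "?f \<noteq> 0" by auto
  then have "rat_of_nat ?d = rat_of_nat (?e * ?f)" using d by (simp add: field_simps)
  then have dim: "?d = ?e * ?f" by (simp only: of_nat_eq_iff)
  \<comment> \<open>\<Omega> is given as algebraic over L only; finiteness of L(x) over L and of L
    over K makes x algebraic over K.\<close>
  have alg: "(algebraic over K) x" if x: "x \<in> carrier \<Omega>" for x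
  proof -
    have "finite_dimension L (simple_extension L x)"
      using finite_dimension_simple_extension[OF sL x] algebraic_extension[OF x] by blast
    then have "finite_dimension K (simple_extension L x)"
      using telescopic_base_dim(1)[OF assms(2) sL assms(4)] by blast
    then show ?thesis
      using finite_dimension_imp_algebraic[OF assms(2) simple_extension_is_subring[OF subfieldE(1)[OF sL] x]]
        simple_extension_mem[OF subfieldE(1)[OF sL] x] by blast
  qed
  have "henselian_structure \<Omega> \<nu>bar K" "henselian_structure \<Omega> \<nu>bar L"
    using henselian_structure_exists[OF field_axioms root_closed assms(15)] assms(2) sL alg algebraic_extension
    by blast+
  then show ?thesis
    using essentially_fin_gen_val_ring localized_fin_gen_if_defectless[OF alg assms(4) _ _ dim nz] vr by simp
qed

end
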